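(* Let $q\in\mathbb{C}_p$ satisfy $|q-1|_p<p^{-1/(p-1)}$, $q\neq1$, and let $f,g\in UD(\mathbb{Z}_p,\mathbb{C}_p)$. Then for every $z\in\mathbb{Z}_p$, $$ (f *_q g)(z)=\frac{q-1}{\log q}\, I_q^{(x)}\big(f(x)\,g(z-x)\,q^{-x}\big)-\big(f\otimes_q g'\big)(z),$$ where $I_q^{(x)}$ denotes the $p$-adic $q$-integral with respect to the variable $x$.
   Context: $p$ is a prime, $\mathbb{C}_p$ is the completion of an algebraic closure of $\mathbb{Q}_p$. The element $q\in\mathbb{C}_p$ satisfies $|q-1|_p<p^{-1/(p-1)}$, and $q^x=\exp(x\log q)$ for $x\in\mathbb{Z}_p$; $[x]=\frac{1-q^x}{1-q}$. $UD(\mathbb{Z}_p,\mathbb{C}_p)$ is the space of uniformly differentiable functions $\mathbb{Z}_p\to\mathbb{C}_p$, and $C(\mathbb{Z}_p,\mathbb{C}_p)$ the space of continuous functions. The $p$-adic $q$-integral is $I_q(f)=\lim_{N\to\infty}\frac{1}{[p^N]}\sum_{x=0}^{p^N-1}f(x)q^x$. $C_{p^n}$ is the group of $p^n$-th roots of unity in $\mathbb{C}_p$, $T_p=\bigcup_{n\ge1}C_{p^n}$, and $\sum_w$ means $\lim_{n\to\infty}\sum_{w\in C_{p^n}}$. For a principal unit $\alpha$ of $\mathbb{C}_p$ (e.g. $\alpha\in T_p$ or $\alpha=wq^{-1}$ with $w\in T_p$) let $\phi_\alpha(x)=\alpha^x$, and set $(\hat f_\alpha)_q=I_q(\phi_\alpha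 f)$. The $q$-convolution of $f,g\in UD(\mathbb{Z}_p,\mathbb{C}_p)$ is $f*_q g=\sum_w(\hat f_{wq^{-1}})_q(\hat g_{wq^{-1}})_q\,\phi_{w^{-1}}$, which lies in $UD(\mathbb{Z}_p,\mathbb{C}_p)$. Differentiation induces $UD(\mathbb{Z}_p,\mathbb{C}_p)/\{F: F'=0\}\cong C(\mathbb{Z}_p,\mathbb{C}_p)$, and the convolution $\otimes_q$ on $C(\mathbb{Z}_p,\mathbb{C}_p)$ is defined by $F'\otimes_q G'=-(F*_q G)'$ for $F,G\in UD(\mathbb{Z}_p,\mathbb{C}_p)$; thus $f\otimes_q g'=-(F*_q g)'$ where $F\in UD(\mathbb{Z}_p,\mathbb{C}_p)$ is any function with $F'=f$. *)

theory Defs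
  imports Complex_Main "HOL-Computational_Algebra.Primes"
begin

text \<open>We model C_p as an arbitrary field 'a with an absolute value v :: 'a => real that
  is a non-archimedean absolute value with v(p) = 1/p, complete, algebraically closed,
  and in which the elements algebraic over Q are dense.  These properties characterise
  C_p up to isometric isomorphism.\<close>

definition vtendsto :: "('a::field \<Rightarrow> real) \<Rightarrow> (nat \<Rightarrow> 'a) \<Rightarrow> 'a \<Rightarrow> bool" where
  "vtendsto v X L \<longleftrightarrow> (\<forall>e>0. \<exists>N. \<forall>n\<ge>N. v (X n - L) < e)"

definition vlim :: "('a::field \<Rightarrow> real) \<Rightarrow> (nat \<Rightarrow> 'a) \<Rightarrow> 'a" where
  "vlim v X = (THE L. vtendsto v X L)"

definition is_Cp :: "nat \<Rightarrow> ('a::field_char_0 \<Rightarrow> real) \<Rightarrow> bool" where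
  "is_Cp p v \<longleftrightarrow>
     prime p \<and>
     (\<forall>x. v x \<ge> 0) \<and> (\<forall>x. v x = 0 \<longleftrightarrow> x = 0) \<and>
     (\<forall>x y. v (x * y) = v x * v y) \<and>
     (\<forall>x y. v (x + y) \<le> max (v x) (v y)) \<and>
     v (of_nat p) = 1 / real p \<and>
     (\<forall>X. (\<forall>e>0. \<exists>N. \<forall>m\<ge>N. \<forall>n\<ge>N. v (X m - X n) < e) \<longrightarrow> (\<exists>L. vtendsto v X L)) \<and>
     (\<forall>n>0. \<forall>c::nat \<Rightarrow> 'a. \<exists>x. x ^ n + (\<Sum>i<n. c i * x ^ i) = 0) \<and>
     (\<forall>x. \<forall>e>0. \<exists>y. v (x - y) < e \<and>
        (\<exists>n>0. \<exists>c::nat \<Rightarrow> int. c n \<noteq> 0 \<and> (\<Sum>i\<le>n. of_int (c i) * y ^ i) = 0))"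

definition Zp :: "('a::field \<Rightarrow> real) \<Rightarrow> 'a set" where
  "Zp v = {x. \<exists>s::nat \<Rightarrow> int. vtendsto v (\<lambda>k. of_int (s k)) x}"

definition vexp :: "('a::field_char_0 \<Rightarrow> real) \<Rightarrow> 'a \<Rightarrow> 'a" where
  "vexp v x = vlim v (\<lambda>N. \<Sum>n<N. x ^ n / of_nat (fact n))"

definition vlog :: "('a::field_char_0 \<Rightarrow> real) \<Rightarrow> 'a \<Rightarrow> 'a" where
  "vlog v q = vlim v (\<lambda>N. \<Sum>n\<in>{1..N}. (-1) ^ (n + 1) * (q - 1) ^ n / of_nat n)"

definition qpow :: "('a::field_char_0 \<Rightarrow> real) \<Rightarrow> 'a \<Rightarrow> 'a \<Rightarrow> 'a" where
  "qpow v q x = vexp v (x * vlog v q)"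

definition qnum :: "('a::field_char_0 \<Rightarrow> real) \<Rightarrow> 'a \<Rightarrow> 'a \<Rightarrow> 'a" where
  "qnum v q x = (1 - qpow v q x) / (1 - q)"

definition Iq :: "nat \<Rightarrow> ('a::field_char_0 \<Rightarrow> real) \<Rightarrow> 'a \<Rightarrow> ('a \<Rightarrow> 'a) \<Rightarrow> 'a" where
  "Iq p v q f = vlim v (\<lambda>N. (1 / qnum v q (of_nat (p ^ N))) *
       (\<Sum>x<p ^ N. f (of_nat x) * qpow v q (of_nat x)))"

text \<open>alpha^x for a principal unit alpha and x in Z_p (continuous extension of integer powers).\<close>
definition upow :: "('a::field \<Rightarrow> real) \<Rightarrow> 'a \<Rightarrow> 'a \<Rightarrow> 'a" where
  "upow v \<alpha> x = (THE L. \<forall>s::nat \<Rightarrow> int. vtendsto v (\<lambda>k. of_int (s k)) x \<longrightarrow>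
                          vtendsto v (\<lambda>k. \<alpha> powi (s k)) L)"

definition fhat :: "nat \<Rightarrow> ('a::field_char_0 \<Rightarrow> real) \<Rightarrow> 'a \<Rightarrow> ('a \<Rightarrow> 'a) \<Rightarrow> 'a \<Rightarrow> 'a" where
  "fhat p v q f \<alpha> = Iq p v q (\<lambda>x. upow v \<alpha> x * f x)"

definition roots_pn :: "nat \<Rightarrow> nat \<Rightarrow> 'a::field set" where
  "roots_pn p n = {w. w ^ (p ^ n) = 1}"

definition sum_w :: "nat \<Rightarrow> ('a::field \<Rightarrow> real) \<Rightarrow> ('a \<Rightarrow> 'a) \<Rightarrow> 'a" where
  "sum_w p v F = vlim v (\<lambda>n. \<Sum>w\<in>roots_pn p n. F w)"

definition qconv :: "nat \<Rightarrow> ('a::field_char_0 \<Rightarrow> real) \<Rightarrow> 'a \<Rightarrow> ('a \<Rightarrow> 'a) \<Rightarrow> ('a \<Rightarrow> 'a) \<Rightarrow> 'a \<Rightarrow> 'a" where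
  "qconv p v q f g z = sum_w p v (\<lambda>w. fhat p v q f (w / q) * fhat p v q g (w / q) * upow v (inverse w) z)"

definition vderiv :: "('a::field \<Rightarrow> real) \<Rightarrow> ('a \<Rightarrow> 'a) \<Rightarrow> 'a \<Rightarrow> 'a" where
  "vderiv v f a = (THE L. \<forall>e>0. \<exists>d>0. \<forall>x\<in>Zp v. x \<noteq> a \<and> v (x - a) < d \<longrightarrow>
                        v ((f x - f a) / (x - a) - L) < e)"

definition UD :: "('a::field \<Rightarrow> real) \<Rightarrow> ('a \<Rightarrow> 'a) \<Rightarrow> bool" where
  "UD v f \<longleftrightarrow> (\<exists>d. \<forall>e>0. \<exists>\<delta>>0. \<forall>x\<in>Zp v. \<forall>y\<in>Zp v. \<forall>a\<in>Zp v.
       x \<noteq> y \<and> v (x - a) < \<delta> \<and> v (y - a) < \<delta> \<longrightarrow> v ((f x - f y) / (x - y) - d a) < e)"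

text \<open>The convolution on C(Z_p,C_p): F' (x)_q G' = -(F *_q G)' for UD functions F, G.\<close>
definition qotimes :: "nat \<Rightarrow> ('a::field_char_0 \<Rightarrow> real) \<Rightarrow> 'a \<Rightarrow> ('a \<Rightarrow> 'a) \<Rightarrow> ('a \<Rightarrow> 'a) \<Rightarrow> 'a \<Rightarrow> 'a" where
  "qotimes p v q \<phi> \<psi> z =
     (let F = (SOME F. UD v F \<and> (\<forall>x\<in>Zp v. vderiv v F x = \<phi> x));
          G = (SOME G. UD v G \<and> (\<forall>x\<in>Zp v. vderiv v G x = \<psi> x))
      in - vderiv v (qconv p v q F G) z)"

end

theory Submission
  imports Defs "HOL-Computational_Algebra.Polynomial"
begin

text \<open>Put \<open>c = (q - 1) / log q\<close>. Since \<open>p ^ N / [p ^ N]\<close> tends to \<open>c\<close>, the q-integral of \<open>h\<close> is \<open>c\<close> times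
  the Volkenborn integral of \<open>h(x) q ^ x\<close>; this reduces the claim, up to the factor \<open>c ^ 2\<close>, to the case
  \<open>q = 1\<close>. By orthogonality of the characters of \<open>C_{p ^ n}\<close>, the partial sum over \<open>C_{p ^ n}\<close> in \<open>(f * g)(z)\<close> is
  \<open>H_n(z) = p ^ (- n) \<Sum> A_n(a) B_n(b)\<close>, summed over residues with \<open>a + b \<equiv> z mod p ^ n\<close>, where \<open>A_n(a)\<close> is the
  Volkenborn integral of \<open>y \<mapsto> f(a + p ^ n y)\<close>, and similarly for \<open>B_n\<close> and \<open>g\<close>.
  The expansion \<open>A_n(a) = f(a) - p ^ n f'(a) / 2 + o(p ^ n)\<close> has two consequences.
  First, \<open>H_n(z)\<close> is \<open>p ^ (- n) \<Sum>_{a < p ^ n} f(a) g(z - a)\<close> minus \<open>X(f, g')(z)\<close> up to \<open>o(1)\<close>, where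
  \<open>X(\<phi>, \<psi>)\<close> is the continuous extension of the Cauchy product \<open>m \<mapsto> \<Sum>_{a \<le> m} \<phi>(a) \<psi>(m - a)\<close>.
  Second, \<open>H_{n+1} - H_n\<close> is determined by the \<open>n\<close>-th digit of \<open>z\<close> up to \<open>o(p ^ n)\<close>, which shows
  that the limit \<open>H\<close> is differentiable with derivative \<open>- X(f', g')\<close>; so \<open>X\<close> is the convolution \<open>\<otimes>\<close>.\<close>

text \<open>Every identity at level \<open>n\<close> is finally divided by \<open>p ^ n\<close>, so
  errors have to be carried to o(\<open>p ^ n\<close>) uniformly over the residues. Hence uniform
  differentiability is recast as a linear expansion with error at most \<open>e * v (x - y)\<close>.
  The number of summands is harmless, since an ultrametric sum is no larger than its largest term.
  The incomplete sum over \<open>a \<le> m\<close> has its origin in borrowing. For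
  \<open>a \<le> m\<close> the representative of \<open>m - a\<close> modulo \<open>p ^ n\<close> is
  \<open>m - a\<close> itself; for \<open>a > m\<close> it is off by \<open>p ^ n\<close>, and this
  shift times \<open>g'\<close> survives the division by \<open>p ^ n\<close>. Complete sums over
  all residues tend to 0, so only the sum over \<open>a \<le> m\<close> remains. The same borrow,
  acting on the next digit, produces the derivative of the limit. That derivative depends on
  \<open>F'\<close> and \<open>G'\<close> alone, which makes the arbitrary choice of primitives in
  \<open>qotimes\<close> harmless. The identity exp(log q) = q is drawn from the limit of
  \<open>(q ^ (p ^ N) - 1) / p ^ N\<close> instead of a composition of power series. The case
  \<open>p = 2\<close> runs along with the odd primes: dividing by 2 costs at most a factor 2 in
  absolute value.\<close>

lemma sum_lessThan_add:
  fixes h :: "nat \<Rightarrow> 'b::comm_monoid_add"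
  shows "(\<Sum>x<n + m. h x) = (\<Sum>x<n. h x) + (\<Sum>x<m. h (n + x))"
  by (induction m) (simp_all add: add.assoc)

text \<open>Division with remainder writes \<open>x\<close> uniquely as \<open>a + M * j\<close>.
  The regroupings of sums by residue class modulo a power of \<open>p\<close> rest on this.\<close>

lemma sum_lessThan_mult:
  fixes h :: "nat \<Rightarrow> 'b::comm_monoid_add"
  shows "(\<Sum>x<M * K. h x) = (\<Sum>a<M. \<Sum>j<K. h (a + M * j))"
proof (induction K)
  case (Suc K)
  have "(\<Sum>x<M * Suc K. h x) = (\<Sum>x<M * K. h x) + (\<Sum>a<M. h (M * K + a))"
    using sum_lessThan_add[of h "M * K" M] by (simp add: add.commute)
  then show ?case by (simp add: Suc.IH sum.distrib add.commute)
qed simp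

section \<open>The field and its absolute value\<close>

locale Cp =
  fixes p :: nat and v :: "'a::field_char_0 \<Rightarrow> real"
  assumes is_Cp: "is_Cp p v"
begin

lemma prime_p: "prime p"
  using is_Cp by (simp add: is_Cp_def)

lemma p_gt_1: "1 < p"
  using prime_p prime_gt_1_nat by blast

lemma p_pos [simp]: "0 < p" "p \<noteq> 0"
  using p_gt_1 by auto

lemma v_nonneg [simp]: "0 \<le> v x"
  using is_Cp by (simp add: is_Cp_def)

lemma v_eq_0_iff [simp]: "v x = 0 \<longleftrightarrow> x = 0"
  using is_Cp by (simp add: is_Cp_def)

lemma v_pos_iff [simp]: "0 < v x \<longleftrightarrow> x \<noteq> 0"
  by (simp add: less_le)

lemma v_mult: "v (x * y) = v x * v y"
  using is_Cp by (simp add: is_Cp_def)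

lemma v_add: "v (x + y) \<le> max (v x) (v y)"
  using is_Cp by (simp add: is_Cp_def)

lemma v_p: "v (of_nat p) = 1 / real p"
  using is_Cp by (simp add: is_Cp_def)

lemma complete:
  assumes "\<And>e. e > 0 \<Longrightarrow> \<exists>N. \<forall>m\<ge>N. \<forall>n\<ge>N. v (X m - X n) < e"
  shows "\<exists>L. vtendsto v X L"
  using is_Cp assms unfolding is_Cp_def by meson

lemma root_exists:
  fixes c :: "nat \<Rightarrow> 'a"
  assumes "n > 0"
  shows "\<exists>x. x ^ n + (\<Sum>i<n. c i * x ^ i) = 0"
  using is_Cp assms unfolding is_Cp_def by meson

lemma v_0 [simp]: "v 0 = 0"
  by simp

lemma v_1 [simp]: "v 1 = 1"
proof -
  have "v 1 * v 1 = v 1 * 1" by (metis v_mult mult_1_right)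
  then show ?thesis by simp
qed

lemma v_minus [simp]: "v (- x) = v x"
proof -
  have "v (-1) * v (-1) = 1" by (metis v_mult v_1 minus_mult_minus mult_1_right)
  then have "v (-1) = 1 \<or> v (-1) = -1"
    by (simp only: square_eq_1_iff)
  then have "v (-1) = 1" using v_nonneg[of "-1"] by linarith
  then show ?thesis by (metis v_mult mult_minus1 mult_1)
qed

lemma v_minus_commute: "v (x - y) = v (y - x)"
  by (metis v_minus minus_diff_eq)

lemma v_add_le: "v x \<le> e \<Longrightarrow> v y \<le> e \<Longrightarrow> v (x + y) \<le> e"
  using v_add[of x y] by linarith

lemma v_diff_le: "v x \<le> e \<Longrightarrow> v y \<le> e \<Longrightarrow> v (x - y) \<le> e"
  using v_add_le[of x e "- y"] by simp

lemma v_add_less: "v x < e \<Longrightarrow> v y < e \<Longrightarrow> v (x + y) < e"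
  using v_add[of x y] by linarith

lemma v_trans: "v (x - y) \<le> e \<Longrightarrow> v (y - z) \<le> e \<Longrightarrow> v (x - z) \<le> e"
  using v_add_le[of "x - y" e "y - z"] by simp

lemma v_sum_le:
  assumes "0 \<le> e" "\<And>i. i \<in> A \<Longrightarrow> v (h i) \<le> e"
  shows "v (sum h A) \<le> e"
  using assms(2)
  by (induction A rule: infinite_finite_induct) (auto simp: assms(1) intro!: v_add_le)

lemma v_mult_le: "v x \<le> a \<Longrightarrow> v y \<le> b \<Longrightarrow> v (x * y) \<le> a * b"
  unfolding v_mult by (intro mult_mono) (auto intro: order_trans[OF v_nonneg])

lemma v_inverse: "v (inverse x) = inverse (v x)"
proof (cases "x = 0")
  case False
  then have "v x * v (inverse x) = 1" by (simp flip: v_mult)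
  then show ?thesis by (simp add: inverse_unique)
qed simp

lemma v_divide: "v (x / y) = v x / v y"
  by (simp add: divide_inverse v_mult v_inverse)

lemma v_power: "v (x ^ n) = v x ^ n"
  by (induction n) (simp_all add: v_mult)

lemma v_nat_le_1: "v (of_nat n) \<le> 1"
  by (induction n) (auto intro: v_add_le)

lemma v_int_le_1: "v (of_int n) \<le> 1"
  by (cases n rule: int_cases2) (simp_all add: v_nat_le_1)

section \<open>The radii \<open>p ^ (- n)\<close> and divisibility of integers\<close>

definition rad :: "nat \<Rightarrow> real" where "rad n = (1 / real p) ^ n"

lemma rad_pos [simp]: "0 < rad n"
  using p_gt_1 by (simp add: rad_def)

lemma rad_nonneg [simp]: "0 \<le> rad n"
  by (simp add: rad_def)

lemma rad_0 [simp]: "rad 0 = 1"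
  by (simp add: rad_def)

lemma rad_Suc: "rad (Suc n) = rad n / real p"
  by (simp add: rad_def)

lemma rad_add: "rad (m + n) = rad m * rad n"
  by (simp add: rad_def power_add)

lemma rad_antimono: "m \<le> n \<Longrightarrow> rad n \<le> rad m"
  using p_gt_1 unfolding rad_def by (intro power_decreasing) auto

lemma rad_le_1 [simp]: "rad n \<le> 1"
  using rad_antimono[of 0 n] by simp

lemma rad_strict_iff: "rad m < rad n \<longleftrightarrow> n < m"
  using p_gt_1 unfolding rad_def by (intro power_strict_decreasing_iff) auto

lemma rad_tendsto: "rad \<longlonglongrightarrow> 0"
  unfolding rad_def using p_gt_1 by (intro LIMSEQ_realpow_zero) auto

lemma rad_less_ex: "e > 0 \<Longrightarrow> \<exists>n. rad n < e"
  using order_tendstoD(2)[OF rad_tendsto, of e] eventually_sequentially by auto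

lemma v_p_power: "v (of_nat p ^ n) = rad n"
  by (simp add: v_power v_p rad_def)

lemma v_divide_p_power_le:
  assumes "v x \<le> e * rad N"
  shows "v (x / of_nat p ^ N) \<le> e"
  using assms by (simp add: v_divide v_p_power pos_divide_le_eq)

lemma p_neq_0 [simp]: "of_nat p \<noteq> (0::'a)"
  using p_gt_1 by simp

lemma v_int_dvd: "int p ^ k dvd n \<Longrightarrow> v (of_int n) \<le> rad k"
proof -
  assume "int p ^ k dvd n"
  then obtain t where "n = int p ^ k * t" by blast
  then have "v (of_int n) = rad k * v (of_int t)"
    by (simp add: v_mult v_power v_p rad_def)
  then show ?thesis using v_int_le_1[of t] by (simp add: mult_left_le)
qed

text \<open>If \<open>n\<close> had value below 1, a Bezout relation
  \<open>a * p + b * n = 1\<close> would write 1 as a sum of two elements of value below 1, against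
  the ultrametric inequality.\<close>

lemma v_int_not_dvd:
  assumes "\<not> int p dvd n"
  shows "v (of_int n) = 1"
proof (rule ccontr)
  assume "v (of_int n) \<noteq> 1"
  then have less: "v (of_int n) < 1" using v_int_le_1[of n] by linarith
  have "coprime (int p) n"
    using assms prime_p by (simp add: prime_imp_coprime)
  then obtain a b where ab: "a * int p + b * n = 1"
    by (metis bezout_int coprime_imp_gcd_eq_1)
  have "v (of_int (a * int p)) < 1"
  proof -
    have "v (of_int (a * int p)) = v (of_int a) * (1 / real p)" by (simp add: v_mult v_p)
    also have "\<dots> \<le> 1 / real p" using v_int_le_1[of a] by (simp add: divide_right_mono)
    also have "\<dots> < 1" using p_gt_1 by simp
    finally show ?thesis .
  qed
  moreover have "v (of_int (b * n)) < 1"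
  proof -
    have "v (of_int (b * n)) = v (of_int b) * v (of_int n)" by (simp add: v_mult)
    also have "\<dots> \<le> v (of_int n)" using v_int_le_1[of b] by (simp add: mult_left_le_one_le)
    finally show ?thesis using less by linarith
  qed
  ultimately have "v (of_int (a * int p) + of_int (b * n)) < 1" by (rule v_add_less)
  also have "of_int (a * int p) + of_int (b * n) = (1::'a)"
    using ab by (metis of_int_1 of_int_add)
  finally show False by simp
qed

lemma v_int_le_rad: "v (of_int n) \<le> rad k \<longleftrightarrow> int p ^ k dvd n"
proof
  assume "v (of_int n) \<le> rad k"
  then show "int p ^ k dvd n"
  proof (induction k arbitrary: n)
    case (Suc k)
    have "rad (Suc k) < 1" using rad_strict_iff[of "Suc k" 0] by simp
    then have "int p dvd n" using v_int_not_dvd[of n] Suc.prems by fastforce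
    then obtain t where t: "n = int p * t" by blast
    have "v (of_int n) = v (of_int t) / real p" by (simp add: t v_mult v_p)
    then have "v (of_int t) \<le> rad k"
      using Suc.prems p_gt_1 by (simp add: rad_Suc divide_le_cancel)
    from Suc.IH[OF this] show ?case by (simp add: t)
  qed simp
qed (rule v_int_dvd)

subsection \<open>Limits\<close>

lemma vtendsto_iff: "vtendsto v X L \<longleftrightarrow> (\<lambda>n. v (X n - L)) \<longlonglongrightarrow> 0"
  unfolding vtendsto_def LIMSEQ_def by simp

lemma vtendstoI:
  assumes "\<And>e. e > 0 \<Longrightarrow> \<exists>N. \<forall>n\<ge>N. v (X n - L) \<le> e"
  shows "vtendsto v X L"
  unfolding vtendsto_def
proof (intro allI impI)
  fix e :: real assume "e > 0"
  then have "e / 2 > 0" by simp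
  from assms[OF this] obtain N where "\<forall>n\<ge>N. v (X n - L) \<le> e / 2" by blast
  with \<open>e > 0\<close> have "\<forall>n\<ge>N. v (X n - L) < e" by (fastforce intro: le_less_trans)
  then show "\<exists>N. \<forall>n\<ge>N. v (X n - L) < e" by blast
qed

lemma vtendsto_eventually_le: "vtendsto v X L \<Longrightarrow> e > 0 \<Longrightarrow> \<exists>N. \<forall>n\<ge>N. v (X n - L) \<le> e"
  unfolding vtendsto_def by (meson less_imp_le)

lemma vtendsto_const: "vtendsto v (\<lambda>_. c) c"
  by (simp add: vtendsto_def)

lemma vtendsto_null_le:
  assumes "\<And>n. v (X n - L) \<le> Y n" "Y \<longlonglongrightarrow> 0"
  shows "vtendsto v X L"
  unfolding vtendsto_iff by (rule tendsto_sandwich[OF _ _ tendsto_const assms(2)]) (auto simp: assms)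

lemma vtendsto_add:
  assumes "vtendsto v X L" "vtendsto v Y M"
  shows "vtendsto v (\<lambda>n. X n + Y n) (L + M)"
proof (rule vtendsto_null_le)
  show "v (X n + Y n - (L + M)) \<le> max (v (X n - L)) (v (Y n - M))" for n
    using v_add[of "X n - L" "Y n - M"] by (simp add: algebra_simps)
  show "(\<lambda>n. max (v (X n - L)) (v (Y n - M))) \<longlonglongrightarrow> 0"
    using tendsto_max[OF assms[unfolded vtendsto_iff]] by simp
qed

lemma vtendsto_cmult: 
  assumes "vtendsto v X L"
  shows "vtendsto v (\<lambda>n. c * X n) (c * L)"
proof (rule vtendsto_null_le)
  show "v (c * X n - c * L) \<le> v c * v (X n - L)" for n
    by (simp flip: v_mult add: algebra_simps)
  show "(\<lambda>n. v c * v (X n - L)) \<longlonglongrightarrow> 0"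
    using tendsto_mult_right_zero assms vtendsto_iff by blast
qed

lemma vtendsto_cdivide: "vtendsto v X L \<Longrightarrow> vtendsto v (\<lambda>n. X n / c) (L / c)"
  using vtendsto_cmult[of X L "inverse c"] by (simp add: divide_inverse mult.commute)

lemma vtendsto_minus: "vtendsto v X L \<Longrightarrow> vtendsto v (\<lambda>n. - X n) (- L)"
  using vtendsto_cmult[of X L "-1"] by simp

lemma vtendsto_diff:
  "vtendsto v X L \<Longrightarrow> vtendsto v Y M \<Longrightarrow> vtendsto v (\<lambda>n. X n - Y n) (L - M)"
  using vtendsto_add[OF _ vtendsto_minus] by fastforce

lemma vtendsto_mult:
  assumes "vtendsto v X L" "vtendsto v Y M"
  shows "vtendsto v (\<lambda>n. X n * Y n) (L * M)"
proof -
  have "vtendsto v (\<lambda>n. (X n - L) * (Y n - M)) 0"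
    unfolding vtendsto_iff using tendsto_mult[OF assms[unfolded vtendsto_iff]] by (simp add: v_mult)
  moreover have "vtendsto v (\<lambda>n. L * Y n + M * X n - L * M) (L * M + M * L - L * M)"
    using assms by (intro vtendsto_add vtendsto_diff vtendsto_cmult vtendsto_const)
  ultimately have "vtendsto v (\<lambda>n. (X n - L) * (Y n - M) + (L * Y n + M * X n - L * M))
    (0 + (L * M + M * L - L * M))" by (rule vtendsto_add)
  then show ?thesis by (simp add: algebra_simps)
qed

lemma vtendsto_sum:
  assumes "\<And>i. i \<in> A \<Longrightarrow> vtendsto v (X i) (L i)"
  shows "vtendsto v (\<lambda>n. \<Sum>i\<in>A. X i n) (\<Sum>i\<in>A. L i)"
  using assms
  by (induction A rule: infinite_finite_induct) (auto intro: vtendsto_const vtendsto_add)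

lemma vtendsto_unique: "vtendsto v X L \<Longrightarrow> vtendsto v X M \<Longrightarrow> L = M"
proof -
  assume "vtendsto v X L" "vtendsto v X M"
  from vtendsto_diff[OF this] have "(\<lambda>n. v (L - M)) \<longlonglongrightarrow> 0"
    by (simp add: vtendsto_iff v_minus_commute)
  then have "v (L - M) = 0" by (simp only: LIMSEQ_const_iff)
  then show ?thesis by simp
qed

lemma vlim_eq: "vtendsto v X L \<Longrightarrow> vlim v X = L"
  unfolding vlim_def using vtendsto_unique by blast

lemma vtendsto_shift: "vtendsto v (\<lambda>n. X (n + k)) L \<longleftrightarrow> vtendsto v X L"
  unfolding vtendsto_iff
  using LIMSEQ_offset[of "\<lambda>n. v (X n - L)" k 0]
    LIMSEQ_ignore_initial_segment[of "\<lambda>n. v (X n - L)" 0 k] by blast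

lemma vtendsto_cong: "vtendsto v X L \<Longrightarrow> (\<And>n. n \<ge> N \<Longrightarrow> X n = Y n) \<Longrightarrow> vtendsto v Y L"
  unfolding vtendsto_def by (metis linorder_linear order_trans)

lemma vtendsto_bound:
  assumes "vtendsto v X L" "\<And>n. n \<ge> N \<Longrightarrow> v (X n - Y) \<le> e"
  shows "v (L - Y) \<le> e"
proof (cases "e > 0")
  case True
  then obtain M where "\<forall>n\<ge>M. v (X n - L) \<le> e" using vtendsto_eventually_le[OF assms(1)] by blast
  then have "v (L - X (max N M)) \<le> e" by (simp add: v_minus_commute)
  then show ?thesis by (rule v_trans) (rule assms(2), simp)
next
  case False
  \<comment> \<open>Here \<open>e\<close> can only be 0, because it bounds an absolute value, and
    the sequence is eventually constant.\<close>
  have "X n = Y" if "n \<ge> N" for n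
    using assms(2)[OF that] False by (smt (verit) v_nonneg v_eq_0_iff right_minus_eq)
  then have "vtendsto v X Y" using vtendsto_cong[OF vtendsto_const, of N Y X] by simp
  then have "L = Y" using assms(1) vtendsto_unique by blast
  then show ?thesis using order_trans[OF v_nonneg assms(2)[OF order_refl]] by simp
qed

lemma vtendsto_bound0: "vtendsto v X L \<Longrightarrow> (\<And>n. v (X n) \<le> e) \<Longrightarrow> v L \<le> e"
  using vtendsto_bound[of X L 0 0 e] by simp

lemma step_trans:
  assumes "\<And>n. n \<ge> N \<Longrightarrow> v (X (Suc n) - X n) \<le> e" "N \<le> m" "m \<le> n" "0 \<le> e"
  shows "v (X n - X m) \<le> e"
  using assms(3)
proof (induction n rule: dec_induct)
  case (step n)
  then show ?case using v_trans[OF assms(1)[of n] step.IH] assms(2) by simp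
qed (simp add: assms)

text \<open>In an ultrametric, \<open>v (X m - X n)\<close> is at most the largest step in between,
  so steps tending to 0 already make the sequence Cauchy. Limits whose value is not known in advance
  are obtained from this criterion.\<close>

lemma converges_if_steps:
  assumes "\<And>e. e > 0 \<Longrightarrow> \<exists>N. \<forall>n\<ge>N. v (X (Suc n) - X n) \<le> e"
  shows "\<exists>L. vtendsto v X L"
proof (rule complete)
  fix e :: real assume "e > 0"
  then obtain N where N: "\<And>n. n \<ge> N \<Longrightarrow> v (X (Suc n) - X n) \<le> e / 2" 
    using assms[of "e / 2"] by auto
  have *: "v (X m - X N) \<le> e / 2" if "m \<ge> N" for m
    using step_trans[of N X "e / 2", OF N] that \<open>e > 0\<close> by simp
  have "v (X m - X n) < e" if "m \<ge> N" "n \<ge> N" for m n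
    using v_trans[OF *, of m "X n"] * that \<open>e > 0\<close> by (fastforce simp: v_minus_commute)
  then show "\<exists>N. \<forall>m\<ge>N. \<forall>n\<ge>N. v (X m - X n) < e" by blast
qed

subsection \<open>The ring of p-adic integers\<close>

lemma of_int_Zp [simp]: "of_int m \<in> Zp v"
  unfolding Zp_def using vtendsto_const[of "of_int m"] by (auto intro: exI[of _ "\<lambda>_. m"])

lemma of_nat_Zp [simp]: "of_nat m \<in> Zp v"
  using of_int_Zp[of "int m"] by simp

lemma of_nat_power_Zp [simp]: "of_nat m ^ n \<in> Zp v"
  using of_nat_Zp[of "m ^ n"] by simp

lemma Zp_add: "x \<in> Zp v \<Longrightarrow> y \<in> Zp v \<Longrightarrow> x + y \<in> Zp v"
proof -
  assume "x \<in> Zp v" "y \<in> Zp v"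
  then obtain s t where "vtendsto v (\<lambda>k. of_int (s k)) x" "vtendsto v (\<lambda>k. of_int (t k)) y"
    unfolding Zp_def by blast
  from vtendsto_add[OF this] have "vtendsto v (\<lambda>k. of_int (s k + t k)) (x + y)" by simp
  then show ?thesis unfolding Zp_def by (intro CollectI exI)
qed

lemma Zp_mult: "x \<in> Zp v \<Longrightarrow> y \<in> Zp v \<Longrightarrow> x * y \<in> Zp v"
proof -
  assume "x \<in> Zp v" "y \<in> Zp v"
  then obtain s t where "vtendsto v (\<lambda>k. of_int (s k)) x" "vtendsto v (\<lambda>k. of_int (t k)) y"
    unfolding Zp_def by blast
  from vtendsto_mult[OF this] have "vtendsto v (\<lambda>k. of_int (s k * t k)) (x * y)" by simp
  then show ?thesis unfolding Zp_def by (intro CollectI exI)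
qed

lemma Zp_minus: "x \<in> Zp v \<Longrightarrow> - x \<in> Zp v"
proof -
  assume "x \<in> Zp v"
  then obtain s where "vtendsto v (\<lambda>k. of_int (s k)) x"
    unfolding Zp_def by blast
  from vtendsto_minus[OF this] have "vtendsto v (\<lambda>k. of_int (- s k)) (- x)" by simp
  then show ?thesis unfolding Zp_def by (intro CollectI exI)
qed

lemma Zp_diff: "x \<in> Zp v \<Longrightarrow> y \<in> Zp v \<Longrightarrow> x - y \<in> Zp v"
  using Zp_add[OF _ Zp_minus] by fastforce

lemma Zp_approx:
  assumes "z \<in> Zp v"
  shows "\<exists>m. v (z - of_int m) \<le> rad n"
proof -
  obtain s where "vtendsto v (\<lambda>k. of_int (s k)) z" using assms unfolding Zp_def by blast
  then obtain k where "v (of_int (s k) - z) \<le> rad n"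
    using vtendsto_eventually_le[of _ z "rad n"] by (metis order_refl rad_pos)
  then show ?thesis by (metis v_minus_commute)
qed

lemma v_Zp: "z \<in> Zp v \<Longrightarrow> v z \<le> 1"
proof -
  assume "z \<in> Zp v"
  then obtain m where "v (z - of_int m) \<le> 1" using Zp_approx[of z 0] by auto
  from v_add_le[OF this v_int_le_1[of m]] show ?thesis by simp
qed

lemma v_nat_diff_le_rad: "v (of_nat a - of_nat b) \<le> rad n \<longleftrightarrow> a mod p ^ n = b mod p ^ n"
proof -
  have "v (of_nat a - of_nat b) \<le> rad n \<longleftrightarrow> int p ^ n dvd (int a - int b)"
    using v_int_le_rad[of "int a - int b" n] by simp
  also have "\<dots> \<longleftrightarrow> int a mod int (p ^ n) = int b mod int (p ^ n)"
    by (simp add: mod_eq_dvd_iff)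
  also have "\<dots> \<longleftrightarrow> a mod p ^ n = b mod p ^ n"
    by (metis of_nat_mod of_nat_eq_iff)
  finally show ?thesis .
qed

text \<open>The residue of \<open>z\<close> modulo \<open>p ^ n\<close>, that is, the number formed
  by its first \<open>n\<close> p-adic digits. It is a natural number because the finite sums run
  over \<open>{..<p ^ n}\<close>.\<close>

definition trunc :: "nat \<Rightarrow> 'a \<Rightarrow> nat" where
  "trunc n z = (THE a. a < p ^ n \<and> v (z - of_nat a) \<le> rad n)"

lemma trunc_ex:
  assumes "z \<in> Zp v"
  shows "\<exists>a < p ^ n. v (z - of_nat a) \<le> rad n"
proof -
  obtain m where m: "v (z - of_int m) \<le> rad n" using Zp_approx[OF assms] by blast
  define a where "a = nat (m mod int (p ^ n))"
  have pos: "0 < p ^ n" using p_gt_1 by simp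
  have a: "int a = m mod int (p ^ n)" unfolding a_def using pos by simp
  then have "int p ^ n dvd m - int a" by (simp add: minus_mod_eq_mult_div)
  then have "v (of_int m - of_nat a) \<le> rad n" using v_int_dvd[of n "m - int a"] by simp
  then have "v (z - of_nat a) \<le> rad n" using m v_trans by blast
  moreover have "int a < int (p ^ n)" unfolding a using pos by (intro pos_mod_bound) simp
  ultimately show ?thesis by auto
qed

lemma trunc_unique:
  assumes "a < p ^ n" "v (z - of_nat a) \<le> rad n"
  shows "trunc n z = a"
  unfolding trunc_def
proof (rule the_equality)
  fix b assume b: "b < p ^ n \<and> v (z - of_nat b) \<le> rad n"
  then have "v (of_nat b - of_nat a) \<le> rad n"
    using assms(2) v_trans[of "of_nat b" z "rad n" "of_nat a"] by (simp add: v_minus_commute)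
  then show "b = a" using assms(1) b by (simp add: v_nat_diff_le_rad)
qed (use assms in simp)

lemma
  assumes "z \<in> Zp v"
  shows trunc_less: "trunc n z < p ^ n" and trunc_close: "v (z - of_nat (trunc n z)) \<le> rad n"
  using trunc_ex[OF assms, of n] trunc_unique by auto

lemma trunc_of_nat [simp]: "trunc n (of_nat m) = m mod p ^ n"
  using p_gt_1 by (intro trunc_unique) (simp_all add: v_nat_diff_le_rad)

lemma trunc_eq:
  assumes "y \<in> Zp v" "v (x - y) \<le> rad n"
  shows "trunc n x = trunc n y"
  using trunc_less[OF assms(1)] v_trans[OF assms(2) trunc_close[OF assms(1)]] by (intro trunc_unique)

lemma trunc_mod:
  assumes "z \<in> Zp v" "i \<le> n"
  shows "trunc i z = trunc n z mod p ^ i"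
proof -
  have "v (z - of_nat (trunc n z)) \<le> rad i"
    using trunc_close[OF assms(1), of n] rad_antimono[OF assms(2)] by linarith
  from trunc_eq[OF of_nat_Zp this] show ?thesis by simp
qed

lemma trunc_tendsto: "z \<in> Zp v \<Longrightarrow> vtendsto v (\<lambda>n. of_nat (trunc n z)) z"
  by (rule vtendsto_null_le[OF _ rad_tendsto]) (metis trunc_close v_minus_commute)

lemma trunc_Suc:
  assumes "z \<in> Zp v"
  obtains d where "d < p" "trunc (Suc n) z = trunc n z + p ^ n * d"
proof
  show "trunc (Suc n) z div p ^ n < p"
    using trunc_less[OF assms, of "Suc n"] by (simp add: less_mult_imp_div_less)
  show "trunc (Suc n) z = trunc n z + p ^ n * (trunc (Suc n) z div p ^ n)"
    using trunc_mod[OF assms, of n "Suc n"] by simp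
qed

lemma trunc_step:
  assumes "z \<in> Zp v"
  shows "v (of_nat (trunc (Suc n) z) - of_nat (trunc n z)) \<le> rad n"
  by (simp add: v_nat_diff_le_rad trunc_mod[OF assms, of n "Suc n"])

text \<open>With \<open>m\<close> the first index whose radius lies below \<open>v (x - y)\<close>,
  the level \<open>n = m - 1\<close> satisfies both bounds. Returning from \<open>rad n\<close> to
  the distance thus costs only a factor \<open>p\<close>.\<close>

lemma rad_sandwich:
  assumes "x \<in> Zp v" "y \<in> Zp v" "x \<noteq> y" "v (x - y) \<le> rad k"
  obtains n where "k \<le> n" "v (x - y) \<le> rad n" "rad n \<le> real p * v (x - y)"
proof -
  define m where "m = (LEAST m. rad m < v (x - y))"
  have pos: "v (x - y) > 0" using assms(3) by simp
  have m: "rad m < v (x - y)"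
    unfolding m_def by (rule LeastI_ex[OF rad_less_ex[OF pos]])
  then have "k < m" using rad_strict_iff[of m k] assms(4) by linarith
  then obtain n where n: "m = Suc n" by (cases m) auto
  have "\<not> rad n < v (x - y)" unfolding m_def
    using not_less_Least[of n "\<lambda>m. rad m < v (x - y)"] n m_def by simp
  moreover have "rad n \<le> real p * v (x - y)"
    using m p_gt_1 by (simp add: n rad_Suc field_simps)
  ultimately show ?thesis using that[of n] \<open>k < m\<close> n by simp
qed

subsection \<open>Uniform continuity and uniform differentiability\<close>

definition ucont :: "('a \<Rightarrow> 'a) \<Rightarrow> bool" where
  "ucont \<phi> \<longleftrightarrow> (\<forall>e>0. \<exists>k. \<forall>x\<in>Zp v. \<forall>y\<in>Zp v. v (x - y) \<le> rad k \<longrightarrow> v (\<phi> x - \<phi> y) \<le> e)"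

text \<open>Uniform differentiability with the derivative \<open>d\<close> named, freed of division
  so that \<open>x = y\<close> is allowed, and with the radii restricted to \<open>rad k\<close>. Up
  to the naming of \<open>d\<close> it is \<open>UD\<close>; see \<open>UD_imp_UDd\<close> and
  \<open>UDd_imp_UD\<close>.\<close>

definition UDd :: "('a \<Rightarrow> 'a) \<Rightarrow> ('a \<Rightarrow> 'a) \<Rightarrow> bool" where
  "UDd f d \<longleftrightarrow> (\<forall>e>0. \<exists>k. \<forall>x\<in>Zp v. \<forall>y\<in>Zp v. \<forall>a\<in>Zp v.
     v (x - a) \<le> rad k \<longrightarrow> v (y - a) \<le> rad k \<longrightarrow> v (f x - f y - (x - y) * d a) \<le> e * v (x - y))"

lemma ucontE:
  assumes "ucont \<phi>" "e > 0"
  obtains k where "\<And>n x y. n \<ge> k \<Longrightarrow> x \<in> Zp v \<Longrightarrow> y \<in> Zp v \<Longrightarrow> v (x - y) \<le> rad n \<Longrightarrow> v (\<phi> x - \<phi> y) \<le> e"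
proof -
  obtain k where k: "\<forall>x\<in>Zp v. \<forall>y\<in>Zp v. v (x - y) \<le> rad k \<longrightarrow> v (\<phi> x - \<phi> y) \<le> e"
    using assms unfolding ucont_def by blast
  have "v (\<phi> x - \<phi> y) \<le> e" if "n \<ge> k" "x \<in> Zp v" "y \<in> Zp v" "v (x - y) \<le> rad n" for n x y
    using k that(2,3) order_trans[OF that(4) rad_antimono[OF that(1)]] by blast
  then show ?thesis using that by blast
qed

lemma UDdE:
  assumes "UDd f d" "e > 0"
  obtains k where "\<And>n x y a. n \<ge> k \<Longrightarrow> x \<in> Zp v \<Longrightarrow> y \<in> Zp v \<Longrightarrow> a \<in> Zp v \<Longrightarrow>
     v (x - a) \<le> rad n \<Longrightarrow> v (y - a) \<le> rad n \<Longrightarrow> v (f x - f y - (x - y) * d a) \<le> e * v (x - y)"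
proof -
  obtain k where k: "\<forall>x\<in>Zp v. \<forall>y\<in>Zp v. \<forall>a\<in>Zp v. v (x - a) \<le> rad k \<longrightarrow> v (y - a) \<le> rad k \<longrightarrow>
      v (f x - f y - (x - y) * d a) \<le> e * v (x - y)"
    using assms unfolding UDd_def by blast
  have "v (f x - f y - (x - y) * d a) \<le> e * v (x - y)"
    if "n \<ge> k" "x \<in> Zp v" "y \<in> Zp v" "a \<in> Zp v" "v (x - a) \<le> rad n" "v (y - a) \<le> rad n" for n x y a
    using k that(2-4) order_trans[OF that(5) rad_antimono[OF that(1)]]
      order_trans[OF that(6) rad_antimono[OF that(1)]] by blast
  then show ?thesis using that by blast
qed

lemma ucont_const: "ucont (\<lambda>_. c)"
  by (auto simp: ucont_def)

text \<open>Compactness in elementary form: modulo \<open>p ^ k\<close> there are finitely many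
  residues, and within one residue class the function varies by at most 1.\<close>

lemma ucont_bounded:
  assumes "ucont \<phi>"
  obtains B where "B \<ge> 1" "\<And>x. x \<in> Zp v \<Longrightarrow> v (\<phi> x) \<le> B"
proof -
  obtain k where k: "\<And>x y. x \<in> Zp v \<Longrightarrow> y \<in> Zp v \<Longrightarrow> v (x - y) \<le> rad k \<Longrightarrow> v (\<phi> x - \<phi> y) \<le> 1"
    using assms unfolding ucont_def by (meson zero_less_one)
  define B where "B = 1 + (\<Sum>a<p ^ k. v (\<phi> (of_nat a)))"
  have "v (\<phi> x) \<le> B" if x: "x \<in> Zp v" for x
  proof -
    have "v (\<phi> (of_nat (trunc k x))) \<le> (\<Sum>a<p ^ k. v (\<phi> (of_nat a)))"
      using trunc_less[OF x] by (intro member_le_sum) auto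
    then have "v (\<phi> (of_nat (trunc k x))) \<le> B" by (simp add: B_def)
    moreover have "v (\<phi> x - \<phi> (of_nat (trunc k x))) \<le> B"
      using k[OF x of_nat_Zp trunc_close[OF x]] by (simp add: B_def add_increasing2 sum_nonneg)
    ultimately show ?thesis using v_add_le by fastforce
  qed
  moreover have "B \<ge> 1" by (simp add: B_def sum_nonneg)
  ultimately show ?thesis using that by blast
qed

text \<open>For neighbouring \<open>a\<close> and \<open>b\<close>, one and the same increment from
  \<open>a\<close> to \<open>a + p ^ k\<close> is approximated by both \<open>d a\<close> and
  \<open>d b\<close>; comparing the two expansions bounds \<open>d a - d b\<close>.\<close>

lemma UDd_imp_ucont_deriv:
  assumes "UDd f d"
  shows "ucont d"
  unfolding ucont_def
proof (intro allI impI)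
  fix e :: real assume "e > 0"
  obtain k where
    k: "\<And>x y a. x \<in> Zp v \<Longrightarrow> y \<in> Zp v \<Longrightarrow> a \<in> Zp v \<Longrightarrow>
     v (x - a) \<le> rad k \<Longrightarrow> v (y - a) \<le> rad k \<Longrightarrow> v (f x - f y - (x - y) * d a) \<le> e * v (x - y)"
    using assms \<open>e > 0\<close> unfolding UDd_def by meson
  have "v (d a - d b) \<le> e" if ab: "a \<in> Zp v" "b \<in> Zp v" "v (a - b) \<le> rad k" for a b
  proof -
    define x where "x = a + of_nat (p ^ k)"
    have x: "x \<in> Zp v" "v (x - a) = rad k"
      using Zp_add[OF ab(1) of_nat_power_Zp] by (simp_all add: x_def v_p_power)
    then have xb: "v (x - b) \<le> rad k" using v_trans[of x a "rad k" b] ab by simp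
    have 1: "v (f x - f a - (x - a) * d a) \<le> e * rad k"
      using k[of x a a] x ab by simp
    have 2: "v (f x - f a - (x - a) * d b) \<le> e * rad k"
      using k[of x a b] x ab xb by simp
    have "v (x - a) * v (d a - d b) = v ((f x - f a - (x - a) * d b) - (f x - f a - (x - a) * d a))"
      by (simp flip: v_mult add: algebra_simps)
    also have "\<dots> \<le> e * rad k" by (rule v_diff_le[OF 2 1])
    finally show ?thesis using x(2) rad_pos[of k] by (simp add: mult.commute)
  qed
  then show "\<exists>k. \<forall>x\<in>Zp v. \<forall>y\<in>Zp v. v (x - y) \<le> rad k \<longrightarrow> v (d x - d y) \<le> e" by blast
qed

lemma UDd_imp_ucont:
  assumes "UDd f d"
  shows "ucont f"
  unfolding ucont_def
proof (intro allI impI)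
  fix e :: real assume "e > 0"
  obtain B where B: "B \<ge> 1" "\<And>x. x \<in> Zp v \<Longrightarrow> v (d x) \<le> B"
    using ucont_bounded[OF UDd_imp_ucont_deriv[OF assms]] by blast
  from UDdE[OF assms \<open>e > 0\<close>] obtain k where
    k: "\<And>n x y a. n \<ge> k \<Longrightarrow> x \<in> Zp v \<Longrightarrow> y \<in> Zp v \<Longrightarrow> a \<in> Zp v \<Longrightarrow>
     v (x - a) \<le> rad n \<Longrightarrow> v (y - a) \<le> rad n \<Longrightarrow> v (f x - f y - (x - y) * d a) \<le> e * v (x - y)"
    by blast
  obtain m where m: "rad m < e / B" using rad_less_ex[of "e / B"] B \<open>e > 0\<close> by auto
  have "v (f x - f y) \<le> e" if xy: "x \<in> Zp v" "y \<in> Zp v" "v (x - y) \<le> rad (max k m)" for x y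
  proof -
    have le: "v (x - y) \<le> e / B" using xy(3) m rad_antimono[of m "max k m"] by linarith
    have "v (f x - f y - (x - y) * d y) \<le> e * v (x - y)"
      using xy by (intro k[where n = "max k m"]) auto
    also have "\<dots> \<le> e" using \<open>e > 0\<close> v_Zp[OF Zp_diff[OF xy(1,2)]] by (simp add: mult_left_le)
    finally have 1: "v (f x - f y - (x - y) * d y) \<le> e" .
    have "v ((x - y) * d y) \<le> e / B * B" using le B xy by (intro v_mult_le) auto
    then have 2: "v ((x - y) * d y) \<le> e" using B by simp
    show ?thesis using v_add_le[OF 1 2] by simp
  qed
  then show "\<exists>k. \<forall>x\<in>Zp v. \<forall>y\<in>Zp v. v (x - y) \<le> rad k \<longrightarrow> v (f x - f y) \<le> e"
    by (intro exI[of _ "max k m"] ballI impI)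
qed

lemma UDd_cong:
  assumes "UDd f d" "\<And>x. x \<in> Zp v \<Longrightarrow> f x = f' x" "\<And>x. x \<in> Zp v \<Longrightarrow> d x = d' x"
  shows "UDd f' d'"
proof -
  have "UDd f d = UDd f' d'"
    unfolding UDd_def
    by (intro all_cong1 imp_cong refl ex_cong1 ball_cong) (simp add: assms(2,3))
  then show ?thesis using assms(1) by simp
qed

lemma UDd_cmult:
  assumes "UDd f d"
  shows "UDd (\<lambda>x. c * f x) (\<lambda>x. c * d x)"
  unfolding UDd_def
proof (intro allI impI)
  fix e :: real assume "e > 0"
  define C where "C = v c + 1"
  have C: "C > 0" "v c \<le> C" using v_nonneg[of c] by (simp_all add: C_def add_nonneg_pos)
  then have e: "e / C > 0" using \<open>e > 0\<close> by simp
  obtain k where k: "\<And>n x y a. n \<ge> k \<Longrightarrow> x \<in> Zp v \<Longrightarrow> y \<in> Zp v \<Longrightarrow> a \<in> Zp v \<Longrightarrow>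
     v (x - a) \<le> rad n \<Longrightarrow> v (y - a) \<le> rad n \<Longrightarrow> v (f x - f y - (x - y) * d a) \<le> e / C * v (x - y)"
    using UDdE[OF assms e] by blast
  have "v (c * f x - c * f y - (x - y) * (c * d a)) \<le> e * v (x - y)"
    if "x \<in> Zp v" "y \<in> Zp v" "a \<in> Zp v" "v (x - a) \<le> rad k" "v (y - a) \<le> rad k" for x y a
  proof -
    have "c * f x - c * f y - (x - y) * (c * d a) = c * (f x - f y - (x - y) * d a)"
      by (simp add: algebra_simps)
    also have "v \<dots> \<le> C * (e / C * v (x - y))"
      using that by (intro v_mult_le C k[of k]) auto
    finally show ?thesis using C by simp
  qed
  then show "\<exists>k. \<forall>x\<in>Zp v. \<forall>y\<in>Zp v. \<forall>a\<in>Zp v. v (x - a) \<le> rad k \<longrightarrow> v (y - a) \<le> rad k \<longrightarrow>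
    v (c * f x - c * f y - (x - y) * (c * d a)) \<le> e * v (x - y)" by blast
qed

section \<open>Comparison with the difference quotients in \<open>UD\<close> and
  \<open>vderiv\<close>\<close>

lemma v_quotient:
  assumes "x \<noteq> y"
  shows "v (A - (x - y) * d) = v (x - y) * v (A / (x - y) - d)"
proof -
  have "A - (x - y) * d = (x - y) * (A / (x - y) - d)"
    using assms by (simp add: right_diff_distrib)
  then show ?thesis by (simp add: v_mult)
qed

lemma UD_imp_UDd:
  assumes "UD v f"
  shows "\<exists>d. UDd f d"
proof -
  obtain d where d: "\<And>e. e > 0 \<Longrightarrow> \<exists>\<delta>>0. \<forall>x\<in>Zp v. \<forall>y\<in>Zp v. \<forall>a\<in>Zp v.
       x \<noteq> y \<and> v (x - a) < \<delta> \<and> v (y - a) < \<delta> \<longrightarrow> v ((f x - f y) / (x - y) - d a) < e"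
    using assms unfolding UD_def by blast
  have "UDd f d"
    unfolding UDd_def
  proof (intro allI impI)
    fix e :: real assume "e > 0"
    from d[OF this] obtain \<delta> where "\<delta> > 0" and \<delta>: "\<And>x y a. x \<in> Zp v \<Longrightarrow> y \<in> Zp v \<Longrightarrow> a \<in> Zp v \<Longrightarrow>
       x \<noteq> y \<Longrightarrow> v (x - a) < \<delta> \<Longrightarrow> v (y - a) < \<delta> \<Longrightarrow> v ((f x - f y) / (x - y) - d a) < e" by meson
    obtain k where k: "rad k < \<delta>" using rad_less_ex[OF \<open>\<delta> > 0\<close>] by blast
    have "v (f x - f y - (x - y) * d a) \<le> e * v (x - y)"
      if "x \<in> Zp v" "y \<in> Zp v" "a \<in> Zp v" "v (x - a) \<le> rad k" "v (y - a) \<le> rad k" for x y a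
    proof (cases "x = y")
      case False
      have "v (f x - f y - (x - y) * d a) = v (x - y) * v ((f x - f y) / (x - y) - d a)"
        by (rule v_quotient[OF False])
      also have "\<dots> \<le> v (x - y) * e"
        using \<delta>[OF that(1-3) False] that k by (intro mult_left_mono) auto
      finally show ?thesis by (simp add: mult.commute)
    qed simp
    then show "\<exists>k. \<forall>x\<in>Zp v. \<forall>y\<in>Zp v. \<forall>a\<in>Zp v.
     v (x - a) \<le> rad k \<longrightarrow> v (y - a) \<le> rad k \<longrightarrow> v (f x - f y - (x - y) * d a) \<le> e * v (x - y)"
      by blast
  qed
  then show ?thesis by blast
qed

lemma UDd_quotient:
  assumes "UDd f d" "e > 0"
  shows "\<exists>\<delta>>0. \<forall>x\<in>Zp v. \<forall>y\<in>Zp v. \<forall>a\<in>Zp v.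
       x \<noteq> y \<and> v (x - a) < \<delta> \<and> v (y - a) < \<delta> \<longrightarrow> v ((f x - f y) / (x - y) - d a) < e"
proof -
  have "e / 2 > 0" using assms(2) by simp
  then obtain k where
    k: "\<And>x y a. x \<in> Zp v \<Longrightarrow> y \<in> Zp v \<Longrightarrow> a \<in> Zp v \<Longrightarrow>
     v (x - a) \<le> rad k \<Longrightarrow> v (y - a) \<le> rad k \<Longrightarrow> v (f x - f y - (x - y) * d a) \<le> e / 2 * v (x - y)"
    using assms(1) unfolding UDd_def by meson
  have "v ((f x - f y) / (x - y) - d a) < e"
    if "x \<in> Zp v" "y \<in> Zp v" "a \<in> Zp v" "x \<noteq> y" "v (x - a) < rad k" "v (y - a) < rad k" for x y a
  proof -
    have "v (x - y) * v ((f x - f y) / (x - y) - d a) = v (f x - f y - (x - y) * d a)"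
      by (rule v_quotient[OF that(4), symmetric])
    also have "\<dots> \<le> v (x - y) * (e / 2)" using k[OF that(1-3)] that(5,6) by (simp add: mult.commute)
    finally have "v ((f x - f y) / (x - y) - d a) \<le> e / 2"
      using that(4) by (subst (asm) mult_le_cancel_left_pos) simp_all
    then show ?thesis using assms(2) by linarith
  qed
  then show ?thesis using rad_pos by blast
qed

lemma UDd_imp_UD: "UDd f d \<Longrightarrow> UD v f"
  using UDd_quotient unfolding UD_def by blast

lemma UDd_imp_vderiv:
  assumes "UDd f d" "a \<in> Zp v"
  shows "vderiv v f a = d a"
  unfolding vderiv_def
proof (rule the_equality)
  show lim: "\<forall>e>0. \<exists>\<delta>>0. \<forall>x\<in>Zp v. x \<noteq> a \<and> v (x - a) < \<delta> \<longrightarrow> v ((f x - f a) / (x - a) - d a) < e"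
  proof (intro allI impI)
    fix e :: real assume "e > 0"
    from UDd_quotient[OF assms(1) this] assms(2)
    show "\<exists>\<delta>>0. \<forall>x\<in>Zp v. x \<noteq> a \<and> v (x - a) < \<delta> \<longrightarrow> v ((f x - f a) / (x - a) - d a) < e" by fastforce
  qed
  fix L
  assume L: "\<forall>e>0. \<exists>\<delta>>0. \<forall>x\<in>Zp v. x \<noteq> a \<and> v (x - a) < \<delta> \<longrightarrow> v ((f x - f a) / (x - a) - L) < e"
  show "L = d a"
  proof (rule ccontr)
    assume "L \<noteq> d a"
    then have e: "v (L - d a) > 0" by simp
    obtain \<delta>1 where \<delta>1: "\<delta>1 > 0" "\<And>x. x \<in> Zp v \<Longrightarrow> x \<noteq> a \<Longrightarrow> v (x - a) < \<delta>1 \<Longrightarrow>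
      v ((f x - f a) / (x - a) - L) < v (L - d a)" using L e by meson
    obtain \<delta>2 where \<delta>2: "\<delta>2 > 0" "\<And>x. x \<in> Zp v \<Longrightarrow> x \<noteq> a \<Longrightarrow> v (x - a) < \<delta>2 \<Longrightarrow>
      v ((f x - f a) / (x - a) - d a) < v (L - d a)" using lim e by meson
    \<comment> \<open>The point \<open>a\<close> is not isolated: \<open>a + p ^ n\<close> lies
      within both radii, and its difference quotient cannot be closer than
      \<open>v (L - d a)\<close> to both candidates.\<close>
    obtain n where n: "rad n < min \<delta>1 \<delta>2" using rad_less_ex[of "min \<delta>1 \<delta>2"] \<delta>1(1) \<delta>2(1) by auto
    define x where "x = a + of_nat (p ^ n)"
    define Q where "Q = (f x - f a) / (x - a)"
    have x: "x \<in> Zp v" "v (x - a) = rad n"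
      using Zp_add[OF assms(2) of_nat_power_Zp] by (simp_all add: x_def v_p_power)
    then have "x \<noteq> a" by (metis v_0 diff_self rad_pos less_irrefl)
    then have "v (Q - L) < v (L - d a)" "v (Q - d a) < v (L - d a)"
      using \<delta>1(2) \<delta>2(2) x n by (auto simp: Q_def)
    then have "v ((Q - d a) + - (Q - L)) < v (L - d a)"
      by (intro v_add_less) (simp_all only: v_minus)
    then show False by simp
  qed
qed

lemma UDd_vderiv: "UD v f \<Longrightarrow> UDd f (vderiv v f)"
  using UD_imp_UDd UDd_imp_vderiv UDd_cong by metis

text \<open>A criterion for functions built digit by digit. If \<open>\<Phi> n\<close> sees only the
  first \<open>n\<close> digits and appending a digit changes it by that digit's contribution times
  \<open>\<psi>\<close>, up to o(\<open>p ^ n\<close>), then the limit has derivative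
  \<open>\<psi>\<close>. Points at distance about \<open>p ^ (- n)\<close> share
  \<open>\<Phi> n\<close>, so their difference is decided by the tails alone. It is applied to
  primitives and to the convolution.\<close>

lemma UDd_levels:
  assumes dep: "\<And>n x y. x \<in> Zp v \<Longrightarrow> y \<in> Zp v \<Longrightarrow> trunc n x = trunc n y \<Longrightarrow> \<Phi> n x = \<Phi> n y"
    and \<psi>: "ucont \<psi>"
    and step: "\<And>e. e > 0 \<Longrightarrow> \<exists>n0. \<forall>n\<ge>n0. \<forall>z\<in>Zp v.
      v (\<Phi> (Suc n) z - \<Phi> n z - (of_nat (trunc (Suc n) z) - of_nat (trunc n z)) * \<psi> z) \<le> e * rad n"
  shows "\<exists>F. (\<forall>z\<in>Zp v. vtendsto v (\<lambda>n. \<Phi> n z) (F z)) \<and> UDd F \<psi>"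
proof -
  let ?t = "\<lambda>n z. of_nat (trunc n z) :: 'a"
  obtain B where B: "B \<ge> 1" "\<And>x. x \<in> Zp v \<Longrightarrow> v (\<psi> x) \<le> B"
    using ucont_bounded[OF \<psi>] by blast
  have "\<exists>L. vtendsto v (\<lambda>n. \<Phi> n z) L" if z: "z \<in> Zp v" for z
  proof (rule converges_if_steps)
    fix e :: real assume "e > 0"
    obtain n0 where n0: "\<And>n. n \<ge> n0 \<Longrightarrow> 
      v (\<Phi> (Suc n) z - \<Phi> n z - (?t (Suc n) z - ?t n z) * \<psi> z) \<le> e * rad n"
      using step[OF \<open>e > 0\<close>] z by blast
    obtain m where m: "rad m < e / B" using rad_less_ex[of "e / B"] B \<open>e > 0\<close> by auto
    have "v (\<Phi> (Suc n) z - \<Phi> n z) \<le> e" if n: "n \<ge> max n0 m" for n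
    proof -
      have "e * rad n \<le> e" using \<open>e > 0\<close> by (simp add: mult_left_le)
      then have 1: "v (\<Phi> (Suc n) z - \<Phi> n z - (?t (Suc n) z - ?t n z) * \<psi> z) \<le> e"
        using n0[of n] n by simp
      have "rad n \<le> e / B" using m rad_antimono[of m n] n by simp
      then have "v (?t (Suc n) z - ?t n z) \<le> e / B" using trunc_step[OF z, of n] by simp
      then have "v ((?t (Suc n) z - ?t n z) * \<psi> z) \<le> e / B * B" by (intro v_mult_le B z)
      then have 2: "v ((?t (Suc n) z - ?t n z) * \<psi> z) \<le> e" using B by simp
      show ?thesis using v_add_le[OF 1 2] by simp
    qed
    then show "\<exists>N. \<forall>n\<ge>N. v (\<Phi> (Suc n) z - \<Phi> n z) \<le> e" by blast
  qed
  then obtain F where F: "\<And>z. z \<in> Zp v \<Longrightarrow> vtendsto v (\<lambda>n. \<Phi> n z) (F z)" by metis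
  have bound: "v (F z - \<Phi> n z - (z - ?t n z) * \<psi> z) \<le> e * rad n"
    if n0: "\<And>n z. n \<ge> n0 \<Longrightarrow> z \<in> Zp v \<Longrightarrow>
      v (\<Phi> (Suc n) z - \<Phi> n z - (?t (Suc n) z - ?t n z) * \<psi> z) \<le> e * rad n"
      and z: "z \<in> Zp v" and n: "n \<ge> n0" and e: "e > 0" for e n0 z n
  proof -
    \<comment> \<open>Removing the linear part makes every later step at most
      \<open>e * rad n\<close>, and by the ultrametric inequality so is their sum.\<close>
    define X where "X m = \<Phi> m z - \<psi> z * ?t m z" for m
    have X: "vtendsto v X (F z - \<psi> z * z)"
      unfolding X_def by (intro vtendsto_diff vtendsto_cmult F z trunc_tendsto)
    have "v (X (Suc m) - X m) \<le> e * rad n" if "m \<ge> n" for m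
    proof -
      have "v (X (Suc m) - X m) = v (\<Phi> (Suc m) z - \<Phi> m z - (?t (Suc m) z - ?t m z) * \<psi> z)"
        by (simp add: X_def algebra_simps)
      also have "\<dots> \<le> e * rad m" using n0[OF _ z, of m] n that by simp
      also have "\<dots> \<le> e * rad n" using rad_antimono[OF that] e by simp
      finally show ?thesis .
    qed
    then have "v (X m - X n) \<le> e * rad n" if "m \<ge> n" for m
      using step_trans[of n X "e * rad n" n m] that e by simp
    from vtendsto_bound[OF X this] have "v (F z - \<psi> z * z - X n) \<le> e * rad n" by blast
    then show ?thesis by (simp add: X_def algebra_simps)
  qed
  have "UDd F \<psi>" unfolding UDd_def
  proof (intro allI impI)
    fix e :: real assume "e > 0"
    \<comment> \<open>The factor \<open>p\<close> is the loss in passing from \<open>rad n\<close>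
      back to \<open>v (x - y)\<close>.\<close>
    then have e': "e / p > 0" using p_gt_1 by simp
    obtain n0 where n0: "\<And>n z. n \<ge> n0 \<Longrightarrow> z \<in> Zp v \<Longrightarrow>
      v (\<Phi> (Suc n) z - \<Phi> n z - (?t (Suc n) z - ?t n z) * \<psi> z) \<le> e / p * rad n"
      using step[OF e'] by blast
    obtain k where k: "\<And>n x y. n \<ge> k \<Longrightarrow> x \<in> Zp v \<Longrightarrow> y \<in> Zp v \<Longrightarrow> v (x - y) \<le> rad n \<Longrightarrow>
      v (\<psi> x - \<psi> y) \<le> e / p" using ucontE[OF \<psi> e'] by blast
    define K where "K = max n0 k"
    have "v (F x - F y - (x - y) * \<psi> a) \<le> e * v (x - y)"
      if "x \<in> Zp v" "y \<in> Zp v" "a \<in> Zp v" "v (x - a) \<le> rad K" "v (y - a) \<le> rad K" for x y a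
    proof (cases "x = y")
      case False
      have "v (x - y) \<le> rad K" using v_trans[OF that(4), of y] that(5) by (simp add: v_minus_commute)
      then obtain n where n: "K \<le> n" "v (x - y) \<le> rad n" "rad n \<le> real p * v (x - y)"
        using rad_sandwich[OF \<open>x \<in> Zp v\<close> \<open>y \<in> Zp v\<close> False] by blast
      have xy: "trunc n x = trunc n y" using trunc_eq[OF \<open>y \<in> Zp v\<close> n(2)] .
      have lev: "v (F u - \<Phi> n u - (u - ?t n u) * \<psi> u) \<le> e / p * rad n" if "u \<in> Zp v" for u
        by (rule bound[of n0, OF _ that _ e']) (erule (1) n0, use n(1) K_def in simp)
      have "v ((x - ?t n x) * (\<psi> x - \<psi> a)) \<le> rad n * (e / p)"
        and "v ((y - ?t n y) * (\<psi> y - \<psi> a)) \<le> rad n * (e / p)"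
        by (intro v_mult_le trunc_close that k[where n = K]; simp add: K_def)+
      then have 3: "v ((x - ?t n x) * (\<psi> x - \<psi> a)) \<le> e / p * rad n"
        and 4: "v ((y - ?t n y) * (\<psi> y - \<psi> a)) \<le> e / p * rad n" by (simp_all add: mult.commute)
      \<comment> \<open>Both \<open>\<Phi> n\<close> and the truncations agree at \<open>x\<close>
        and \<open>y\<close> and cancel; what remains are the two tail errors and the variation of
        \<open>\<psi>\<close> near \<open>a\<close>.\<close>
      have "F x - F y - (x - y) * \<psi> a =
        (F x - \<Phi> n x - (x - ?t n x) * \<psi> x) - (F y - \<Phi> n y - (y - ?t n y) * \<psi> y)
        + ((x - ?t n x) * (\<psi> x - \<psi> a) - (y - ?t n y) * (\<psi> y - \<psi> a))"
        using dep[OF that(1,2) xy] by (simp add: xy algebra_simps)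
      also have "v \<dots> \<le> e / p * rad n"
        by (intro v_add_le v_diff_le lev that 3 4)
      also have "\<dots> \<le> e / p * (p * v (x - y))" using n(3) e' by (intro mult_left_mono) auto
      also have "\<dots> = e * v (x - y)" using p_gt_1 by simp
      finally show ?thesis .
    qed simp
    then show "\<exists>k. \<forall>x\<in>Zp v. \<forall>y\<in>Zp v. \<forall>a\<in>Zp v.
     v (x - a) \<le> rad k \<longrightarrow> v (y - a) \<le> rad k \<longrightarrow> v (F x - F y - (x - y) * \<psi> a) \<le> e * v (x - y)" by blast
  qed
  with F show ?thesis by blast
qed

text \<open>A Riemann sum along the truncations of \<open>z\<close>: each new digit contributes its
  increment times the value of \<open>\<psi>\<close> at the truncation before it. This provides the
  witness behind the choice of a primitive in \<open>qotimes\<close>.\<close>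

lemma antiderivative_ex:
  assumes "ucont \<psi>"
  shows "\<exists>F. UDd F \<psi>"
proof -
  define \<Phi> where "\<Phi> n z = (\<Sum>i<n. (of_nat (trunc (Suc i) z) - of_nat (trunc i z)) * \<psi> (of_nat (trunc i z)))"
    for n z
  have "\<exists>F. (\<forall>z\<in>Zp v. vtendsto v (\<lambda>n. \<Phi> n z) (F z)) \<and> UDd F \<psi>"
  proof (rule UDd_levels[OF _ assms])
    fix n x y assume xy: "x \<in> Zp v" "y \<in> Zp v" "trunc n x = trunc n y"
    then have "trunc i x = trunc i y" if "i \<le> n" for i using that trunc_mod by metis
    then show "\<Phi> n x = \<Phi> n y" by (simp add: \<Phi>_def)
  next
    fix e :: real assume "e > 0"
    from ucontE[OF assms this] obtain k where k: "\<And>n x y. n \<ge> k \<Longrightarrow> x \<in> Zp v \<Longrightarrow> y \<in> Zp v \<Longrightarrow>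
      v (x - y) \<le> rad n \<Longrightarrow> v (\<psi> x - \<psi> y) \<le> e" by blast
    have "v (\<Phi> (Suc n) z - \<Phi> n z - (of_nat (trunc (Suc n) z) - of_nat (trunc n z)) * \<psi> z) \<le> e * rad n"
      if "n \<ge> k" "z \<in> Zp v" for n z
    proof -
      have "\<Phi> (Suc n) z - \<Phi> n z - (of_nat (trunc (Suc n) z) - of_nat (trunc n z)) * \<psi> z
        = (of_nat (trunc (Suc n) z) - of_nat (trunc n z)) * (\<psi> (of_nat (trunc n z)) - \<psi> z)"
        by (simp add: \<Phi>_def algebra_simps)
      also have "v \<dots> \<le> rad n * e"
        using that k[of n "of_nat (trunc n z)" z] trunc_close[of z n]
        by (intro v_mult_le trunc_step) (simp_all add: v_minus_commute)
      finally show ?thesis by (simp add: mult.commute)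
    qed
    then show "\<exists>n0. \<forall>n\<ge>n0. \<forall>z\<in>Zp v. v (\<Phi> (Suc n) z - \<Phi> n z
      - (of_nat (trunc (Suc n) z) - of_nat (trunc n z)) * \<psi> z) \<le> e * rad n" by blast
  qed
  then show ?thesis by blast
qed

lemma v_mult_diff_le:
  assumes "v (x - x') \<le> e" "v (y - y') \<le> e" "v y \<le> B" "v x' \<le> B"
  shows "v (x * y - x' * y') \<le> e * B"
proof -
  have "v ((x - x') * y) \<le> e * B" "v (x' * (y - y')) \<le> B * e"
    using assms by (intro v_mult_le; simp)+
  then have "v ((x - x') * y + x' * (y - y')) \<le> e * B"
    by (intro v_add_le) (simp_all add: mult.commute)
  then show ?thesis by (simp add: algebra_simps)
qed

subsection \<open>Convolution sums\<close>

text \<open>For \<open>m\<close> and \<open>a\<close> below \<open>M\<close> this is the residue of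
  \<open>m - a\<close> modulo \<open>M\<close>, written by cases so that the borrow stays
  visible.\<close>

definition cdiff :: "nat \<Rightarrow> nat \<Rightarrow> nat \<Rightarrow> nat" where
  "cdiff M m a = (if a \<le> m then m - a else m + M - a)"

lemma cdiff_less: "m < M \<Longrightarrow> a < M \<Longrightarrow> cdiff M m a < M"
  by (auto simp: cdiff_def)

lemma of_nat_cdiff: "a < M \<Longrightarrow>
  (of_nat (cdiff M m a) :: 'b::comm_ring_1) = of_nat m - of_nat a + (if a \<le> m then 0 else of_nat M)"
  by (auto simp: cdiff_def of_nat_diff)

lemma v_cdiff: "a < p ^ n \<Longrightarrow> v (of_nat (cdiff (p ^ n) m a) - (of_nat m - of_nat a)) \<le> rad n"
  by (simp add: of_nat_cdiff v_p_power)

definition ctotal :: "('a \<Rightarrow> 'a) \<Rightarrow> ('a \<Rightarrow> 'a) \<Rightarrow> nat \<Rightarrow> nat \<Rightarrow> 'a" where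
  "ctotal \<phi> \<psi> n m = (\<Sum>a<p ^ n. \<phi> (of_nat a) * \<psi> (of_nat (cdiff (p ^ n) m a)))"

definition csum :: "('a \<Rightarrow> 'a) \<Rightarrow> ('a \<Rightarrow> 'a) \<Rightarrow> nat \<Rightarrow> 'a" where
  "csum \<phi> \<psi> m = (\<Sum>a<Suc m. \<phi> (of_nat a) * \<psi> (of_nat (m - a)))"

text \<open>Sort the summands by \<open>a\<close> modulo \<open>p ^ k\<close>. Within one class the
  \<open>p ^ i\<close> terms are nearly equal by uniform continuity, and \<open>p ^ i\<close> copies
  of one bounded term have a small sum.\<close>

lemma ctotal_small:
  assumes "ucont \<phi>" "ucont \<psi>" "e > 0"
  shows "\<exists>n0. \<forall>n\<ge>n0. \<forall>m. v (ctotal \<phi> \<psi> n m) \<le> e"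
proof -
  obtain B1 B2 where "B1 \<ge> 1" and B1: "\<And>x. x \<in> Zp v \<Longrightarrow> v (\<phi> x) \<le> B1"
    and "B2 \<ge> 1" and B2: "\<And>x. x \<in> Zp v \<Longrightarrow> v (\<psi> x) \<le> B2"
    using ucont_bounded[OF assms(1)] ucont_bounded[OF assms(2)] by metis
  define B where "B = max B1 B2"
  have B: "B \<ge> 1" "\<And>x. x \<in> Zp v \<Longrightarrow> v (\<phi> x) \<le> B" "\<And>x. x \<in> Zp v \<Longrightarrow> v (\<psi> x) \<le> B"
    using \<open>B1 \<ge> 1\<close> B1 B2 unfolding B_def by (auto simp: le_max_iff_disj)
  have e1: "e / B > 0" using B assms(3) by simp
  obtain k1 where k1: "\<And>n x y. n \<ge> k1 \<Longrightarrow> x \<in> Zp v \<Longrightarrow> y \<in> Zp v \<Longrightarrow> v (x - y) \<le> rad n \<Longrightarrow>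
    v (\<phi> x - \<phi> y) \<le> e / B" using ucontE[OF assms(1) e1] by blast
  obtain k2 where k2: "\<And>n x y. n \<ge> k2 \<Longrightarrow> x \<in> Zp v \<Longrightarrow> y \<in> Zp v \<Longrightarrow> v (x - y) \<le> rad n \<Longrightarrow>
    v (\<psi> x - \<psi> y) \<le> e / B" using ucontE[OF assms(2) e1] by blast
  define k where "k = max k1 k2"
  \<comment> \<open>\<open>l\<close> is chosen so that \<open>p ^ l\<close> times a term of size
    \<open>B * B\<close> is at most \<open>e\<close>.\<close>
  have "e / (B * B) > 0" using B assms(3) by simp
  from rad_less_ex[OF this] obtain l where "rad l < e / (B * B)" by blast
  then have l: "rad l * (B * B) \<le> e" using B by (simp add: field_simps)
  have "v (ctotal \<phi> \<psi> n m) \<le> e" if n: "n \<ge> k + l" for n m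
  proof -
    obtain i where i: "n = k + i" "l \<le> i" using n by (metis add.assoc le_add1 le_iff_add)
    define T where "T a = \<phi> (of_nat a) * \<psi> (of_nat m - of_nat a)" for a :: nat
    let ?t = "\<lambda>a. \<phi> (of_nat a) * \<psi> (of_nat (cdiff (p ^ n) m a))"
    have sum: "ctotal \<phi> \<psi> n m = (\<Sum>a<p ^ k. \<Sum>j<p ^ i. ?t (a + p ^ k * j))"
      unfolding ctotal_def i(1) power_add sum_lessThan_mult ..
    have 1: "v (?t (a + p ^ k * j) - T a) \<le> e / B * B" if a: "a < p ^ k" "j < p ^ i" for a j
      unfolding T_def
    proof (rule v_mult_diff_le)
      have less: "a + p ^ k * j < p ^ n"
      proof -
        have "a + p ^ k * j < p ^ k * Suc j" using a by simp
        also have "\<dots> \<le> p ^ k * p ^ i" using a by (intro mult_le_mono) auto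
        finally show ?thesis by (simp add: i power_add)
      qed
      have "v (of_nat (a + p ^ k * j) - of_nat a) \<le> rad k"
        unfolding v_nat_diff_le_rad by simp
      then show "v (\<phi> (of_nat (a + p ^ k * j)) - \<phi> (of_nat a)) \<le> e / B"
        by (intro k1[of k]) (auto simp: k_def simp del: of_nat_add)
      have "rad n \<le> rad k" using i rad_antimono[of k n] by simp
      then have "v (of_nat (cdiff (p ^ n) m (a + p ^ k * j)) - (of_nat m - of_nat (a + p ^ k * j))) \<le> rad k"
        using v_cdiff[OF less, of m] by linarith
      moreover have "v ((of_nat m - of_nat (a + p ^ k * j)) - (of_nat m - of_nat a)) \<le> rad k"
        using \<open>v (of_nat (a + p ^ k * j) - of_nat a) \<le> rad k\<close>
        by (subst v_minus_commute) (simp add: algebra_simps)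
      ultimately have "v (of_nat (cdiff (p ^ n) m (a + p ^ k * j)) - (of_nat m - of_nat a)) \<le> rad k"
        by (rule v_trans)
      then show "v (\<psi> (of_nat (cdiff (p ^ n) m (a + p ^ k * j))) - \<psi> (of_nat m - of_nat a)) \<le> e / B"
        by (intro k2[of k]) (auto simp: k_def Zp_diff)
    qed (auto intro: B)
    have 2: "v (of_nat (p ^ i) * T a) \<le> e" for a
    proof -
      have "v (of_nat (p ^ i) * T a) \<le> rad l * (B * B)"
        unfolding T_def using v_p_power[of i] rad_antimono[OF i(2)]
        by (intro v_mult_le B Zp_diff of_nat_Zp) simp
      then show ?thesis using l by linarith
    qed
    have "v (\<Sum>a<p ^ k. (\<Sum>j<p ^ i. ?t (a + p ^ k * j) - T a) + of_nat (p ^ i) * T a) \<le> e"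
      using 1 2 B assms(3) by (intro v_sum_le v_add_le) (auto simp del: of_nat_power)
    also have "(\<Sum>a<p ^ k. (\<Sum>j<p ^ i. ?t (a + p ^ k * j) - T a) + of_nat (p ^ i) * T a) = ctotal \<phi> \<psi> n m"
      by (simp add: sum sum_subtractf)
    finally show ?thesis .
  qed
  then show ?thesis by blast
qed

text \<open>Raising \<open>m\<close> by \<open>p ^ n\<close> adds \<open>p ^ n\<close> leading
  terms, which nearly form a complete sum over residues and are therefore small, and shifts the
  index of the others by \<open>p ^ n\<close>. Repeating this \<open>d\<close> times costs nothing
  in an ultrametric, so \<open>n0\<close> does not depend on \<open>d\<close>.\<close>

lemma csum_step:
  assumes "ucont \<phi>" "ucont \<psi>" "e > 0"
  shows "\<exists>n0. \<forall>n\<ge>n0. \<forall>m d. v (csum \<phi> \<psi> (m + p ^ n * d) - csum \<phi> \<psi> m) \<le> e"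
proof -
  obtain B1 B2 where "B1 \<ge> 1" and B1: "\<And>x. x \<in> Zp v \<Longrightarrow> v (\<phi> x) \<le> B1"
    and "B2 \<ge> 1" and B2: "\<And>x. x \<in> Zp v \<Longrightarrow> v (\<psi> x) \<le> B2"
    using ucont_bounded[OF assms(1)] ucont_bounded[OF assms(2)] by metis
  have e1: "e / B2 > 0" "e / B1 > 0" using \<open>B1 \<ge> 1\<close> \<open>B2 \<ge> 1\<close> assms(3) by auto
  obtain k1 where k1: "\<And>n x y. n \<ge> k1 \<Longrightarrow> x \<in> Zp v \<Longrightarrow> y \<in> Zp v \<Longrightarrow> v (x - y) \<le> rad n \<Longrightarrow>
    v (\<phi> x - \<phi> y) \<le> e / B2" using ucontE[OF assms(1) e1(1)] by blast
  obtain k2 where k2: "\<And>n x y. n \<ge> k2 \<Longrightarrow> x \<in> Zp v \<Longrightarrow> y \<in> Zp v \<Longrightarrow> v (x - y) \<le> rad n \<Longrightarrow>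
    v (\<psi> x - \<psi> y) \<le> e / B1" using ucontE[OF assms(2) e1(2)] by blast
  obtain k3 where k3: "\<And>n m. n \<ge> k3 \<Longrightarrow> v (ctotal \<phi> \<psi> n m) \<le> e" using ctotal_small[OF assms] by blast
  define n0 where "n0 = max k1 (max k2 k3)"
  have one: "v (csum \<phi> \<psi> (m + p ^ n) - csum \<phi> \<psi> m) \<le> e" if n: "n \<ge> n0" for n m
  proof -
    define m' where "m' = m mod p ^ n"
    define S where "S = (\<Sum>a<p ^ n. \<phi> (of_nat a) * \<psi> (of_nat (m + p ^ n - a)))"
    have split: "csum \<phi> \<psi> (m + p ^ n) = S + (\<Sum>a<Suc m. \<phi> (of_nat (p ^ n + a)) * \<psi> (of_nat (m - a)))"
    proof -
      have *: "Suc (m + p ^ n) = p ^ n + Suc m" by simp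
      show ?thesis unfolding csum_def S_def * sum_lessThan_add
        by (simp add: add.commute del: of_nat_diff of_nat_add sum.lessThan_Suc)
    qed
    have "v (S - ctotal \<phi> \<psi> n m') \<le> e"
      unfolding S_def ctotal_def sum_subtractf[symmetric] right_diff_distrib[symmetric]
    proof (rule v_sum_le)
      fix a assume "a \<in> {..<p ^ n}"
      then have a: "a < p ^ n" by simp
      have "of_nat (m + p ^ n - a) = (of_nat (m + p ^ n) - of_nat a :: 'a)"
        using a by (intro of_nat_diff) simp
      then have "v (of_nat (m + p ^ n - a) - (of_nat m' - of_nat a)) = v (of_nat (m + p ^ n) - of_nat m')"
        by (simp add: algebra_simps)
      also have "\<dots> \<le> rad n" unfolding v_nat_diff_le_rad m'_def by simp
      finally have "v (of_nat (m + p ^ n - a) - of_nat (cdiff (p ^ n) m' a)) \<le> rad n"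
        by (rule v_trans) (metis v_cdiff[OF a] v_minus_commute)
      then have "v (\<psi> (of_nat (m + p ^ n - a)) - \<psi> (of_nat (cdiff (p ^ n) m' a))) \<le> e / B1"
        using n by (intro k2[of n]) (auto simp: n0_def)
      then have "v (\<phi> (of_nat a) * (\<psi> (of_nat (m + p ^ n - a)) - \<psi> (of_nat (cdiff (p ^ n) m' a)))) \<le> B1 * (e / B1)"
        by (intro v_mult_le B1) auto
      then show "v (\<phi> (of_nat a) * (\<psi> (of_nat (m + p ^ n - a)) - \<psi> (of_nat (cdiff (p ^ n) m' a)))) \<le> e"
        using \<open>B1 \<ge> 1\<close> by simp
    qed (use assms in simp)
    from v_add_le[OF this k3[of n m']] n have S: "v S \<le> e" by (simp add: n0_def)
    have "v ((\<Sum>a<Suc m. \<phi> (of_nat (p ^ n + a)) * \<psi> (of_nat (m - a))) - csum \<phi> \<psi> m) \<le> e"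
      unfolding csum_def sum_subtractf[symmetric] left_diff_distrib[symmetric]
    proof (rule v_sum_le)
      fix a
      have "v (of_nat (p ^ n + a) - of_nat a) \<le> rad n" unfolding v_nat_diff_le_rad by simp
      then have "v (\<phi> (of_nat (p ^ n + a)) - \<phi> (of_nat a)) \<le> e / B2"
        using n by (intro k1[of n]) (auto simp: n0_def simp del: of_nat_add)
      then have "v ((\<phi> (of_nat (p ^ n + a)) - \<phi> (of_nat a)) * \<psi> (of_nat (m - a))) \<le> e / B2 * B2"
        by (intro v_mult_le B2) auto
      then show "v ((\<phi> (of_nat (p ^ n + a)) - \<phi> (of_nat a)) * \<psi> (of_nat (m - a))) \<le> e"
        using \<open>B2 \<ge> 1\<close> by simp
    qed (use assms in simp)
    from v_add_le[OF S this] show ?thesis unfolding split by (simp add: algebra_simps)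
  qed
  have "v (csum \<phi> \<psi> (m + p ^ n * d) - csum \<phi> \<psi> m) \<le> e" if n: "n \<ge> n0" for n m d
  proof (induction d)
    case (Suc d)
    have "v (csum \<phi> \<psi> (m + p ^ n * d + p ^ n) - csum \<phi> \<psi> (m + p ^ n * d)) \<le> e"
      by (rule one[OF n])
    from v_trans[OF this Suc.IH] show ?case by (simp add: algebra_simps)
  qed (use assms in simp)
  then show ?thesis by blast
qed

definition cconv :: "('a \<Rightarrow> 'a) \<Rightarrow> ('a \<Rightarrow> 'a) \<Rightarrow> 'a \<Rightarrow> 'a" where
  "cconv \<phi> \<psi> z = vlim v (\<lambda>n. csum \<phi> \<psi> (trunc n z))"

lemma csum_trunc_step:
  assumes "ucont \<phi>" "ucont \<psi>" "e > 0"
  shows "\<exists>n0. \<forall>n\<ge>n0. \<forall>z\<in>Zp v. v (csum \<phi> \<psi> (trunc (Suc n) z) - csum \<phi> \<psi> (trunc n z)) \<le> e"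
  using csum_step[OF assms] trunc_Suc by metis

lemma cconv_tendsto:
  assumes "ucont \<phi>" "ucont \<psi>" "z \<in> Zp v"
  shows "vtendsto v (\<lambda>n. csum \<phi> \<psi> (trunc n z)) (cconv \<phi> \<psi> z)"
proof -
  have "\<exists>L. vtendsto v (\<lambda>n. csum \<phi> \<psi> (trunc n z)) L"
    using csum_trunc_step[OF assms(1,2)] assms(3) by (intro converges_if_steps) blast
  then show ?thesis unfolding cconv_def using vlim_eq by metis
qed

lemma cconv_uniform:
  assumes "ucont \<phi>" "ucont \<psi>" "e > 0"
  shows "\<exists>n0. \<forall>n\<ge>n0. \<forall>z\<in>Zp v. v (csum \<phi> \<psi> (trunc n z) - cconv \<phi> \<psi> z) \<le> e"
proof -
  obtain n0 where n0: "\<And>n z. n \<ge> n0 \<Longrightarrow> z \<in> Zp v \<Longrightarrow>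
    v (csum \<phi> \<psi> (trunc (Suc n) z) - csum \<phi> \<psi> (trunc n z)) \<le> e"
    using csum_trunc_step[OF assms] by blast
  have "v (csum \<phi> \<psi> (trunc n z) - cconv \<phi> \<psi> z) \<le> e" if n: "n \<ge> n0" and z: "z \<in> Zp v" for n z
  proof (subst v_minus_commute, rule vtendsto_bound[OF cconv_tendsto[OF assms(1,2) z]])
    fix i assume "i \<ge> n"
    show "v (csum \<phi> \<psi> (trunc i z) - csum \<phi> \<psi> (trunc n z)) \<le> e"
      by (rule step_trans[where N = n and X = "\<lambda>i. csum \<phi> \<psi> (trunc i z)"])
        (use n0 n z \<open>i \<ge> n\<close> assms(3) in auto)
  qed
  then show ?thesis by blast
qed

lemma cconv_ucont:
  assumes "ucont \<phi>" "ucont \<psi>"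
  shows "ucont (cconv \<phi> \<psi>)"
  unfolding ucont_def
proof (intro allI impI)
  fix e :: real assume "e > 0"
  obtain n where n: "\<And>z. z \<in> Zp v \<Longrightarrow> v (csum \<phi> \<psi> (trunc n z) - cconv \<phi> \<psi> z) \<le> e"
    using cconv_uniform[OF assms \<open>e > 0\<close>] by blast
  have "v (cconv \<phi> \<psi> x - cconv \<phi> \<psi> y) \<le> e" if "x \<in> Zp v" "y \<in> Zp v" "v (x - y) \<le> rad n" for x y
  proof (rule v_trans)
    show "v (cconv \<phi> \<psi> x - csum \<phi> \<psi> (trunc n x)) \<le> e"
      by (subst v_minus_commute) (rule n[OF that(1)])
    show "v (csum \<phi> \<psi> (trunc n x) - cconv \<phi> \<psi> y) \<le> e"
      unfolding trunc_eq[OF that(2,3)] by (rule n[OF that(2)])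
  qed
  then show "\<exists>k. \<forall>x\<in>Zp v. \<forall>y\<in>Zp v. v (x - y) \<le> rad k \<longrightarrow> v (cconv \<phi> \<psi> x - cconv \<phi> \<psi> y) \<le> e"
    by blast
qed

lemma cconv_cong:
  assumes "\<And>x. x \<in> Zp v \<Longrightarrow> \<phi> x = \<phi>' x" "\<And>x. x \<in> Zp v \<Longrightarrow> \<psi> x = \<psi>' x"
  shows "cconv \<phi> \<psi> z = cconv \<phi>' \<psi>' z"
  using assms by (simp add: cconv_def csum_def del: of_nat_diff)

subsection \<open>The Volkenborn integral over residue classes\<close>

definition mean :: "(nat \<Rightarrow> 'a) \<Rightarrow> nat \<Rightarrow> 'a" where
  "mean h N = (\<Sum>x<p ^ N. h x) / of_nat p ^ N"

lemma mean_Suc: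
  "mean h (Suc N) - mean h N = (\<Sum>x<p ^ N. \<Sum>j<p. h (x + p ^ N * j) - h x) / of_nat p ^ Suc N"
proof -
  have "mean h N = (\<Sum>x<p ^ N. \<Sum>j<p. h x) / of_nat p ^ Suc N"
    using p_gt_1 by (simp add: mean_def flip: sum_distrib_left)
  moreover have "mean h (Suc N) = (\<Sum>x<p ^ N. \<Sum>j<p. h (x + p ^ N * j)) / of_nat p ^ Suc N"
    unfolding mean_def power_Suc2[of p N] sum_lessThan_mult by simp
  ultimately show ?thesis by (simp only: diff_divide_distrib sum_subtractf)
qed

text \<open>The factor \<open>p\<close> arises because the denominator is \<open>p ^ (N + 1)\<close>
  whereas the increments are measured against \<open>rad N\<close>.\<close>

lemma v_mean_Suc_le:
  assumes "0 \<le> e" "\<And>x j. x < p ^ N \<Longrightarrow> j < p \<Longrightarrow> v (h (x + p ^ N * j) - h x) \<le> e * rad N"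
  shows "v (mean h (Suc N) - mean h N) \<le> real p * e"
  unfolding mean_Suc
proof (rule v_divide_p_power_le)
  have "v (\<Sum>x<p ^ N. \<Sum>j<p. h (x + p ^ N * j) - h x) \<le> e * rad N"
    using assms by (intro v_sum_le) auto
  also have "\<dots> = real p * e * rad (Suc N)" using p_gt_1 by (simp add: rad_Suc)
  finally show "v (\<Sum>x<p ^ N. \<Sum>j<p. h (x + p ^ N * j) - h x) \<le> real p * e * rad (Suc N)" .
qed

definition vol :: "('a \<Rightarrow> 'a) \<Rightarrow> nat \<Rightarrow> nat \<Rightarrow> 'a" where
  "vol f n a = vlim v (mean (\<lambda>y. f (of_nat (a + p ^ n * y))))"

lemma v_progression: "v (of_nat (a + p ^ n * (x + p ^ N * j)) - of_nat (a + p ^ n * x)) \<le> rad (n + N)"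
  by (simp add: v_mult v_p_power rad_add v_nat_le_1 mult_left_le algebra_simps)

text \<open>Consecutive means differ by increments of \<open>f\<close> divided by
  \<open>p ^ (N + 1)\<close>. Replacing the increments by their linear parts leaves a multiple of
  \<open>p ^ N\<close> times a sum of derivatives over \<open>p ^ N\<close> points of a progression,
  and this sum tends to 0 by \<open>ctotal_small\<close>.\<close>

lemma vol_tendsto:
  assumes f: "UDd f d"
  shows "vtendsto v (mean (\<lambda>y. f (of_nat (a + p ^ n * y)))) (vol f n a)"
proof -
  let ?u = "\<lambda>x. of_nat (a + p ^ n * x) :: 'a"
  let ?h = "\<lambda>x. f (?u x)"
  have d: "ucont d" by (rule UDd_imp_ucont_deriv[OF f])
  have d': "ucont (\<lambda>x. d (of_nat a + of_nat (p ^ n) * x))"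
    unfolding ucont_def
  proof (intro allI impI)
    fix e :: real assume "e > 0"
    from ucontE[OF d this] obtain k where k: "\<And>m x y. m \<ge> k \<Longrightarrow> x \<in> Zp v \<Longrightarrow> y \<in> Zp v \<Longrightarrow>
      v (x - y) \<le> rad m \<Longrightarrow> v (d x - d y) \<le> e" by blast
    have "v (d (of_nat a + of_nat (p ^ n) * x) - d (of_nat a + of_nat (p ^ n) * y)) \<le> e"
      if "x \<in> Zp v" "y \<in> Zp v" "v (x - y) \<le> rad k" for x y
    proof (rule k[of k])
      have "v (of_nat (p ^ n) * (x - y)) \<le> 1 * rad k"
        using that(3) by (intro v_mult_le v_nat_le_1)
      then show "v (of_nat a + of_nat (p ^ n) * x - (of_nat a + of_nat (p ^ n) * y)) \<le> rad k"
        by (simp add: algebra_simps)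
    qed (auto intro!: Zp_add Zp_mult that simp del: of_nat_power)
    then show "\<exists>k. \<forall>x\<in>Zp v. \<forall>y\<in>Zp v. v (x - y) \<le> rad k \<longrightarrow>
      v (d (of_nat a + of_nat (p ^ n) * x) - d (of_nat a + of_nat (p ^ n) * y)) \<le> e" by blast
  qed
  have "\<exists>L. vtendsto v (mean ?h) L"
  proof (rule converges_if_steps)
    fix e :: real assume "e > 0"
    then have e: "e / p > 0" using p_gt_1 by simp
    obtain k where k: "\<And>m x y b. m \<ge> k \<Longrightarrow> x \<in> Zp v \<Longrightarrow> y \<in> Zp v \<Longrightarrow> b \<in> Zp v \<Longrightarrow>
      v (x - b) \<le> rad m \<Longrightarrow> v (y - b) \<le> rad m \<Longrightarrow> v (f x - f y - (x - y) * d b) \<le> e / p * v (x - y)"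
      using UDdE[OF f e] by blast
    \<comment> \<open>Against the constant function 1, \<open>ctotal\<close> is the plain sum of the
      derivatives along the progression.\<close>
    obtain n0 where n0: "\<And>N. N \<ge> n0 \<Longrightarrow> v (\<Sum>x<p ^ N. d (?u x)) \<le> e / p"
      using ctotal_small[OF d' ucont_const[of 1] e] by (auto simp: ctotal_def)
    have "v (mean ?h (Suc N) - mean ?h N) \<le> e" if N: "N \<ge> max k n0" for N
    proof -
      let ?w = "\<lambda>x j. of_nat (p ^ (n + N) * j) * d (?u x)"
      have nonneg: "0 \<le> e / p * rad N" using \<open>e > 0\<close> by (intro mult_nonneg_nonneg) auto
      have 1: "v (?h (x + p ^ N * j) - ?h x - ?w x j) \<le> e / p * rad N" for x j
      proof -
        have diff: "?u (x + p ^ N * j) - ?u x = of_nat (p ^ (n + N) * j)"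
          by (simp add: power_add algebra_simps)
        have "v (?h (x + p ^ N * j) - ?h x - (?u (x + p ^ N * j) - ?u x) * d (?u x))
          \<le> e / p * v (?u (x + p ^ N * j) - ?u x)"
          using v_progression N by (intro k[of "n + N"]) (auto simp del: of_nat_add of_nat_mult)
        also have "\<dots> \<le> e / p * rad N"
          using order_trans[OF v_progression, of n N "rad N"] rad_antimono[of N "n + N"] e
          by (intro mult_left_mono) auto
        finally show ?thesis unfolding diff .
      qed
      have sum: "(\<Sum>x<p ^ N. \<Sum>j<p. ?w x j) = of_nat (p ^ (n + N)) * (\<Sum>j<p. of_nat j) * (\<Sum>x<p ^ N. d (?u x))"
        by (simp add: sum_distrib_left sum_distrib_right mult_ac sum.swap[of _ "{..<p}"])
      have "v (of_nat (p ^ (n + N)) * (\<Sum>j<p. of_nat j)) \<le> rad N * 1"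
        using v_p_power[of "n + N"] rad_antimono[of N "n + N"]
        by (intro v_mult_le v_sum_le v_nat_le_1) auto
      then have "v (\<Sum>x<p ^ N. \<Sum>j<p. ?w x j) \<le> rad N * 1 * (e / p)"
        unfolding sum using n0[of N] N by (intro v_mult_le[of _ "rad N * 1"]) auto
      moreover have "v (\<Sum>x<p ^ N. \<Sum>j<p. ?h (x + p ^ N * j) - ?h x - ?w x j) \<le> e / p * rad N"
        by (intro v_sum_le nonneg 1)
      ultimately have "v ((\<Sum>x<p ^ N. \<Sum>j<p. ?h (x + p ^ N * j) - ?h x - ?w x j) + (\<Sum>x<p ^ N. \<Sum>j<p. ?w x j))
        \<le> e / p * rad N" by (intro v_add_le) (simp_all add: mult.commute)
      then have "v (\<Sum>x<p ^ N. \<Sum>j<p. ?h (x + p ^ N * j) - ?h x) \<le> e / p * rad N"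
        unfolding sum_subtractf by simp
      also have "\<dots> = e * rad (Suc N)" by (simp add: rad_Suc)
      finally show ?thesis unfolding mean_Suc by (rule v_divide_p_power_le)
    qed
    then show "\<exists>N. \<forall>n\<ge>N. v (mean ?h (Suc n) - mean ?h n) \<le> e" by blast
  qed
  then show ?thesis unfolding vol_def using vlim_eq by metis
qed

text \<open>As \<open>N\<close> grows this tends to \<open>- c / 2\<close>, which is the source of
  the term \<open>- p ^ n f'(a) / 2\<close> in the expansion of \<open>vol\<close>.\<close>

lemma mean_linear: "mean (\<lambda>y. c * of_nat y) N = c * (of_nat p ^ N - 1) / 2"
proof -
  have *: "2 * (\<Sum>y<M. of_nat y) = of_nat M * (of_nat M - 1 :: 'a)" for M
    by (induction M) (simp_all add: algebra_simps)
  have "2 * (\<Sum>y<p ^ N. c * of_nat y) = c * (2 * (\<Sum>y<p ^ N. of_nat y :: 'a))"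
    by (simp flip: sum_distrib_left)
  also have "\<dots> = c * (of_nat p ^ N * (of_nat p ^ N - 1))" by (simp only: * of_nat_power)
  finally have "(\<Sum>y<p ^ N. c * of_nat y) = c * (of_nat p ^ N * (of_nat p ^ N - 1)) / 2"
    by (simp add: field_simps)
  then show ?thesis by (simp add: mean_def)
qed

lemma mean_const: "mean (\<lambda>_. c) N = c"
  using p_gt_1 by (simp add: mean_def)

lemma mean_add: "mean (\<lambda>x. g x + h x) N = mean g N + mean h N"
  by (simp add: mean_def sum.distrib add_divide_distrib)

lemma p_power_tendsto: "vtendsto v (\<lambda>N. of_nat p ^ N) 0"
  unfolding vtendsto_iff using rad_tendsto by (simp add: v_p_power)

text \<open>The mean of the linear Taylor part is explicit. For the remainder \<open>h\<close> each
  step from level \<open>N\<close> to \<open>N + 1\<close> is at most \<open>e * rad n\<close>,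
  because \<open>h\<close> inherits the factor \<open>p ^ n\<close> of the progression; the bound
  then passes to the limit.\<close>

lemma vol_approx:
  assumes f: "UDd f d" and "e > 0"
  shows "\<exists>n0. \<forall>n\<ge>n0. \<forall>a. v (vol f n a - (f (of_nat a) - of_nat p ^ n * d (of_nat a) / 2)) \<le> e * rad n"
proof -
  have e: "e / p > 0" using p_gt_1 \<open>e > 0\<close> by simp
  obtain k where k: "\<And>m x y b. m \<ge> k \<Longrightarrow> x \<in> Zp v \<Longrightarrow> y \<in> Zp v \<Longrightarrow> b \<in> Zp v \<Longrightarrow>
    v (x - b) \<le> rad m \<Longrightarrow> v (y - b) \<le> rad m \<Longrightarrow> v (f x - f y - (x - y) * d b) \<le> e / p * v (x - y)"
    using UDdE[OF f e] by blast
  have "v (vol f n a - (f (of_nat a) - of_nat p ^ n * d (of_nat a) / 2)) \<le> e * rad n" if n: "n \<ge> k" for n a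
  proof -
    let ?u = "\<lambda>x. of_nat (a + p ^ n * x) :: 'a"
    let ?c = "of_nat p ^ n * d (of_nat a)"
    define h where "h y = f (?u y) - f (of_nat a) - ?c * of_nat y" for y
    have "mean (\<lambda>y. f (?u y)) N = mean (\<lambda>y. h y + (?c * of_nat y + f (of_nat a))) N" for N
      by (simp add: h_def)
    then have mean: "mean (\<lambda>y. f (?u y)) N = mean h N + (?c * (of_nat p ^ N - 1) / 2 + f (of_nat a))" for N
      by (simp only: mean_add mean_linear mean_const)
    have "vtendsto v (\<lambda>N. mean (\<lambda>y. f (?u y)) N - (?c * (of_nat p ^ N - 1) / 2 + f (of_nat a)))
      (vol f n a - (?c * (0 - 1) / 2 + f (of_nat a)))"
      by (intro vtendsto_diff vtendsto_add vtendsto_cdivide vtendsto_cmult vol_tendsto[OF f]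
          vtendsto_const p_power_tendsto)
    then have "vtendsto v (mean h) (vol f n a - (?c * (0 - 1) / 2 + f (of_nat a)))"
      by (simp only: mean add_diff_cancel_right')
    moreover have "?c * (0 - 1) / 2 + f (of_nat a) = f (of_nat a) - ?c / 2" by simp
    ultimately have lim: "vtendsto v (mean h) (vol f n a - (f (of_nat a) - ?c / 2))"
      by (simp only:)
    have step: "v (mean h (Suc N) - mean h N) \<le> e * rad n" for N
    proof -
      have "v (h (x + p ^ N * j) - h x) \<le> e / p * rad n * rad N" for x j
      proof -
        have near: "v (?u y - of_nat a) \<le> rad n" for y
          unfolding v_nat_diff_le_rad by simp
        have "v (f (?u (x + p ^ N * j)) - f (?u x) - (?u (x + p ^ N * j) - ?u x) * d (of_nat a))
          \<le> e / p * v (?u (x + p ^ N * j) - ?u x)"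
          using near n by (intro k) (auto simp del: of_nat_add of_nat_mult)
        also have "\<dots> \<le> e / p * rad (n + N)"
          using e v_progression by (intro mult_left_mono) auto
        also have "f (?u (x + p ^ N * j)) - f (?u x) - (?u (x + p ^ N * j) - ?u x) * d (of_nat a)
          = h (x + p ^ N * j) - h x" by (simp add: h_def algebra_simps)
        finally show ?thesis by (simp add: rad_add mult.assoc)
      qed
      then have "v (mean h (Suc N) - mean h N) \<le> real p * (e / p * rad n)"
        using \<open>e > 0\<close> by (intro v_mean_Suc_le mult_nonneg_nonneg) auto
      then show ?thesis using p_gt_1 by simp
    qed
    \<comment> \<open>At level 0 only \<open>y = 0\<close> enters, where \<open>h\<close> vanishes,
      so the mean is the sum of its steps.\<close>
    have "mean h 0 = 0" by (simp add: mean_def h_def)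
    then have "v (mean h N) \<le> e * rad n" for N
      using step_trans[of 0 "mean h" "e * rad n" 0 N, OF step] \<open>e > 0\<close> by simp
    then show ?thesis by (rule vtendsto_bound0[OF lim])
  qed
  then show ?thesis by blast
qed

text \<open>Writing \<open>y = j + p * y'\<close> splits the progression of step
  \<open>p ^ n\<close> into \<open>p\<close> progressions of step \<open>p ^ (n + 1)\<close>; the
  factor \<open>p\<close> comes from the shorter average.\<close>

lemma vol_distribution:
  assumes f: "UDd f d"
  shows "(\<Sum>j<p. vol f (Suc n) (a + p ^ n * j)) = of_nat p * vol f n a"
proof -
  have "of_nat p * mean (\<lambda>y. f (of_nat (a + p ^ n * y))) (Suc N) =
    (\<Sum>j<p. mean (\<lambda>y. f (of_nat (a + p ^ n * j + p ^ Suc n * y))) N)" for N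
    unfolding mean_def power_Suc[of p N] sum_lessThan_mult
    by (simp add: algebra_simps del: of_nat_add of_nat_mult flip: sum_divide_distrib)
  moreover have "vtendsto v (\<lambda>N. of_nat p * mean (\<lambda>y. f (of_nat (a + p ^ n * y))) (Suc N)) (of_nat p * vol f n a)"
    using vtendsto_shift[of _ 1] vol_tendsto[OF f] by (intro vtendsto_cmult) simp
  moreover have "vtendsto v (\<lambda>N. \<Sum>j<p. mean (\<lambda>y. f (of_nat (a + p ^ n * j + p ^ Suc n * y))) N)
    (\<Sum>j<p. vol f (Suc n) (a + p ^ n * j))"
    by (intro vtendsto_sum vol_tendsto[OF f])
  ultimately show ?thesis using vtendsto_unique by simp
qed

subsection \<open>The discrete convolution at finite level\<close>

definition dconv :: "('a \<Rightarrow> 'a) \<Rightarrow> ('a \<Rightarrow> 'a) \<Rightarrow> nat \<Rightarrow> nat \<Rightarrow> 'a" where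
  "dconv f g n m = (\<Sum>a<p ^ n. vol f n a * vol g n (cdiff (p ^ n) m a)) / of_nat p ^ n"

text \<open>2 is a unit for odd \<open>p\<close> and has value 1/2 for \<open>p = 2\<close>; the
  common factor 2 avoids a case distinction in the estimates that follow.\<close>

lemma v_half: "v (x / 2) \<le> 2 * v x"
proof -
  have "v 2 \<ge> 1 / 2"
  proof (cases "p = 2")
    case True
    then show ?thesis using v_p by simp
  next
    case False
    then have "\<not> int p dvd 2"
      using p_gt_1 by (metis int_dvd_int_iff int_ops(3) primes_dvd_imp_eq prime_p two_is_prime_nat)
    then show ?thesis using v_int_not_dvd[of 2] by simp
  qed
  then have "v x \<le> 2 * v x * v 2" using mult_left_mono[of "1/2" "v 2" "2 * v x"] by simp
  moreover have "v 2 > 0" by simp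
  ultimately show ?thesis by (simp add: v_divide pos_divide_le_eq)
qed

lemma v_half_le: "v x \<le> e \<Longrightarrow> v (x / 2) \<le> 2 * e"
  using v_half[of x] by linarith

lemma UDd_bounds:
  assumes "UDd f d" "UDd g d'"
  obtains B where "B \<ge> 1" "\<And>x. x \<in> Zp v \<Longrightarrow> v (f x) \<le> B" "\<And>x. x \<in> Zp v \<Longrightarrow> v (d x) \<le> B"
    "\<And>x. x \<in> Zp v \<Longrightarrow> v (g x) \<le> B" "\<And>x. x \<in> Zp v \<Longrightarrow> v (d' x) \<le> B"
proof -
  obtain B1 where B1: "B1 \<ge> 1" "\<And>x. x \<in> Zp v \<Longrightarrow> v (f x) \<le> B1"
    using ucont_bounded[OF UDd_imp_ucont[OF assms(1)]] by blast
  obtain B2 where B2: "B2 \<ge> 1" "\<And>x. x \<in> Zp v \<Longrightarrow> v (d x) \<le> B2"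
    using ucont_bounded[OF UDd_imp_ucont_deriv[OF assms(1)]] by blast
  obtain B3 where B3: "B3 \<ge> 1" "\<And>x. x \<in> Zp v \<Longrightarrow> v (g x) \<le> B3"
    using ucont_bounded[OF UDd_imp_ucont[OF assms(2)]] by blast
  obtain B4 where B4: "B4 \<ge> 1" "\<And>x. x \<in> Zp v \<Longrightarrow> v (d' x) \<le> B4"
    using ucont_bounded[OF UDd_imp_ucont_deriv[OF assms(2)]] by blast
  show ?thesis
    by (rule that[of "max (max B1 B2) (max B3 B4)"]) (use B1 B2 B3 B4 in \<open>auto simp: le_max_iff_disj\<close>)
qed

text \<open>Here \<open>w\<close> is the error made in replacing \<open>z - a\<close> by its representative \<open>b\<close> modulo \<open>p ^ n\<close>.\<close>
lemma vol_product_approx: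
  assumes f: "UDd f d" and g: "UDd g d'" and "e > 0"
  shows "\<exists>n0. \<forall>n\<ge>n0. \<forall>z\<in>Zp v. \<forall>a b w. of_nat b = z - of_nat a + w \<longrightarrow> v w \<le> rad n \<longrightarrow>
    v (f (of_nat a) * g (z - of_nat a) - vol f n a * vol g n b + w * (f (of_nat a) * d' (of_nat b))
      - of_nat p ^ n / 2 * (d (of_nat a) * g (of_nat b) + f (of_nat a) * d' (of_nat b))) \<le> e * rad n"
proof -
  obtain B where B: "B \<ge> 1" "\<And>x. x \<in> Zp v \<Longrightarrow> v (f x) \<le> B" "\<And>x. x \<in> Zp v \<Longrightarrow> v (d x) \<le> B"
    "\<And>x. x \<in> Zp v \<Longrightarrow> v (g x) \<le> B" "\<And>x. x \<in> Zp v \<Longrightarrow> v (d' x) \<le> B"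
    using UDd_bounds[OF f g] by blast
  \<comment> \<open>The bound 1 keeps \<open>vol g n b\<close> within \<open>2 * B\<close>; the
    other bound allows an error \<open>e1 * rad n\<close> to be multiplied by anything up to
    \<open>2 * B\<close>.\<close>
  define e1 where "e1 = min 1 (e / (2 * B))"
  have e1: "e1 > 0" "e1 \<le> 1" "e1 * (2 * B) \<le> e"
    using B(1) \<open>e > 0\<close> by (auto simp: e1_def min_def field_simps)
  obtain k1 where k1: "\<And>n a. n \<ge> k1 \<Longrightarrow>
    v (vol f n a - (f (of_nat a) - of_nat p ^ n * d (of_nat a) / 2)) \<le> e1 * rad n"
    using vol_approx[OF f e1(1)] by blast
  obtain k2 where k2: "\<And>n a. n \<ge> k2 \<Longrightarrow>
    v (vol g n a - (g (of_nat a) - of_nat p ^ n * d' (of_nat a) / 2)) \<le> e1 * rad n"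
    using vol_approx[OF g e1(1)] by blast
  obtain k3 where k3: "\<And>m x y b. m \<ge> k3 \<Longrightarrow> x \<in> Zp v \<Longrightarrow> y \<in> Zp v \<Longrightarrow> b \<in> Zp v \<Longrightarrow>
    v (x - b) \<le> rad m \<Longrightarrow> v (y - b) \<le> rad m \<Longrightarrow> v (g x - g y - (x - y) * d' b) \<le> e1 * v (x - y)"
    using UDdE[OF g e1(1)] by blast
  have "e / (4 * B * B) > 0" using B(1) \<open>e > 0\<close> by simp
  from rad_less_ex[OF this] obtain k4 where "rad k4 < e / (4 * B * B)" by blast
  then have k4: "rad k4 * (4 * B * B) \<le> e" using B(1) by (simp add: field_simps)
  define n0 where "n0 = max (max k1 k2) (max k3 k4)"
  have "v (f (of_nat a) * g (z - of_nat a) - vol f n a * vol g n b + w * (f (of_nat a) * d' (of_nat b))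
      - of_nat p ^ n / 2 * (d (of_nat a) * g (of_nat b) + f (of_nat a) * d' (of_nat b))) \<le> e * rad n"
    if n: "n \<ge> n0" and z: "z \<in> Zp v" and b: "of_nat b = z - of_nat a + w" and w: "v w \<le> rad n"
    for n z a b w
  proof -
    define fa da gb d'b where "fa = f (of_nat a)" and "da = d (of_nat a)"
      and "gb = g (of_nat b)" and "d'b = d' (of_nat b)"
    have bounds: "v fa \<le> B" "v da \<le> B" "v gb \<le> B" "v d'b \<le> B"
      by (simp_all add: fa_def da_def gb_def d'b_def B)
    define P where "P = (of_nat p ^ n :: 'a)"
    have P: "v P = rad n" by (simp add: P_def v_p_power)
    define \<alpha> where "\<alpha> = vol f n a - (fa - P * da / 2)"
    define \<beta> where "\<beta> = vol g n b - (gb - P * d'b / 2)"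
    define \<gamma> where "\<gamma> = gb - g (z - of_nat a) - w * d'b"
    have \<alpha>: "v \<alpha> \<le> e1 * rad n" unfolding \<alpha>_def fa_def da_def P_def using n by (intro k1) (simp add: n0_def)
    have \<beta>: "v \<beta> \<le> e1 * rad n" unfolding \<beta>_def gb_def d'b_def P_def using n by (intro k2) (simp add: n0_def)
    have w': "w = of_nat b - (z - of_nat a)" using b by simp
    have "v \<gamma> \<le> e1 * v w"
      unfolding \<gamma>_def gb_def d'b_def unfolding w'
      by (rule k3[of n]) (use n w in \<open>auto simp: n0_def w' v_minus_commute intro!: Zp_diff z\<close>)
    also have "\<dots> \<le> e1 * rad n" using w e1(1) by simp
    finally have \<gamma>: "v \<gamma> \<le> e1 * rad n" .
    have e1': "e1 * rad n \<le> 2 * B * rad n" using e1(2) B(1) by (intro mult_right_mono) auto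
    have "v (P * d'b / 2) \<le> 2 * (rad n * B)" by (intro v_half_le v_mult_le bounds) (simp add: P)
    then have "v (P * d'b / 2) \<le> 2 * B * rad n" by (simp add: mult_ac)
    from v_diff_le[OF order_trans[OF \<beta> e1'] this]
    have Vg: "v (vol g n b - gb) \<le> 2 * B * rad n" by (simp add: \<beta>_def)
    also have "\<dots> \<le> 2 * B" using B(1) by (simp add: mult_left_le)
    finally have "v ((vol g n b - gb) + gb) \<le> 2 * B" using bounds(3) B(1) by (intro v_add_le) auto
    then have V: "v (vol g n b) \<le> 2 * B" by simp
    have small: "x * (e1 * rad n) \<le> e * rad n" if "x \<le> 2 * B" for x
    proof -
      have "x * (e1 * rad n) \<le> 2 * B * (e1 * rad n)" using that e1(1) by (intro mult_right_mono) auto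
      also have "\<dots> \<le> e * rad n" using mult_right_mono[OF e1(3), of "rad n"] by (simp add: mult_ac)
      finally show ?thesis .
    qed
    have 1: "v (fa * \<gamma>) \<le> e * rad n"
      using v_mult_le[OF bounds(1) \<gamma>] small[of B] B(1) by linarith
    have 2: "v (vol g n b * \<alpha>) \<le> e * rad n"
      using v_mult_le[OF V \<alpha>] small[of "2 * B"] by linarith
    have 3: "v (fa * \<beta>) \<le> e * rad n"
      using v_mult_le[OF bounds(1) \<beta>] small[of B] B(1) by linarith
    \<comment> \<open>A product of two first-order terms has order \<open>p ^ (2 * n)\<close>; one
      factor \<open>rad n\<close> is at most \<open>rad k4\<close> and absorbs the constant
      \<open>4 * B * B\<close>.\<close>
    have "v (P * da / 2 * (vol g n b - gb)) \<le> 2 * (rad n * B) * (2 * B * rad n)"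
      by (intro v_mult_le v_half_le Vg bounds) (simp add: P)
    also have "\<dots> = rad n * (4 * B * B) * rad n" by (simp add: mult_ac)
    also have "\<dots> \<le> rad k4 * (4 * B * B) * rad n"
      using n B(1) by (intro mult_right_mono rad_antimono) (auto simp: n0_def)
    also have "\<dots> \<le> e * rad n" using k4 by (intro mult_right_mono) auto
    finally have 4: "v (P * da / 2 * (vol g n b - gb)) \<le> e * rad n" .
    \<comment> \<open>Inserting the expansions of \<open>vol f n a\<close>, \<open>vol g n b\<close>
      and \<open>g (z - of_nat a)\<close>, with errors \<open>\<alpha>\<close>,
      \<open>\<beta>\<close> and \<open>\<gamma>\<close>, cancels everything of order 0 and 1 in
      \<open>P\<close>.\<close>
    have "fa * g (z - of_nat a) - vol f n a * vol g n b + w * (fa * d'b) - P / 2 * (da * gb + fa * d'b)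
      = P * da / 2 * (vol g n b - gb) - fa * \<gamma> - vol g n b * \<alpha> - fa * \<beta>"
      unfolding \<alpha>_def \<beta>_def \<gamma>_def by (simp add: algebra_simps add_divide_distrib)
    also have "v \<dots> \<le> e * rad n" by (intro v_diff_le 1 2 3 4)
    finally show ?thesis unfolding fa_def da_def gb_def d'b_def P_def .
  qed
  then show ?thesis by blast
qed

text \<open>Summing the expansion of the products over all \<open>a\<close> and dividing by
  \<open>p ^ n\<close> leaves first-order sums. Those over all residues are complete and vanish in
  the limit; the borrow singles out \<open>a \<le> m\<close>, which is where \<open>csum\<close>
  comes from.\<close>

lemma dconv_vs_mean:
  assumes f: "UDd f d" and g: "UDd g d'" and z: "z \<in> Zp v"
  shows "vtendsto v (\<lambda>n. mean (\<lambda>a. f (of_nat a) * g (z - of_nat a)) n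
    - dconv f g n (trunc n z) - csum f d' (trunc n z)) 0"
proof (rule vtendstoI)
  fix e :: real assume "e > 0"
  then have e2: "e / 2 > 0" by simp
  have uc: "ucont f" "ucont d" "ucont g" "ucont d'"
    using f g UDd_imp_ucont UDd_imp_ucont_deriv by blast+
  obtain k1 where k1: "\<And>n a b w. n \<ge> k1 \<Longrightarrow> of_nat b = z - of_nat a + w \<Longrightarrow> v w \<le> rad n \<Longrightarrow>
    v (f (of_nat a) * g (z - of_nat a) - vol f n a * vol g n b + w * (f (of_nat a) * d' (of_nat b))
      - of_nat p ^ n / 2 * (d (of_nat a) * g (of_nat b) + f (of_nat a) * d' (of_nat b))) \<le> e * rad n"
    using vol_product_approx[OF f g \<open>e > 0\<close>] z by blast
  obtain k2 where k2: "\<And>n m. n \<ge> k2 \<Longrightarrow> v (ctotal f d' n m) \<le> e / 2"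
    using ctotal_small[OF uc(1,4) e2] by blast
  obtain k3 where k3: "\<And>n m. n \<ge> k3 \<Longrightarrow> v (ctotal d g n m) \<le> e / 2"
    using ctotal_small[OF uc(2,3) e2] by blast
  have "v (mean (\<lambda>a. f (of_nat a) * g (z - of_nat a)) n
    - dconv f g n (trunc n z) - csum f d' (trunc n z) - 0) \<le> e" if n: "n \<ge> max k1 (max k2 k3)" for n
  proof -
    define m where "m = trunc n z"
    have m: "m < p ^ n" unfolding m_def by (rule trunc_less[OF z])
    define P where "P = (of_nat p ^ n :: 'a)"
    have P: "P \<noteq> 0" "v P = rad n" by (simp_all add: P_def v_p_power)
    define \<rho> where "\<rho> = (z - of_nat m) / P"
    have \<rho>: "v \<rho> \<le> 1" "z - of_nat m = P * \<rho>"
      using v_divide_p_power_le[of "z - of_nat m" 1 n] trunc_close[OF z, of n] P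
      by (auto simp: \<rho>_def m_def P_def)
    \<comment> \<open>The shift is 0 or \<open>P\<close> according to whether \<open>m - a\<close>
      borrows, less the part \<open>P * \<rho>\<close> of \<open>z\<close> beyond its first
      \<open>n\<close> digits.\<close>
    define w where "w a = (if a \<le> m then 0 else P) - P * \<rho>" for a
    define b where "b a = cdiff (p ^ n) m a" for a
    have b: "of_nat (b a) = z - of_nat a + w a" if "a < p ^ n" for a
      using that \<rho>(2) by (simp add: b_def of_nat_cdiff w_def P_def algebra_simps)
    have w: "v (w a) \<le> rad n" for a
      unfolding w_def using v_mult_le[of P "rad n" \<rho> 1] \<rho>(1) P(2) by (intro v_diff_le) auto
    define E where "E a = f (of_nat a) * g (z - of_nat a) - vol f n a * vol g n (b a)
      + w a * (f (of_nat a) * d' (of_nat (b a)))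
      - P / 2 * (d (of_nat a) * g (of_nat (b a)) + f (of_nat a) * d' (of_nat (b a)))" for a
    have E: "v (E a) \<le> e * rad n" if "a < p ^ n" for a
      unfolding E_def P_def using n by (intro k1 b w that) simp
    have low: "(\<Sum>a<p ^ n. if a \<le> m then f (of_nat a) * d' (of_nat (b a)) else 0) = csum f d' m"
    proof -
      have "(\<Sum>a<p ^ n. if a \<le> m then f (of_nat a) * d' (of_nat (b a)) else 0)
        = (\<Sum>a\<in>{..<p ^ n} \<inter> {a. a \<le> m}. f (of_nat a) * d' (of_nat (b a)))"
        by (simp add: sum.inter_restrict)
      also have "{..<p ^ n} \<inter> {a. a \<le> m} = {..<Suc m}" using m by auto
      finally show ?thesis by (simp add: csum_def b_def cdiff_def del: of_nat_diff sum.lessThan_Suc)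
    qed
    \<comment> \<open>The borrow indicator is 1 minus the indicator of \<open>a \<le> m\<close>,
      which gives a complete sum minus an incomplete one.\<close>
    have "(\<Sum>a<p ^ n. w a * (f (of_nat a) * d' (of_nat (b a))))
      = (\<Sum>a<p ^ n. (P - P * \<rho>) * (f (of_nat a) * d' (of_nat (b a)))
         - P * (if a \<le> m then f (of_nat a) * d' (of_nat (b a)) else 0))"
      by (intro sum.cong refl) (simp add: w_def algebra_simps)
    also have "\<dots> = (P - P * \<rho>) * ctotal f d' n m - P * csum f d' m"
      by (simp add: sum_subtractf low ctotal_def b_def flip: sum_distrib_left)
    finally have W: "(\<Sum>a<p ^ n. w a * (f (of_nat a) * d' (of_nat (b a))))
      = (P - P * \<rho>) * ctotal f d' n m - P * csum f d' m" .
    have "(\<Sum>a<p ^ n. E a) = (\<Sum>a<p ^ n. f (of_nat a) * g (z - of_nat a)) - (\<Sum>a<p ^ n. vol f n a * vol g n (b a))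
      + (\<Sum>a<p ^ n. w a * (f (of_nat a) * d' (of_nat (b a))))
      - P / 2 * (ctotal d g n m + ctotal f d' n m)"
      unfolding E_def ctotal_def b_def sum.distrib sum_subtractf sum_distrib_left distrib_left ..
    then have "(\<Sum>a<p ^ n. E a) / P = mean (\<lambda>a. f (of_nat a) * g (z - of_nat a)) n - dconv f g n m
      + ((1 - \<rho>) * ctotal f d' n m - csum f d' m) - (ctotal d g n m + ctotal f d' n m) / 2"
      unfolding W unfolding mean_def dconv_def b_def P_def[symmetric] using P(1) by (simp add: field_simps)
    then have eq: "mean (\<lambda>a. f (of_nat a) * g (z - of_nat a)) n - dconv f g n m - csum f d' m
      = (\<Sum>a<p ^ n. E a) / P - (1 - \<rho>) * ctotal f d' n m + (ctotal d g n m + ctotal f d' n m) / 2"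
      by (simp add: algebra_simps)
    have 1: "v ((\<Sum>a<p ^ n. E a) / P) \<le> e"
      unfolding P_def using \<open>e > 0\<close> E by (intro v_divide_p_power_le v_sum_le) auto
    have "v ((1 - \<rho>) * ctotal f d' n m) \<le> 1 * (e / 2)"
      using n \<rho> by (intro v_mult_le k2 v_diff_le) auto
    then have 2: "v ((1 - \<rho>) * ctotal f d' n m) \<le> e" using \<open>e > 0\<close> by simp
    have "v ((ctotal d g n m + ctotal f d' n m) / 2) \<le> 2 * (e / 2)"
      using n by (intro v_half_le v_add_le k2 k3) auto
    then have 3: "v ((ctotal d g n m + ctotal f d' n m) / 2) \<le> e" by simp
    have "v (mean (\<lambda>a. f (of_nat a) * g (z - of_nat a)) n - dconv f g n m - csum f d' m) \<le> e"
      unfolding eq by (intro v_add_le v_diff_le 1 2 3)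
    then show ?thesis by (simp add: m_def)
  qed
  then show "\<exists>N. \<forall>n\<ge>N. v (mean (\<lambda>a. f (of_nat a) * g (z - of_nat a)) n
    - dconv f g n (trunc n z) - csum f d' (trunc n z) - 0) \<le> e" by blast
qed

section \<open>From level \<open>n\<close> to level \<open>n + 1\<close>: the effect of one more
  digit\<close>

lemma cdiff_digits:
  assumes "a < N" "m < N" "j < p" "d < p"
  shows "cdiff (N * p) (m + N * d) (a + N * j) =
    cdiff N m a + N * cdiff p (if a \<le> m then d else if d = 0 then p - 1 else d - 1) j"
proof -
  \<comment> \<open>Schoolbook subtraction: if the low parts satisfy \<open>a > m\<close>, one is
    borrowed from the next digit \<open>d\<close>, and for \<open>d = 0\<close> this digit wraps
    around to \<open>p - 1\<close>. The three cases for \<open>s\<close> record this without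
    truncated subtraction.\<close>
  have *: "cdiff (N * p) (m + N * d) (a + N * j) = cdiff N m a + N * cdiff p s j"
    if s: "a \<le> m \<and> s = d \<or> a > m \<and> d = Suc s \<or> a > m \<and> d = 0 \<and> p = Suc s" for s
  proof (cases "j \<le> s")
    case True
    then obtain k where "s = j + k" using le_Suc_ex by blast
    then show ?thesis using s assms by (auto simp: cdiff_def algebra_simps)
  next
    case False
    then obtain k where k: "j = s + Suc k" using less_imp_Suc_add[of s j] by auto
    obtain l where l: "p = j + Suc l" using less_imp_Suc_add[OF assms(3)] by auto
    show ?thesis using s assms k l by (auto simp: cdiff_def algebra_simps)
  qed
  show ?thesis by (rule *) (use assms in auto)
qed

text \<open>The average of the digits \<open>0, ..., p - 1\<close>, so that centred digits sum to
  zero.\<close>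

abbreviation half_p :: 'a where "half_p \<equiv> (of_nat p - 1) / 2"

lemma v_digit: "v (of_nat j - half_p) \<le> 2"
proof -
  have "v (half_p) \<le> 2 * 1" 
    using v_diff_le[OF v_nat_le_1[of p], of 1] by (intro v_half_le) simp
  moreover have "v (of_nat j) \<le> 2" using v_nat_le_1[of j] by linarith
  ultimately show ?thesis by (intro v_diff_le) auto
qed

text \<open>The linear term of \<open>f\<close> contributes \<open>j\<close>, while the half-terms
  at the two levels contribute \<open>- p / 2\<close> and \<open>1 / 2\<close>, all times the
  derivative; together they form the centred digit.\<close>

lemma vol_digit:
  assumes f: "UDd f d" and "e > 0"
  shows "\<exists>n0. \<forall>n\<ge>n0. \<forall>a j. v ((vol f (Suc n) (a + p ^ n * j) - vol f n a) / of_nat p ^ n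
    - (of_nat j - half_p) * d (of_nat a)) \<le> e"
proof -
  have e: "e / 2 > 0" using \<open>e > 0\<close> by simp
  obtain k1 where k1: "\<And>n a. n \<ge> k1 \<Longrightarrow>
    v (vol f n a - (f (of_nat a) - of_nat p ^ n * d (of_nat a) / 2)) \<le> e * rad n"
    using vol_approx[OF assms] by blast
  obtain k2 where k2: "\<And>m x y b. m \<ge> k2 \<Longrightarrow> x \<in> Zp v \<Longrightarrow> y \<in> Zp v \<Longrightarrow> b \<in> Zp v \<Longrightarrow>
    v (x - b) \<le> rad m \<Longrightarrow> v (y - b) \<le> rad m \<Longrightarrow> v (f x - f y - (x - y) * d b) \<le> e * v (x - y)"
    using UDdE[OF assms] by blast
  obtain k3 where k3: "\<And>n x y. n \<ge> k3 \<Longrightarrow> x \<in> Zp v \<Longrightarrow> y \<in> Zp v \<Longrightarrow> v (x - y) \<le> rad n \<Longrightarrow>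
    v (d x - d y) \<le> e / 2" using ucontE[OF UDd_imp_ucont_deriv[OF f] e] by blast
  have "v ((vol f (Suc n) (a + p ^ n * j) - vol f n a) / of_nat p ^ n
    - (of_nat j - half_p) * d (of_nat a)) \<le> e" if n: "n \<ge> max k1 (max k2 k3)" for n a j
  proof -
    define P where "P = (of_nat p ^ n :: 'a)"
    have P: "P \<noteq> 0" "v P = rad n" by (simp_all add: P_def v_p_power)
    define u where "u = a + p ^ n * j"
    have u: "of_nat u = of_nat a + P * of_nat j" by (simp add: u_def P_def)
    have near: "v (of_nat u - of_nat a) \<le> rad n" unfolding v_nat_diff_le_rad u_def by simp
    define \<alpha> where "\<alpha> = vol f n a - (f (of_nat a) - P * d (of_nat a) / 2)"
    define \<beta> where "\<beta> = vol f (Suc n) u - (f (of_nat u) - of_nat p * P * d (of_nat u) / 2)"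
    define \<gamma> where "\<gamma> = f (of_nat u) - f (of_nat a) - (of_nat u - of_nat a) * d (of_nat a)"
    have 1: "v \<alpha> \<le> e * rad n" unfolding \<alpha>_def P_def using n by (intro k1) simp
    have "v \<beta> \<le> e * rad (Suc n)"
      unfolding \<beta>_def P_def using n k1[of "Suc n" u] by simp
    also have "\<dots> \<le> e * rad n" using rad_antimono[of n "Suc n"] \<open>e > 0\<close> by simp
    finally have 2: "v \<beta> \<le> e * rad n" .
    have "v \<gamma> \<le> e * v (of_nat u - of_nat a)" unfolding \<gamma>_def using n near by (intro k2[of n]) auto
    also have "\<dots> \<le> e * rad n" using near \<open>e > 0\<close> by simp
    finally have 3: "v \<gamma> \<le> e * rad n" .
    have "v (of_nat p * P / 2 * (d (of_nat u) - d (of_nat a))) \<le> 2 * (1 * rad n) * (e / 2)"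
      using n near by (intro v_mult_le v_half_le v_nat_le_1 k3[of n]) (auto simp: P)
    then have 4: "v (of_nat p * P / 2 * (d (of_nat u) - d (of_nat a))) \<le> e * rad n"
      by (simp add: mult_ac)
    have "vol f (Suc n) u - vol f n a - P * ((of_nat j - half_p) * d (of_nat a))
      = \<beta> - \<alpha> + \<gamma> - of_nat p * P / 2 * (d (of_nat u) - d (of_nat a))"
      unfolding \<alpha>_def \<beta>_def \<gamma>_def u by (simp add: field_simps)
    also have "v \<dots> \<le> e * rad n" by (intro v_diff_le v_add_le 1 2 3 4)
    finally have "v ((vol f (Suc n) u - vol f n a - P * ((of_nat j - half_p) * d (of_nat a))) / of_nat p ^ n) \<le> e"
      by (rule v_divide_p_power_le)
    then show ?thesis using P(1) by (simp add: P_def u_def diff_divide_distrib)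
  qed
  then show ?thesis by blast
qed

lemma sum_cdiff:
  assumes "s < M"
  shows "(\<Sum>j<M. h (cdiff M s j)) = (\<Sum>l<M. h l)"
  by (rule sum.reindex_bij_witness[of _ "cdiff M s" "cdiff M s"]) (use assms in \<open>auto simp: cdiff_def\<close>)

lemma sum_digit: "(\<Sum>j<p. of_nat j - half_p) = (0::'a)"
proof -
  have "2 * (\<Sum>j<M. of_nat j) = of_nat M * (of_nat M - 1 :: 'a)" for M
    by (induction M) (simp_all add: algebra_simps)
  from this[of p] have "(\<Sum>j<p. of_nat j) = of_nat p * half_p" by (simp add: field_simps)
  then show ?thesis by (simp add: sum_subtractf)
qed

text \<open>The correlation of two centred digits whose sum is \<open>s\<close> modulo
  \<open>p\<close>.\<close>

definition digit_corr :: "nat \<Rightarrow> 'a" where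
  "digit_corr s = (\<Sum>j<p. (of_nat j - half_p) * (of_nat (cdiff p s j) - half_p))"

text \<open>Expanding \<open>cdiff p s j\<close> as \<open>s - j\<close>, plus \<open>p\<close> for
  \<open>j > s\<close>, and using that centred digits sum to zero leaves \<open>p * T s\<close>
  minus a constant, where \<open>T s\<close> sums the centred digits above \<open>s\<close>. Moving
  \<open>s\<close> down by one adds a single digit to \<open>T\<close>. For \<open>d = 0\<close> the
  cyclic predecessor \<open>p - 1\<close> fits as well, since \<open>T (p - 1) = 0\<close> and the
  complete sum vanishes.\<close>

lemma digit_corr_diff:
  assumes "d < p"
  shows "digit_corr d - digit_corr (if d = 0 then p - 1 else d - 1) = - (of_nat p * (of_nat d - half_p))"
proof -
  define T where "T s = (\<Sum>j<p. if j \<le> s then 0 else of_nat j - half_p)" for s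
  define Q where "Q = (\<Sum>j<p. (of_nat j - half_p) * of_nat j)"
  have K: "digit_corr s = of_nat p * T s - Q" for s
  proof -
    have "digit_corr s = (\<Sum>j<p. (of_nat s - half_p) * (of_nat j - half_p)
      + of_nat p * (if j \<le> s then 0 else of_nat j - half_p) - (of_nat j - half_p) * of_nat j)"
      unfolding digit_corr_def by (intro sum.cong refl) (simp add: of_nat_cdiff algebra_simps)
    also have "\<dots> = (of_nat s - half_p) * (\<Sum>j<p. of_nat j - half_p) + of_nat p * T s - Q"
      unfolding T_def Q_def sum_subtractf[of "\<lambda>j. _ j + _ j"] sum.distrib sum_distrib_left ..
    finally show ?thesis by (simp only: sum_digit) simp
  qed
  have T: "T d - T (if d = 0 then p - 1 else d - 1) = - (of_nat d - half_p)"
  proof (cases "d = 0")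
    case True
    have "T (p - 1) = 0" unfolding T_def by (intro sum.neutral) auto
    moreover have "T 0 - (\<Sum>j<p. of_nat j - half_p) = (\<Sum>j<p. if j = 0 then - (of_nat j - half_p) else 0)"
      unfolding T_def sum_subtractf[symmetric] by (intro sum.cong) auto
    ultimately show ?thesis using True by (simp add: sum_digit sum.delta)
  next
    case False
    have "T d - T (d - 1) = (\<Sum>j<p. if j = d then - (of_nat j - half_p) else 0)"
      unfolding T_def sum_subtractf[symmetric] using False by (intro sum.cong) auto
    then show ?thesis using False assms by (simp add: sum.delta)
  qed
  have "digit_corr d - digit_corr (if d = 0 then p - 1 else d - 1)
    = of_nat p * (T d - T (if d = 0 then p - 1 else d - 1))"
    unfolding K right_diff_distrib by simp
  then show ?thesis unfolding T by (simp only: mult_minus_right)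
qed

lemma v_digit_corr: "v (digit_corr s) \<le> 4"
  unfolding digit_corr_def using v_mult_le[OF v_digit v_digit] by (intro v_sum_le) auto

text \<open>Each residue modulo \<open>p ^ (n + 1)\<close> is split into \<open>a\<close> and its
  top digit \<open>j\<close>, and each \<open>vol\<close> at level \<open>n + 1\<close> into its
  value at level \<open>n\<close> plus \<open>p ^ n\<close> times a deviation. The deviations sum to
  zero over the digits by \<open>vol_distribution\<close>, so the mixed terms drop out; the constant
  terms reproduce level \<open>n\<close>.\<close>

lemma dconv_step_eq:
  fixes n m d :: nat
  assumes f: "UDd f f'" and g: "UDd g g'" and m: "m < p ^ n" and d: "d < p"
  defines "s \<equiv> \<lambda>a. if a \<le> m then d else if d = 0 then p - 1 else d - 1"
    and "\<alpha> \<equiv> \<lambda>a j. (vol f (Suc n) (a + p ^ n * j) - vol f n a) / of_nat p ^ n"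
    and "\<beta> \<equiv> \<lambda>a j. (vol g (Suc n) (a + p ^ n * j) - vol g n a) / of_nat p ^ n"
  shows "dconv f g (Suc n) (m + p ^ n * d) - dconv f g n m = of_nat p ^ n / of_nat p *
    (\<Sum>a<p ^ n. \<Sum>j<p. \<alpha> a j * \<beta> (cdiff (p ^ n) m a) (cdiff p (s a) j))"
proof -
  define P where "P = (of_nat p ^ n :: 'a)"
  have P: "P \<noteq> 0" by (simp add: P_def)
  define b where "b a = cdiff (p ^ n) m a" for a
  have s: "s a < p" for a using d p_gt_1 by (auto simp: s_def)
  have sum\<alpha>: "(\<Sum>j<p. \<alpha> a j) = 0" for a
    unfolding \<alpha>_def using vol_distribution[OF f, of n a]
    by (simp add: sum_subtractf flip: sum_divide_distrib)
  have sum\<beta>: "(\<Sum>j<p. \<beta> a j) = 0" for a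
    unfolding \<beta>_def using vol_distribution[OF g, of n a]
    by (simp add: sum_subtractf flip: sum_divide_distrib)
  have inner: "(\<Sum>j<p. vol f (Suc n) (a + p ^ n * j) * vol g (Suc n) (b a + p ^ n * cdiff p (s a) j))
    = of_nat p * (vol f n a * vol g n (b a)) + P * P * (\<Sum>j<p. \<alpha> a j * \<beta> (b a) (cdiff p (s a) j))" for a
  proof -
    let ?\<beta> = "\<lambda>j. \<beta> (b a) (cdiff p (s a) j)"
    have "vol f (Suc n) (a + p ^ n * j) = vol f n a + P * \<alpha> a j" for j
      using P by (simp add: \<alpha>_def P_def)
    moreover have "vol g (Suc n) (b a + p ^ n * cdiff p (s a) j) = vol g n (b a) + P * ?\<beta> j" for j
      using P by (simp add: \<beta>_def P_def)
    ultimately have "(\<Sum>j<p. vol f (Suc n) (a + p ^ n * j) * vol g (Suc n) (b a + p ^ n * cdiff p (s a) j))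
      = (\<Sum>j<p. vol f n a * vol g n (b a) + P * vol g n (b a) * \<alpha> a j + P * vol f n a * ?\<beta> j
          + P * P * (\<alpha> a j * ?\<beta> j))"
      by (intro sum.cong refl) (simp add: algebra_simps)
    also have "\<dots> = of_nat p * (vol f n a * vol g n (b a)) + P * vol g n (b a) * (\<Sum>j<p. \<alpha> a j)
      + P * vol f n a * (\<Sum>j<p. ?\<beta> j) + P * P * (\<Sum>j<p. \<alpha> a j * ?\<beta> j)"
      unfolding sum.distrib sum_distrib_left by simp
    finally show ?thesis using sum_cdiff[OF s, of "\<beta> (b a)" a] by (simp add: sum\<alpha> sum\<beta>)
  qed
  have "(\<Sum>a<p ^ Suc n. vol f (Suc n) a * vol g (Suc n) (cdiff (p ^ Suc n) (m + p ^ n * d) a))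
    = (\<Sum>a<p ^ n. \<Sum>j<p. vol f (Suc n) (a + p ^ n * j) * vol g (Suc n) (b a + p ^ n * cdiff p (s a) j))"
    unfolding power_Suc2 sum_lessThan_mult b_def s_def
    using m d by (intro sum.cong refl) (simp add: cdiff_digits)
  also have "\<dots> = of_nat p * (\<Sum>a<p ^ n. vol f n a * vol g n (b a))
    + P * P * (\<Sum>a<p ^ n. \<Sum>j<p. \<alpha> a j * \<beta> (b a) (cdiff p (s a) j))"
    unfolding inner sum.distrib sum_distrib_left ..
  finally show ?thesis
    unfolding dconv_def b_def using P by (simp add: P_def field_simps)
qed

text \<open>To leading order the deviations are centred digits times derivatives, so the sum over
  \<open>j\<close> becomes \<open>digit_corr (s a)\<close>. This takes two values, depending on the
  borrow; their difference is the factor of the incomplete sum \<open>csum\<close>, and the complete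
  sum that is left over is negligible.\<close>

lemma dconv_step:
  assumes f: "UDd f f'" and g: "UDd g g'" and "e > 0"
  shows "\<exists>n0. \<forall>n\<ge>n0. \<forall>m d. m < p ^ n \<longrightarrow> d < p \<longrightarrow>
    v (dconv f g (Suc n) (m + p ^ n * d) - dconv f g n m
      + of_nat p ^ n * ((of_nat d - half_p) * csum f' g' m)) \<le> e * rad n"
proof -
  obtain B where B: "B \<ge> 1" "\<And>x. x \<in> Zp v \<Longrightarrow> v (f' x) \<le> B" "\<And>x. x \<in> Zp v \<Longrightarrow> v (g' x) \<le> B"
    using UDd_bounds[OF f g] by metis
  \<comment> \<open>The factor \<open>4 * B\<close> covers both the bound \<open>2 * B\<close> for
    the product errors and the bound 4 for \<open>digit_corr\<close>; the extra \<open>p\<close>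
    pays for the denominator in \<open>of_nat p ^ n / of_nat p\<close>.\<close>
  define e1 where "e1 = min 1 (e / (4 * B * p))"
  have e1: "e1 > 0" "e1 \<le> 1" "e1 * (4 * B) \<le> e / p"
    using B(1) \<open>e > 0\<close> by (auto simp: e1_def min_def field_simps)
  obtain k1 where k1: "\<And>n a j. n \<ge> k1 \<Longrightarrow> v ((vol f (Suc n) (a + p ^ n * j) - vol f n a) / of_nat p ^ n
    - (of_nat j - half_p) * f' (of_nat a)) \<le> e1"
    using vol_digit[OF f e1(1)] by blast
  obtain k2 where k2: "\<And>n a j. n \<ge> k2 \<Longrightarrow> v ((vol g (Suc n) (a + p ^ n * j) - vol g n a) / of_nat p ^ n
    - (of_nat j - half_p) * g' (of_nat a)) \<le> e1"
    using vol_digit[OF g e1(1)] by blast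
  obtain k3 where k3: "\<And>n m. n \<ge> k3 \<Longrightarrow> v (ctotal f' g' n m) \<le> e1"
    using ctotal_small[OF UDd_imp_ucont_deriv[OF f] UDd_imp_ucont_deriv[OF g] e1(1)] by blast
  have "v (dconv f g (Suc n) (m + p ^ n * d) - dconv f g n m
      + of_nat p ^ n * ((of_nat d - half_p) * csum f' g' m)) \<le> e * rad n"
    if n: "n \<ge> max k1 (max k2 k3)" and m: "m < p ^ n" and d: "d < p" for n m d
  proof -
    define s' where "s' = (if d = 0 then p - 1 else d - 1)"
    define s where "s a = (if a \<le> m then d else s')" for a
    define b where "b a = cdiff (p ^ n) m a" for a
    define \<alpha> where "\<alpha> a j = (vol f (Suc n) (a + p ^ n * j) - vol f n a) / of_nat p ^ n" for a j
    define \<beta> where "\<beta> a j = (vol g (Suc n) (a + p ^ n * j) - vol g n a) / of_nat p ^ n" for a j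
    define \<delta> where "\<delta> j = of_nat j - half_p" for j
    define FG where "FG a = f' (of_nat a) * g' (of_nat (b a))" for a
    define E where "E a j = \<alpha> a j * \<beta> (b a) (cdiff p (s a) j)
      - \<delta> j * f' (of_nat a) * (\<delta> (cdiff p (s a) j) * g' (of_nat (b a)))" for a j
    have \<delta>B: "v (\<delta> j * f' (of_nat a)) \<le> 2 * B" "v (\<delta> j * g' (of_nat a)) \<le> 2 * B" for a j
      unfolding \<delta>_def by (intro v_mult_le v_digit B of_nat_Zp)+
    have \<alpha>: "v (\<alpha> a j - \<delta> j * f' (of_nat a)) \<le> e1" for a j
      unfolding \<alpha>_def \<delta>_def using n by (intro k1) simp
    have \<beta>: "v (\<beta> a j - \<delta> j * g' (of_nat a)) \<le> e1" for a j
      unfolding \<beta>_def \<delta>_def using n by (intro k2) simp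
    have \<beta>B: "v (\<beta> a j) \<le> 2 * B" for a j
    proof -
      have "e1 \<le> 2 * B" using e1(2) B(1) by linarith
      from v_add_le[OF order_trans[OF \<beta>[of a j] this] \<delta>B(2)[of j a]] show ?thesis by simp
    qed
    have "v (\<Sum>a<p ^ n. \<Sum>j<p. E a j) \<le> e1 * (2 * B)"
      unfolding E_def using e1(1) B(1) by (intro v_sum_le v_mult_diff_le \<alpha> \<beta> \<beta>B \<delta>B) auto
    also have "\<dots> \<le> e1 * (4 * B)" using e1(1) B(1) by (intro mult_left_mono) auto
    also note e1(3)
    finally have 1: "v (\<Sum>a<p ^ n. \<Sum>j<p. E a j) \<le> e / p" .
    have "v (digit_corr s' * ctotal f' g' n m) \<le> 4 * e1"
      using n by (intro v_mult_le v_digit_corr k3) simp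
    also have "\<dots> \<le> e1 * (4 * B)" using e1(1) B(1) by simp
    also note e1(3)
    finally have 2: "v (digit_corr s' * ctotal f' g' n m) \<le> e / p" .
    have low: "(\<Sum>a<p ^ n. if a \<le> m then FG a else 0) = csum f' g' m"
    proof -
      have "(\<Sum>a<p ^ n. if a \<le> m then FG a else 0) = (\<Sum>a\<in>{..<p ^ n} \<inter> {a. a \<le> m}. FG a)"
        by (simp add: sum.inter_restrict)
      also have "{..<p ^ n} \<inter> {a. a \<le> m} = {..<Suc m}" using m by auto
      finally show ?thesis by (simp add: FG_def csum_def b_def cdiff_def del: of_nat_diff sum.lessThan_Suc)
    qed
    have corr: "digit_corr d - digit_corr s' = - (of_nat p * \<delta> d)"
      unfolding s'_def \<delta>_def by (rule digit_corr_diff[OF d])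
    have "(\<Sum>a<p ^ n. \<Sum>j<p. \<delta> j * f' (of_nat a) * (\<delta> (cdiff p (s a) j) * g' (of_nat (b a))))
      = (\<Sum>a<p ^ n. digit_corr (s a) * FG a)"
      unfolding digit_corr_def \<delta>_def FG_def sum_distrib_right by (simp add: mult_ac)
    \<comment> \<open>The value belonging to a borrow is taken as the base for all \<open>a\<close>;
      the residues without borrow add the difference.\<close>
    also have "\<dots> = (\<Sum>a<p ^ n. (digit_corr d - digit_corr s') * (if a \<le> m then FG a else 0)
        + digit_corr s' * FG a)"
      by (intro sum.cong refl) (simp add: s_def algebra_simps)
    also have "\<dots> = (digit_corr d - digit_corr s') * csum f' g' m + digit_corr s' * ctotal f' g' n m"
      unfolding sum.distrib by (simp add: low ctotal_def FG_def b_def flip: sum_distrib_left)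
    finally have main: "(\<Sum>a<p ^ n. \<Sum>j<p. \<delta> j * f' (of_nat a) * (\<delta> (cdiff p (s a) j) * g' (of_nat (b a))))
      = - (of_nat p * \<delta> d) * csum f' g' m + digit_corr s' * ctotal f' g' n m"
      unfolding corr .
    have step: "dconv f g (Suc n) (m + p ^ n * d) - dconv f g n m = of_nat p ^ n / of_nat p *
      (\<Sum>a<p ^ n. \<Sum>j<p. \<alpha> a j * \<beta> (b a) (cdiff p (s a) j))"
      using dconv_step_eq[OF f g m d] unfolding s_def s'_def \<alpha>_def \<beta>_def b_def .
    have split: "(\<Sum>a<p ^ n. \<Sum>j<p. \<alpha> a j * \<beta> (b a) (cdiff p (s a) j))
      = (\<Sum>a<p ^ n. \<Sum>j<p. E a j) + (- (of_nat p * \<delta> d) * csum f' g' m + digit_corr s' * ctotal f' g' n m)"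
      unfolding main[symmetric] E_def by (simp add: sum_subtractf)
    have "dconv f g (Suc n) (m + p ^ n * d) - dconv f g n m + of_nat p ^ n * (\<delta> d * csum f' g' m)
      = of_nat p ^ n / of_nat p * ((\<Sum>a<p ^ n. \<Sum>j<p. E a j) + digit_corr s' * ctotal f' g' n m)"
      unfolding step split by (simp add: field_simps)
    also have "v \<dots> \<le> rad n * p * (e / p)"
      by (intro v_mult_le v_add_le 1 2) (simp add: v_divide v_p_power v_p)
    also have "\<dots> = e * rad n" by simp
    finally show ?thesis unfolding \<delta>_def .
  qed
  then show ?thesis by blast
qed

theorem dconv_UDd:
  assumes f: "UDd f f'" and g: "UDd g g'"
  shows "\<exists>H. (\<forall>z\<in>Zp v. vtendsto v (\<lambda>n. dconv f g n (trunc n z)) (H z)) \<and> UDd H (\<lambda>z. - cconv f' g' z)"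
proof -
  have uc: "ucont f'" "ucont g'"
    using f g UDd_imp_ucont_deriv by blast+
  let ?X = "cconv f' g'" and ?cs = "csum f' g'"
  \<comment> \<open>The step of \<open>dconv\<close> carries the factor
    \<open>d - (p - 1) / 2\<close>, whereas \<open>UDd_levels\<close> asks for \<open>d\<close>. The
    excess \<open>p ^ n * (p - 1) / 2\<close> is the increment of \<open>p ^ n / 2\<close>, so
    subtracting \<open>p ^ n / 2\<close> times \<open>csum\<close> removes it and leaves the limit
    unchanged.\<close>
  define \<Phi> where "\<Phi> n z = dconv f g n (trunc n z) - of_nat p ^ n / 2 * ?cs (trunc n z)" for n z
  have "\<exists>H. (\<forall>z\<in>Zp v. vtendsto v (\<lambda>n. \<Phi> n z) (H z)) \<and> UDd H (\<lambda>z. - ?X z)"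
  proof (rule UDd_levels)
    show "\<Phi> n x = \<Phi> n y" if "trunc n x = trunc n y" for n x y
      using that by (simp add: \<Phi>_def)
    show "ucont (\<lambda>z. - ?X z)"
      using cconv_ucont[OF uc] unfolding ucont_def by (simp add: v_minus_commute)
    fix e :: real assume "e > 0"
    then have e2: "e / 2 > 0" by simp
    obtain k1 where k1: "\<And>n m d. n \<ge> k1 \<Longrightarrow> m < p ^ n \<Longrightarrow> d < p \<Longrightarrow>
      v (dconv f g (Suc n) (m + p ^ n * d) - dconv f g n m
      + of_nat p ^ n * ((of_nat d - half_p) * ?cs m)) \<le> e * rad n"
      using dconv_step[OF f g \<open>e > 0\<close>] by blast
    obtain k2 where k2: "\<And>n z. n \<ge> k2 \<Longrightarrow> z \<in> Zp v \<Longrightarrow> v (?cs (trunc n z) - ?X z) \<le> e / 2"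
      using cconv_uniform[OF uc e2] by blast
    have "v (\<Phi> (Suc n) z - \<Phi> n z - (of_nat (trunc (Suc n) z) - of_nat (trunc n z)) * - ?X z) \<le> e * rad n"
      if n: "n \<ge> max k1 k2" and z: "z \<in> Zp v" for n z
    proof -
      obtain d where d: "d < p" "trunc (Suc n) z = trunc n z + p ^ n * d" using trunc_Suc[OF z] .
      define m where "m = trunc n z"
      define P where "P = (of_nat p ^ n :: 'a)"
      have P: "v P = rad n" by (simp add: P_def v_p_power)
      define D where "D = dconv f g (Suc n) (m + p ^ n * d) - dconv f g n m + P * ((of_nat d - half_p) * ?cs m)"
      have 1: "v D \<le> e * rad n"
        unfolding D_def P_def using n d trunc_less[OF z] by (intro k1) (auto simp: m_def)
      have cs: "v (?cs m - ?X z) \<le> e / 2" "v (?cs (m + p ^ n * d) - ?X z) \<le> e / 2"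
        using k2[of n z] k2[of "Suc n" z] n z d by (auto simp: m_def)
      have "v (P * (of_nat d - half_p) * (?cs m - ?X z)) \<le> rad n * 2 * (e / 2)"
        by (intro v_mult_le v_digit cs) (simp add: P)
      then have 2: "v (P * (of_nat d - half_p) * (?cs m - ?X z)) \<le> e * rad n" by (simp add: mult_ac)
      have "v (of_nat p * P / 2 * (?cs (m + p ^ n * d) - ?X z)) \<le> 2 * (1 * rad n) * (e / 2)"
        by (intro v_mult_le v_half_le v_nat_le_1 cs) (simp add: P)
      then have 3: "v (of_nat p * P / 2 * (?cs (m + p ^ n * d) - ?X z)) \<le> e * rad n" by (simp add: mult_ac)
      have "v (P / 2 * (?cs m - ?X z)) \<le> 2 * rad n * (e / 2)"
        by (intro v_mult_le v_half_le cs) (simp add: P)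
      then have 4: "v (P / 2 * (?cs m - ?X z)) \<le> e * rad n" by (simp add: mult_ac)
      have "\<Phi> (Suc n) z - \<Phi> n z - (of_nat (trunc (Suc n) z) - of_nat (trunc n z)) * - ?X z
        = D - P * (of_nat d - half_p) * (?cs m - ?X z)
          - of_nat p * P / 2 * (?cs (m + p ^ n * d) - ?X z) + P / 2 * (?cs m - ?X z)"
        unfolding \<Phi>_def D_def d(2) m_def[symmetric] by (simp add: P_def[symmetric] field_simps)
      also have "v \<dots> \<le> e * rad n" by (intro v_add_le v_diff_le 1 2 3 4)
      finally show ?thesis .
    qed
    then show "\<exists>n0. \<forall>n\<ge>n0. \<forall>z\<in>Zp v. v (\<Phi> (Suc n) z - \<Phi> n z
      - (of_nat (trunc (Suc n) z) - of_nat (trunc n z)) * - ?X z) \<le> e * rad n" by blast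
  qed
  then obtain H where H: "\<And>z. z \<in> Zp v \<Longrightarrow> vtendsto v (\<lambda>n. \<Phi> n z) (H z)" "UDd H (\<lambda>z. - ?X z)" by blast
  have "vtendsto v (\<lambda>n. dconv f g n (trunc n z)) (H z)" if z: "z \<in> Zp v" for z
  proof -
    have "vtendsto v (\<lambda>n. \<Phi> n z + of_nat p ^ n / 2 * ?cs (trunc n z)) (H z + 0 / 2 * ?X z)"
      by (intro vtendsto_add vtendsto_mult vtendsto_cdivide p_power_tendsto H z cconv_tendsto uc)
    then show ?thesis by (simp add: \<Phi>_def)
  qed
  with H(2) show ?thesis by blast
qed

subsection \<open>Exponential and logarithm\<close>

lemma v_add_eq:
  assumes "v y < v x"
  shows "v (x + y) = v x"
proof (rule antisym)
  show "v (x + y) \<le> v x" using assms by (intro v_add_le) auto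
  show "v x \<le> v (x + y)" using v_add[of "x + y" "- y"] assms by simp
qed

lemma v_nat_not_dvd: "\<not> p dvd n \<Longrightarrow> v (of_nat n) = 1"
  using v_int_not_dvd[of "int n"] by simp

text \<open>\<open>p powr (- 1 / (p - 1))\<close>, the radius of convergence of the exponential series\<close>
definition er :: real where "er = real p powr (- 1 / (real p - 1))"

lemma er_pos: "0 < er"
  by (simp add: er_def)

lemma er_less_1: "er < 1"
  unfolding er_def using p_gt_1 by (intro powr_less_one) (auto simp: field_simps)

lemma er_power: "er ^ (p - 1) = 1 / real p"
proof -
  have "er ^ (p - 1) = er powr real (p - 1)" using er_pos by (simp add: powr_realpow)
  also have "\<dots> = real p powr (- 1 / (real p - 1) * real (p - 1))"
    unfolding er_def by (rule powr_powr)
  also have "- 1 / (real p - 1) * real (p - 1) = - 1" using p_gt_1 by (simp add: of_nat_diff)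
  finally show ?thesis by (simp add: powr_minus_divide)
qed

lemma er_power_rad: "er ^ ((p - 1) * m) = rad m"
  unfolding power_mult er_power rad_def ..

lemma v_fact_le_1: "v (fact n) \<le> 1"
  using v_nat_le_1[of "fact n"] by simp

lemma v_fact_digit:
  assumes "s < p"
  shows "v (fact (p * m + s)) = v (fact (p * m))"
  using assms
proof (induction s)
  case (Suc s)
  have "\<not> p dvd Suc (p * m + s)"
  proof
    assume "p dvd Suc (p * m + s)"
    then have "p dvd Suc s" using dvd_add_right_iff[of p "p * m" "Suc s"] by simp
    then show False using Suc.prems by (auto dest: dvd_imp_le)
  qed
  then have "v (of_nat (Suc (p * m + s))) = 1" by (rule v_nat_not_dvd)
  then show ?case using Suc by (simp only: add_Suc_right fact_Suc v_mult)
qed simp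

lemma v_fact_mult: "v (fact (p * m)) = rad m * v (fact m)"
proof (induction m)
  case (Suc m)
  have eq: "p * Suc m = Suc (p * m + (p - 1))" using p_gt_1 by simp
  have "(fact (p * Suc m) :: 'a) = of_nat (p * Suc m) * fact (p * m + (p - 1))"
    unfolding eq by (rule fact_Suc)
  also have "v \<dots> = v (of_nat p) * v (of_nat (Suc m)) * v (fact (p * m))"
    unfolding of_nat_mult v_mult by (subst v_fact_digit) (use p_gt_1 in auto)
  also have "\<dots> = rad (Suc m) * (v (of_nat (Suc m)) * v (fact m))"
    by (simp add: Suc.IH v_p rad_Suc del: of_nat_Suc)
  finally show ?case by (simp only: fact_Suc v_mult)
qed simp

text \<open>The factorial of \<open>n\<close> has p-adic valuation at most
  \<open>(n - 1) / (p - 1)\<close>. With \<open>m = n div p\<close>, the multiples of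
  \<open>p\<close> up to \<open>n\<close> contribute \<open>p ^ m\<close> times
  \<open>fact m\<close>, and the induction closes because
  \<open>(p - 1) * m + (m - 1) = p * m - 1 \<le> n - 1\<close>.\<close>

lemma v_fact_ge: "n \<ge> 1 \<Longrightarrow> er ^ (n - 1) \<le> v (fact n)"
proof (induction n rule: less_induct)
  case (less n)
  define m where "m = n div p"
  have n: "n = p * m + n mod p" by (simp add: m_def)
  have v: "v (fact n) = rad m * v (fact m)"
    using v_fact_digit[of "n mod p" m] v_fact_mult[of m] n p_gt_1 by simp
  show ?case
  proof (cases "m = 0")
    case True
    then show ?thesis using v er_pos er_less_1 by (simp add: power_le_one)
  next
    case False
    then have "m < n" unfolding m_def using p_gt_1 less.prems by (intro div_less_dividend) auto
    have "er ^ (n - 1) \<le> er ^ ((p - 1) * m + (m - 1))"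
    proof (rule power_decreasing)
      have "(p - 1) * m + (m - 1) = p * m - 1" using False p_gt_1 by (simp add: algebra_simps diff_mult_distrib)
      also have "\<dots> \<le> n - 1" using n by linarith
      finally show "(p - 1) * m + (m - 1) \<le> n - 1" .
    qed (use er_pos er_less_1 in auto)
    also have "\<dots> = rad m * er ^ (m - 1)" by (simp only: power_add er_power_rad)
    also have "\<dots> \<le> rad m * v (fact m)"
      using less.IH[OF \<open>m < n\<close>] False by (intro mult_left_mono) auto
    finally show ?thesis using v by simp
  qed
qed

lemma v_exp_term:
  assumes "n \<ge> 1"
  shows "v (x ^ n / fact n) \<le> v x * (v x / er) ^ (n - 1)"
proof -
  obtain k where n: "n = Suc k" using assms by (cases n) auto
  have "v (x ^ n / fact n) = v x ^ n / v (fact n)" by (simp add: v_divide v_power)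
  also have "\<dots> \<le> v x ^ n / er ^ (n - 1)"
    using v_fact_ge[OF assms] er_pos by (intro divide_left_mono) auto
  also have "\<dots> = v x * (v x / er) ^ (n - 1)" by (simp add: n power_divide)
  finally show ?thesis .
qed

lemma v_exp_term': "v (x ^ n / fact n) \<le> (v x / er) ^ n"
proof (cases "n = 0")
  case False
  then have "v (x ^ n / fact n) \<le> v x * (v x / er) ^ (n - 1)" by (intro v_exp_term) simp
  also have "\<dots> \<le> v x / er * (v x / er) ^ (n - 1)"
    using er_pos er_less_1 mult_left_le[of er "v x"]
    by (intro mult_right_mono) (auto simp: pos_le_divide_eq)
  also have "\<dots> = (v x / er) ^ n" using False by (cases n) simp_all
  finally show ?thesis .
qed simp

text \<open>\<open>fact n\<close> is \<open>n\<close> times an integer, hence no larger in value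
  than \<open>n\<close>; the estimates for the exponential series thus serve the logarithm
  too.\<close>

lemma v_log_term:
  assumes "n \<ge> 1"
  shows "v (x ^ n / of_nat n) \<le> v (x ^ n / fact n)"
proof -
  have "v (fact n) = v (of_nat n) * v (fact (n - 1))"
    using assms by (simp add: fact_reduce v_mult)
  also have "\<dots> \<le> v (of_nat n)" using v_fact_le_1 by (simp add: mult_left_le)
  finally have "v (fact n) \<le> v (of_nat n)" .
  then show ?thesis unfolding v_divide using assms by (intro divide_left_mono mult_pos_pos) auto
qed

lemma geometric_tendsto:
  assumes "v x < er"
  shows "(\<lambda>n. (v x / er) ^ n) \<longlonglongrightarrow> 0"
  using assms er_pos by (intro LIMSEQ_realpow_zero) (auto simp: field_simps)

lemma series_converges:
  assumes "\<And>n. v (a n) \<le> Y n" "Y \<longlonglongrightarrow> 0"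
  shows "\<exists>L. vtendsto v (\<lambda>N. \<Sum>n<N. a n) L"
proof (rule converges_if_steps)
  fix e :: real assume "e > 0"
  then obtain N where "\<forall>n\<ge>N. Y n < e"
    using order_tendstoD(2)[OF assms(2)] unfolding eventually_sequentially by blast
  then have "\<forall>n\<ge>N. v (a n) \<le> e" using assms(1) by (meson less_imp_le order_trans)
  then show "\<exists>N. \<forall>n\<ge>N. v ((\<Sum>i<Suc n. a i) - (\<Sum>i<n. a i)) \<le> e" by auto
qed

lemma vexp_tendsto:
  assumes "v x < er"
  shows "vtendsto v (\<lambda>N. \<Sum>n<N. x ^ n / fact n) (vexp v x)"
  using series_converges[OF v_exp_term' geometric_tendsto[OF assms]] vlim_eq
  unfolding vexp_def of_nat_fact by metis

lemma vexp_approx: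
  assumes "v x < er"
  shows "v (vexp v x - (1 + x)) \<le> v x * (v x / er)"
proof (rule vtendsto_bound[OF vexp_tendsto[OF assms], of 2])
  fix n :: nat assume "2 \<le> n"
  then obtain k where n: "n = Suc (Suc k)" by (metis add_2_eq_Suc le_Suc_ex)
  have "(\<Sum>i<n. x ^ i / fact i) - (1 + x) = (\<Sum>i<k. x ^ Suc (Suc i) / fact (Suc (Suc i)))"
    unfolding n by (simp add: sum.lessThan_Suc_shift del: sum.lessThan_Suc fact_Suc)
  also have "v \<dots> \<le> v x * (v x / er)"
  proof (rule v_sum_le)
    fix i
    have "v (x ^ Suc (Suc i) / fact (Suc (Suc i))) \<le> v x * (v x / er) ^ (Suc i)"
      using v_exp_term[of "Suc (Suc i)" x] by simp
    also have "\<dots> \<le> v x * (v x / er) ^ 1"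
      using er_pos assms by (intro mult_left_mono power_decreasing) auto
    finally show "v (x ^ Suc (Suc i) / fact (Suc (Suc i))) \<le> v x * (v x / er)" by simp
  qed (use er_pos in simp)
  finally show "v ((\<Sum>i<n. x ^ i / fact i) - (1 + x)) \<le> v x * (v x / er)" .
qed

lemma vexp_0: "vexp v 0 = 1"
proof -
  have "v (0::'a) < er" using er_pos by simp
  from vexp_approx[OF this] have "v (vexp v 0 - 1) \<le> 0" by simp
  then have "v (vexp v 0 - 1) = 0" using v_nonneg antisym by blast
  then show ?thesis by simp
qed

text \<open>By the binomial theorem the partial sums for \<open>x + y\<close> are sums over the
  triangle \<open>i + j < N\<close>, whereas the product of partial sums runs over a square. Each
  term outside the triangle is at most \<open>t ^ N\<close>.\<close>

lemma vexp_add: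
  assumes x: "v x < er" and y: "v y < er"
  shows "vexp v (x + y) = vexp v x * vexp v y"
proof -
  define t where "t = max (v x) (v y) / er"
  have t: "0 \<le> t" "t < 1" using er_pos x y by (auto simp: t_def le_max_iff_disj)
  have tm: "v (u ^ n / fact n) \<le> t ^ n" if "u \<in> {x, y}" for u n
  proof -
    have "(v u / er) ^ n \<le> t ^ n"
      unfolding t_def using that er_pos by (intro power_mono divide_right_mono) auto
    then show ?thesis using v_exp_term'[of u n] by linarith
  qed
  define a where "a n = x ^ n / fact n" for n
  define b where "b n = y ^ n / fact n" for n
  have xy: "v (x + y) < er" using x y by (rule v_add_less)
  have binom: "(x + y) ^ n / fact n = (\<Sum>i\<le>n. a i * b (n - i))" for n
  proof -
    have "(x + y) ^ n / fact n = (\<Sum>i\<le>n. of_nat (n choose i) * x ^ i * y ^ (n - i) / fact n)"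
      by (simp add: binomial_ring sum_divide_distrib)
    also have "\<dots> = (\<Sum>i\<le>n. a i * b (n - i))"
      by (intro sum.cong refl) (simp add: a_def b_def binomial_fact)
    finally show ?thesis .
  qed
  have "vtendsto v (\<lambda>N. (\<Sum>n<N. a n) * (\<Sum>n<N. b n)) (vexp v x * vexp v y)"
    unfolding a_def b_def using x y by (intro vtendsto_mult vexp_tendsto)
  moreover have "vtendsto v (\<lambda>N. \<Sum>n<N. \<Sum>i\<le>n. a i * b (n - i)) (vexp v (x + y))"
    using vexp_tendsto[OF xy] by (simp add: binom)
  ultimately have "vtendsto v (\<lambda>N. (\<Sum>n<N. a n) * (\<Sum>n<N. b n) - (\<Sum>n<N. \<Sum>i\<le>n. a i * b (n - i)))
    (vexp v x * vexp v y - vexp v (x + y))" by (rule vtendsto_diff)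
  moreover have "vtendsto v (\<lambda>N. (\<Sum>n<N. a n) * (\<Sum>n<N. b n) - (\<Sum>n<N. \<Sum>i\<le>n. a i * b (n - i))) 0"
  proof (rule vtendsto_null_le)
    show "(\<lambda>N. t ^ N) \<longlonglongrightarrow> 0" using t by (intro LIMSEQ_realpow_zero)
    fix N :: nat
    let ?T = "{(i, j). i + j < N}"
    have sub: "?T \<subseteq> {..<N} \<times> {..<N}" by auto
    have "(\<Sum>n<N. a n) * (\<Sum>n<N. b n) = (\<Sum>(i, j)\<in>{..<N} \<times> {..<N}. a i * b j)"
      by (simp add: sum_product sum.cartesian_product)
    moreover have "(\<Sum>n<N. \<Sum>i\<le>n. a i * b (n - i)) = (\<Sum>(i, j)\<in>?T. a i * b j)"
      by (rule sum.triangle_reindex[symmetric])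
    ultimately have "(\<Sum>n<N. a n) * (\<Sum>n<N. b n) - (\<Sum>n<N. \<Sum>i\<le>n. a i * b (n - i))
      = (\<Sum>(i, j)\<in>{..<N} \<times> {..<N} - ?T. a i * b j)"
      by (simp add: sum_diff[OF _ sub])
    also have "v \<dots> \<le> t ^ N"
    proof (rule v_sum_le)
      fix ij assume "ij \<in> {..<N} \<times> {..<N} - ?T"
      then obtain i j where ij: "ij = (i, j)" "i + j \<ge> N" by auto
      have "v (a i * b j) \<le> t ^ i * t ^ j"
        unfolding a_def b_def by (intro v_mult_le tm) auto
      also have "\<dots> \<le> t ^ N" unfolding power_add[symmetric] using t ij by (intro power_decreasing) auto
      finally show "v (case ij of (i, j) \<Rightarrow> a i * b j) \<le> t ^ N" using ij by simp
    qed (use t in simp)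
    finally show "v ((\<Sum>n<N. a n) * (\<Sum>n<N. b n) - (\<Sum>n<N. \<Sum>i\<le>n. a i * b (n - i)) - 0) \<le> t ^ N" by simp
  qed
  ultimately have "vexp v x * vexp v y - vexp v (x + y) = 0" by (rule vtendsto_unique)
  then show ?thesis by simp
qed

lemma v_nat_mult_le: "v (of_nat m * x) \<le> v x"
  using v_mult_le[OF v_nat_le_1 order_refl, of m x] by simp

lemma vexp_of_nat_mult:
  assumes "v x < er"
  shows "vexp v (of_nat m * x) = vexp v x ^ m"
proof (induction m)
  case (Suc m)
  have "v (of_nat m * x) < er" using v_nat_mult_le[of m x] assms by linarith
  from vexp_add[OF this assms] have "vexp v (of_nat m * x + x) = vexp v x ^ Suc m"
    unfolding Suc.IH power_Suc2 .
  moreover have "of_nat m * x + x = of_nat (Suc m) * x" by (simp add: algebra_simps)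
  ultimately show ?case by (simp only:)
qed (simp add: vexp_0)

lemma vexp_minus:
  assumes "v x < er"
  shows "vexp v (- x) = inverse (vexp v x)"
proof -
  have "vexp v x * vexp v (- x) = 1" using vexp_add[of x "- x"] assms by (simp add: vexp_0)
  then show ?thesis by (simp add: inverse_unique)
qed

text \<open>The power \<open>vexp v x ^ (p ^ N)\<close> is the exponential of
  \<open>p ^ N * x\<close>, which is \<open>1 + p ^ N * x\<close> up to an error of order
  \<open>p ^ (2 * N)\<close>.\<close>

lemma vexp_diff_quotient:
  assumes "v x < er"
  shows "vtendsto v (\<lambda>N. (vexp v x ^ (p ^ N) - 1) / of_nat p ^ N) x"
proof (rule vtendsto_null_le)
  show "(\<lambda>N. v x * (v x / er) * rad N) \<longlonglongrightarrow> 0"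
    using tendsto_mult_right_zero[OF rad_tendsto] .
  fix N
  let ?y = "of_nat (p ^ N) * x"
  have y: "v ?y = rad N * v x" using v_p_power[of N] by (simp add: v_mult)
  have "v ?y < er" using v_nat_mult_le[of "p ^ N" x] assms by linarith
  from vexp_approx[OF this] have "v (vexp v x ^ (p ^ N) - 1 - ?y) \<le> v x * (v x / er) * rad N * rad N"
    unfolding vexp_of_nat_mult[OF assms] y by (simp add: algebra_simps)
  then have "v ((vexp v x ^ (p ^ N) - 1 - ?y) / of_nat p ^ N) \<le> v x * (v x / er) * rad N"
    by (rule v_divide_p_power_le)
  then show "v ((vexp v x ^ (p ^ N) - 1) / of_nat p ^ N - x) \<le> v x * (v x / er) * rad N"
    by (simp add: diff_divide_distrib)
qed

text \<open>A quantitative form of \<open>(-1 choose j) = (-1) ^ j\<close>: \<open>p ^ N - 1\<close>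
  is close to -1. Pascal's rule drives the induction, since \<open>p ^ N choose (j + 1)\<close> is
  \<open>p ^ N / (j + 1)\<close> times an integer.\<close>

lemma v_binomial_diff: "v (of_nat ((p ^ N - 1) choose j) - (-1) ^ j) \<le> rad N / v (fact j)"
proof (induction j)
  case (Suc j)
  define M where "M = p ^ N"
  have "M > 0" by (simp add: M_def)
  then have M: "Suc (M - 1) = M" by simp
  have fact: "v (fact (Suc j)) = v (of_nat (Suc j)) * v (fact j)"
    by (simp only: fact_Suc v_mult)
  have fact_pos: "v (fact i) > 0" for i :: nat by simp
  have le: "v (fact (Suc j)) \<le> v (of_nat (Suc j))" "v (fact (Suc j)) \<le> v (fact j)"
    unfolding fact using v_nat_le_1 v_fact_le_1 by (simp_all add: mult_left_le mult_left_le_one_le del: of_nat_Suc)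
  have "of_nat (Suc j) * of_nat (M choose Suc j) = (of_nat M * of_nat ((M - 1) choose j) :: 'a)"
    using Suc_times_binomial[of j "M - 1"] unfolding M by (metis of_nat_mult)
  then have "v (of_nat (Suc j)) * v (of_nat (M choose Suc j)) = v (of_nat M) * v (of_nat ((M - 1) choose j))"
    by (metis v_mult)
  also have "\<dots> \<le> rad N * 1"
    unfolding M_def using v_p_power[of N] v_nat_le_1 by (intro mult_mono) auto
  finally have "v (of_nat (M choose Suc j)) \<le> rad N / v (of_nat (Suc j))"
    by (simp add: pos_le_divide_eq mult.commute del: of_nat_Suc)
  also have "\<dots> \<le> rad N / v (fact (Suc j))"
    using le(1) fact_pos[of "Suc j"] by (intro divide_left_mono) (auto simp del: of_nat_Suc fact_Suc)
  finally have 1: "v (of_nat (M choose Suc j)) \<le> rad N / v (fact (Suc j))" .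
  have "rad N / v (fact j) \<le> rad N / v (fact (Suc j))"
    using le(2) fact_pos[of "Suc j"] by (intro divide_left_mono) (auto simp del: of_nat_Suc fact_Suc)
  with Suc.IH have 2: "v (of_nat ((M - 1) choose j) - (-1) ^ j) \<le> rad N / v (fact (Suc j))"
    unfolding M_def by linarith
  have "M choose Suc j = ((M - 1) choose j) + ((M - 1) choose Suc j)"
    using binomial_Suc_Suc[of "M - 1" j] unfolding M .
  then have "of_nat ((M - 1) choose Suc j) - (-1) ^ Suc j
    = of_nat (M choose Suc j) - (of_nat ((M - 1) choose j) - (-1 :: 'a) ^ j)" by simp
  from v_diff_le[OF 1 2, folded this] show ?case unfolding M_def .
qed simp

lemma vtendsto_subseq:
  assumes "vtendsto v X L" "\<And>n. s n \<ge> n"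
  shows "vtendsto v (\<lambda>n. X (s n)) L"
  using assms unfolding vtendsto_def by (meson order_trans)

context
  fixes q :: 'a
  assumes q: "v (q - 1) < er"
begin

lemma vlog_tendsto: "vtendsto v (\<lambda>N. \<Sum>n\<in>{1..N}. (-1) ^ (n + 1) * (q - 1) ^ n / of_nat n) (vlog v q)"
proof -
  let ?a = "\<lambda>n::nat. (-1) ^ (n + 1) * (q - 1) ^ n / of_nat n"
  have a: "v (?a (Suc n)) \<le> (v (q - 1) / er) ^ n" for n
  proof -
    have "v (?a (Suc n)) = v ((q - 1) ^ Suc n / of_nat (Suc n))"
      by (simp add: v_divide v_mult v_power)
    also have "\<dots> \<le> v (q - 1) * (v (q - 1) / er) ^ n"
      using order_trans[OF v_log_term v_exp_term, of "Suc n" "q - 1"] by simp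
    also have "\<dots> \<le> 1 * (v (q - 1) / er) ^ n"
      using q er_less_1 er_pos by (intro mult_right_mono) auto
    finally show ?thesis by simp
  qed
  have "(\<Sum>n\<in>{1..N}. ?a n) = (\<Sum>n<N. ?a (Suc n))" for N
    by (induction N) (simp_all add: add.commute)
  then obtain L where L: "vtendsto v (\<lambda>N. \<Sum>n\<in>{1..N}. ?a n) L"
    using series_converges[OF a geometric_tendsto[OF q]] by auto
  then show ?thesis unfolding vlog_def vlim_eq[OF L] .
qed

lemma v_vlog: "v (vlog v q) < er"
proof -
  have "v (vlog v q) \<le> v (q - 1)"
  proof (rule vtendsto_bound0[OF vlog_tendsto], rule v_sum_le)
    fix N n :: nat assume n: "n \<in> {1..N}"
    have "v ((-1) ^ (n + 1) * (q - 1) ^ n / of_nat n) = v ((q - 1) ^ n / of_nat n)"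
      by (simp add: v_divide v_mult v_power)
    also have "\<dots> \<le> v (q - 1) * (v (q - 1) / er) ^ (n - 1)"
      using order_trans[OF v_log_term v_exp_term, of n "q - 1"] n by simp
    also have "\<dots> \<le> v (q - 1) * 1"
      using q er_pos by (intro mult_left_mono power_le_one) auto
    finally show "v ((-1) ^ (n + 1) * (q - 1) ^ n / of_nat n) \<le> v (q - 1)" by simp
  qed simp
  then show ?thesis using q by linarith
qed

text \<open>In the binomial expansion of the quotient the coefficient of \<open>y ^ k / k\<close> is
  \<open>(p ^ N - 1) choose (k - 1)\<close>, which tends to the sign in the logarithm series. This
  limit governs \<open>p ^ N / [p ^ N]\<close> and also yields \<open>vexp_vlog\<close>.\<close>

lemma vlog_limit: "vtendsto v (\<lambda>N. (q ^ (p ^ N) - 1) / of_nat p ^ N) (vlog v q)"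
proof -
  define y where "y = q - 1"
  define t where "t = v y / er"
  have t: "0 \<le> t" "t < 1" using q er_pos by (auto simp: t_def y_def)
  let ?a = "\<lambda>n::nat. (-1) ^ (n + 1) * (q - 1) ^ n / of_nat n"
  have lim: "vtendsto v (\<lambda>N. \<Sum>n\<in>{1..p ^ N}. ?a n) (vlog v q)"
    using vlog_tendsto by (rule vtendsto_subseq) (use p_gt_1 in \<open>simp add: less_imp_le\<close>)
  have quot: "(q ^ (p ^ N) - 1) / of_nat p ^ N = (\<Sum>k\<in>{1..p ^ N}. of_nat ((p ^ N - 1) choose (k - 1)) * (y ^ k / of_nat k))"
    for N
  proof -
    define M where "M = p ^ N"
    have "M > 0" by (simp add: M_def)
    then have M: "Suc (M - 1) = M" by simp
    have "q ^ M = (\<Sum>k\<le>M. of_nat (M choose k) * y ^ k)"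
      using binomial_ring[of y 1 M] by (simp add: y_def)
    also have "{..M} = insert 0 {1..M}" by auto
    finally have "q ^ M - 1 = (\<Sum>k\<in>{1..M}. of_nat (M choose k) * y ^ k)" by simp
    also have "\<dots> = (\<Sum>k\<in>{1..M}. of_nat M * (of_nat ((M - 1) choose (k - 1)) * (y ^ k / of_nat k)))"
    proof (rule sum.cong[OF refl])
      fix k assume "k \<in> {1..M}"
      then obtain j where k: "k = Suc j" by (cases k) auto
      have "of_nat (Suc j) * of_nat (M choose Suc j) = (of_nat M * of_nat ((M - 1) choose j) :: 'a)"
        using Suc_times_binomial[of j "M - 1"] unfolding M by (metis of_nat_mult)
      then show "of_nat (M choose k) * y ^ k = of_nat M * (of_nat ((M - 1) choose (k - 1)) * (y ^ k / of_nat k))"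
        unfolding k by (simp add: field_simps del: of_nat_Suc)
    qed
    finally have "q ^ M - 1 = of_nat M * (\<Sum>k\<in>{1..M}. of_nat ((M - 1) choose (k - 1)) * (y ^ k / of_nat k))"
      by (simp add: sum_distrib_left)
    then show ?thesis by (simp add: M_def)
  qed
  have "vtendsto v (\<lambda>N. (q ^ (p ^ N) - 1) / of_nat p ^ N - (\<Sum>n\<in>{1..p ^ N}. ?a n)) 0"
  proof (rule vtendstoI)
    fix e :: real assume "e > 0"
    \<comment> \<open>Terms with \<open>k \<ge> K\<close> are small on both sides by geometric
      decay; for the finitely many \<open>k < K\<close> the denominator \<open>fact (k - 1)\<close>
      is at least \<open>er ^ K\<close> in value, which fixes \<open>N0\<close>.\<close>
    obtain K where K: "t ^ K < e" using real_arch_pow_inv[OF \<open>e > 0\<close> t(2)] by blast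
    have "e * er ^ K > 0" using \<open>e > 0\<close> er_pos by simp
    from rad_less_ex[OF this] obtain N0 where N0: "rad N0 < e * er ^ K" by blast
    have "v ((q ^ (p ^ N) - 1) / of_nat p ^ N - (\<Sum>n\<in>{1..p ^ N}. ?a n) - 0) \<le> e" if N: "N \<ge> N0" for N
    proof -
      have eq: "(q ^ (p ^ N) - 1) / of_nat p ^ N - (\<Sum>n\<in>{1..p ^ N}. ?a n) - 0
        = (\<Sum>k\<in>{1..p ^ N}. (of_nat ((p ^ N - 1) choose (k - 1)) - (-1) ^ (k + 1)) * (y ^ k / of_nat k))"
        unfolding quot by (simp only: left_diff_distrib sum_subtractf diff_0_right y_def times_divide_eq_right diff_divide_distrib)
      show ?thesis unfolding eq
      proof (rule v_sum_le)
        fix k assume "k \<in> {1..p ^ N}"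
        then have k: "k \<ge> 1" by simp
        have tk: "v (y ^ k / of_nat k) \<le> t ^ k"
          unfolding t_def using v_log_term[OF k] v_exp_term' order_trans by blast
        let ?c = "of_nat ((p ^ N - 1) choose (k - 1)) - (-1) ^ (k + 1) :: 'a"
        show "v (?c * (y ^ k / of_nat k)) \<le> e"
        proof (cases "k \<ge> K")
          case True
          have "v ?c \<le> 1" using v_nat_le_1 by (intro v_diff_le) (simp_all add: v_power)
          then have "v (?c * (y ^ k / of_nat k)) \<le> 1 * t ^ k" using tk by (rule v_mult_le)
          also have "\<dots> \<le> t ^ K" using t True by (simp add: power_decreasing)
          finally show ?thesis using K by linarith
        next
          case False
          have sign: "(-1 :: 'a) ^ (k + 1) = (-1) ^ (k - 1)"
            using k by (cases k) simp_all
          have fact: "er ^ K \<le> v (fact (k - 1))"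
          proof (cases "k = 1")
            case True
            then show ?thesis using er_pos er_less_1 by (simp add: power_le_one)
          next
            case k1: False
            have "er ^ K \<le> er ^ (k - 1 - 1)"
              using er_pos er_less_1 False by (intro power_decreasing) auto
            also have "\<dots> \<le> v (fact (k - 1))" using k k1 by (intro v_fact_ge) auto
            finally show ?thesis .
          qed
          have "v ?c \<le> rad N / v (fact (k - 1))"
            unfolding sign by (rule v_binomial_diff)
          also have "\<dots> \<le> rad N0 / er ^ K"
            using fact er_pos rad_antimono[OF N] by (intro frac_le) auto
          also have "\<dots> \<le> e" using N0 er_pos by (simp add: field_simps)
          finally have "v (?c * (y ^ k / of_nat k)) \<le> e * t ^ k" using tk by (rule v_mult_le)
          also have "\<dots> \<le> e" using t \<open>e > 0\<close> by (simp add: mult_left_le power_le_one)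
          finally show ?thesis .
        qed
      qed (use \<open>e > 0\<close> in simp)
    qed
    then show "\<exists>N0. \<forall>N\<ge>N0. v ((q ^ (p ^ N) - 1) / of_nat p ^ N - (\<Sum>n\<in>{1..p ^ N}. ?a n) - 0) \<le> e" by blast
  qed
  from vtendsto_add[OF this lim] show ?thesis by simp
qed

end

text \<open>With \<open>y = u - 1\<close>, the linear term \<open>p * y\<close> strictly dominates:
  the middle binomial coefficients are divisible by \<open>p\<close> and come with higher powers of
  \<open>y\<close>, and \<open>y ^ p\<close> is smaller because
  \<open>v y ^ (p - 1) < er ^ (p - 1) = 1 / p\<close>. The radius \<open>er\<close> is exactly the
  threshold for this.\<close>

lemma v_power_p_minus_1:
  assumes "v (u - 1) < er"
  shows "v (u ^ p - 1) = v (u - 1) / p"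
proof (cases "u = 1")
  case False
  define y where "y = u - 1"
  have y: "v y < er" "0 < v y" "v y < 1" using assms False er_less_1 by (auto simp: y_def)
  have "u ^ p = (\<Sum>k\<le>p. of_nat (p choose k) * y ^ k)"
    using binomial_ring[of y 1 p] by (simp add: y_def)
  also have "{..p} = insert 0 (insert 1 {2..p})" using p_gt_1 by auto
  finally have eq: "u ^ p - 1 = of_nat p * y + (\<Sum>k\<in>{2..p}. of_nat (p choose k) * y ^ k)" by simp
  have yp: "v y ^ (p - 1) < 1 / p"
    unfolding er_power[symmetric] using y p_gt_1 by (intro power_strict_mono) auto
  define B where "B = max (v y / p) (v y ^ (p - 1))"
  have B: "B < 1 / p" using yp y p_gt_1 by (auto simp: B_def divide_strict_right_mono)
  have "0 \<le> B" by (simp add: B_def le_max_iff_disj)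
  have "v (\<Sum>k\<in>{2..p}. of_nat (p choose k) * y ^ k) \<le> v y * B"
  proof (rule v_sum_le)
    fix k assume k: "k \<in> {2..p}"
    show "v (of_nat (p choose k) * y ^ k) \<le> v y * B"
    proof (cases "k = p")
      case True
      then have "v (of_nat (p choose k) * y ^ k) = v y ^ Suc (p - 1)"
        using p_gt_1 by (simp add: v_power)
      also have "\<dots> \<le> v y * B" unfolding power_Suc B_def by (intro mult_left_mono) auto
      finally show ?thesis .
    next
      case False
      then have "p dvd (p choose k)" using k prime_p by (intro dvd_choose_prime) auto
      then obtain c where c: "p choose k = p * c" by blast
      have "v (of_nat (p choose k)) \<le> 1 / p"
        unfolding c of_nat_mult using v_mult_le[OF _ v_nat_le_1, of "of_nat p" "1 / p" c] v_p by simp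
      moreover have "v (y ^ k) \<le> v y ^ 2"
        unfolding v_power using k y by (intro power_decreasing) auto
      ultimately have "v (of_nat (p choose k) * y ^ k) \<le> 1 / p * v y ^ 2" by (rule v_mult_le)
      also have "\<dots> = v y * (v y / p)" by (simp add: power2_eq_square)
      also have "\<dots> \<le> v y * B" unfolding B_def by (intro mult_left_mono) auto
      finally show ?thesis .
    qed
  qed (use \<open>0 \<le> B\<close> in simp)
  also have "v y * B < v (of_nat p * y)" using mult_strict_left_mono[OF B y(2)] by (simp add: v_mult v_p mult.commute)
  finally show ?thesis unfolding eq by (subst v_add_eq) (simp_all add: v_mult v_p y_def)
qed simp

lemma v_power_p_power_minus_1:
  assumes "v (u - 1) < er"
  shows "v (u ^ (p ^ N) - 1) = rad N * v (u - 1)"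
proof (induction N)
  case (Suc N)
  have "rad N * v (u - 1) \<le> 1 * v (u - 1)" by (intro mult_right_mono) auto
  then have "v (u ^ (p ^ N) - 1) < er" using Suc.IH assms by simp
  from v_power_p_minus_1[OF this] have "v ((u ^ (p ^ N)) ^ p - 1) = rad (Suc N) * v (u - 1)"
    by (simp add: Suc.IH rad_Suc)
  then show ?case by (simp add: mult.commute flip: power_mult)
qed simp

lemma v_principal_unit:
  assumes "v (u - 1) < er"
  shows "v u = 1"
  using v_add_eq[of "u - 1" 1] assms er_less_1 by simp

text \<open>The \<open>p ^ N\<close>-th powers of \<open>q\<close> and of \<open>exp (log q)\<close> agree up to \<open>o (p ^ N)\<close>, while raising
  the quotient of these two numbers to the power \<open>p ^ N\<close> scales its distance to 1 by exactly \<open>p ^ (- N)\<close>.\<close>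
lemma vexp_vlog:
  assumes q: "v (q - 1) < er"
  shows "vexp v (vlog v q) = q"
proof -
  define Q where "Q = vexp v (vlog v q)"
  note L = v_vlog[OF q]
  have "v (Q - (1 + vlog v q)) \<le> v (vlog v q) * (v (vlog v q) / er)"
    unfolding Q_def by (rule vexp_approx[OF L])
  also have "\<dots> \<le> v (vlog v q) * 1" using L er_pos by (intro mult_left_mono) auto
  finally have "v (Q - (1 + vlog v q)) < er" using L by simp
  from v_add_less[OF this L] have Q: "v (Q - 1) < er" by simp
  have vq: "v q = 1" by (rule v_principal_unit[OF q])
  then have "q \<noteq> 0" by auto
  define u where "u = Q / q"
  have "u - 1 = (Q - q) / q" using \<open>q \<noteq> 0\<close> by (simp add: u_def diff_divide_distrib)
  then have "v (u - 1) = v (Q - q)" by (simp add: v_divide vq)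
  also have "\<dots> < er" using v_add_less[of "Q - 1" er "1 - q"] Q q by (simp add: v_minus_commute)
  finally have u: "v (u - 1) < er" .
  have "vtendsto v (\<lambda>N. (Q ^ (p ^ N) - 1) / of_nat p ^ N - (q ^ (p ^ N) - 1) / of_nat p ^ N) (vlog v q - vlog v q)"
    unfolding Q_def by (intro vtendsto_diff vlog_limit[OF q] vexp_diff_quotient L)
  then have "(\<lambda>N. v ((Q ^ (p ^ N) - 1) / of_nat p ^ N - (q ^ (p ^ N) - 1) / of_nat p ^ N)) \<longlonglongrightarrow> 0"
    unfolding vtendsto_iff by simp
  moreover have "v ((Q ^ (p ^ N) - 1) / of_nat p ^ N - (q ^ (p ^ N) - 1) / of_nat p ^ N) = v (u - 1)" for N
  proof -
    have "(Q ^ (p ^ N) - 1) / of_nat p ^ N - (q ^ (p ^ N) - 1) / of_nat p ^ N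
      = q ^ (p ^ N) * (u ^ (p ^ N) - 1) / of_nat p ^ N"
      using \<open>q \<noteq> 0\<close> by (simp add: u_def power_divide field_simps)
    then show ?thesis
      using v_power_p_power_minus_1[OF u, of N] by (simp add: v_divide v_mult v_power vq v_p rad_def)
  qed
  ultimately have "v (u - 1) = 0" by (simp only: LIMSEQ_const_iff)
  then show ?thesis using \<open>q \<noteq> 0\<close> by (simp add: u_def Q_def)
qed

subsection \<open>Roots of unity of p-power order\<close>

lemma primitive_root_prime: "\<exists>x::'a. \<forall>m. x ^ m = 1 \<longleftrightarrow> p dvd m"
proof -
  have "0 < p - 1" using p_gt_1 by simp
  from root_exists[OF this, of "\<lambda>_. 1"] obtain x :: 'a where "x ^ (p - 1) + (\<Sum>i<p - 1. x ^ i) = 0" by auto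
  moreover have "Suc (p - 1) = p" using p_gt_1 by simp
  ultimately have sum: "(\<Sum>i<p. x ^ i) = 0" by (metis add.commute sum.lessThan_Suc)
  \<comment> \<open>At 1 the sum would equal \<open>p\<close>, which is nonzero in characteristic
    0.\<close>
  have "x \<noteq> 1" using sum by auto
  have xp: "x ^ p = 1" using power_diff_1_eq[of x p] sum by simp
  have "p dvd m" if "x ^ m = 1" for m
  proof (rule ccontr)
    assume "\<not> p dvd m"
    then have "coprime m p" using prime_imp_coprime[OF prime_p] by (simp add: coprime_commute)
    moreover have "m \<noteq> 0" using \<open>\<not> p dvd m\<close> by (intro notI) simp
    ultimately obtain i j where "m * i = p * j + 1" using bezout_nat[of m p] by auto
    then have "x ^ (m * i) = x ^ (p * j) * x" by simp
    then show False using \<open>x \<noteq> 1\<close> that xp by (simp add: power_mult)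
  qed
  moreover have "x ^ m = 1" if "p dvd m" for m using that xp by (auto simp: power_mult)
  ultimately show ?thesis by blast
qed

lemma p_root_exists: "\<exists>y::'a. y ^ p = x"
proof -
  have "(\<Sum>i<p. (if i = 0 then - x else 0) * y ^ i) = - x" for y
    by (subst sum.remove[of _ 0]) auto
  with root_exists[OF p_pos(1), of "\<lambda>i. if i = 0 then - x else 0"] show ?thesis by auto
qed

text \<open>A \<open>p\<close>-th root of a primitive root of order \<open>p ^ n\<close> is
  primitive of the next order. For \<open>n = 0\<close> this may fail, as the root may be 1, so
  order \<open>p\<close> is taken from \<open>primitive_root_prime\<close>.\<close>

lemma primitive_root: "\<exists>x::'a. \<forall>m. x ^ m = 1 \<longleftrightarrow> p ^ n dvd m"
proof (induction n)
  case 0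
  show ?case by (intro exI[of _ 1]) simp
next
  case (Suc n)
  show ?case
  proof (cases n)
    case 0
    then show ?thesis using primitive_root_prime by simp
  next
    case (Suc k)
    from Suc.IH obtain x :: 'a where x: "\<And>m. x ^ m = 1 \<longleftrightarrow> p ^ n dvd m" by blast
    obtain y where y: "y ^ p = x" using p_root_exists by blast
    have "y ^ m = 1 \<longleftrightarrow> p ^ Suc n dvd m" for m
    proof
      assume m: "y ^ m = 1"
      have "x ^ m = (y ^ m) ^ p" by (simp add: y[symmetric] mult.commute flip: power_mult)
      then have "p ^ n dvd m" using m x by simp
      then obtain i where i: "m = p ^ n * i" by blast
      \<comment> \<open>Since \<open>n = k + 1\<close>, one factor \<open>p\<close> of
        \<open>m\<close> turns \<open>y\<close> into \<open>x\<close>, and the order of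
        \<open>x\<close> then forces \<open>p\<close> to divide \<open>i\<close>.\<close>
      have "x ^ (p ^ k * i) = y ^ m" by (simp add: y[symmetric] i Suc mult.assoc flip: power_mult)
      then have "p ^ n dvd p ^ k * i" using m x by simp
      then have "p dvd i" by (simp add: Suc)
      then show "p ^ Suc n dvd m" by (simp add: i mult.commute)
    next
      assume "p ^ Suc n dvd m"
      then obtain i where "m = p * (p ^ n * i)" by (auto simp: mult.assoc)
      then have "y ^ m = x ^ (p ^ n * i)" by (simp add: power_mult y)
      then show "y ^ m = 1" using x by simp
    qed
    then show ?thesis by blast
  qed
qed

text \<open>The powers of \<open>x\<close> are distinct, and the polynomial
  \<open>X ^ (p ^ n) - 1\<close> has no more than \<open>p ^ n\<close> roots.\<close>

lemma roots_pn_bij: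
  assumes "\<And>m. x ^ m = (1::'a) \<longleftrightarrow> p ^ n dvd m"
  shows "bij_betw (\<lambda>i. x ^ i) {..<p ^ n} (roots_pn p n)"
proof -
  have "x \<noteq> 0"
  proof
    assume "x = 0"
    then show False using assms[of "p ^ n"] by (simp add: power_0_left)
  qed
  have eq: "i = j" if "x ^ i = x ^ j" "i \<le> j" "j < p ^ n" for i j
  proof -
    have "x ^ i * x ^ (j - i) = x ^ j" using that(2) by (simp flip: power_add)
    also have "\<dots> = x ^ i * 1" using that(1) by simp
    finally have "p ^ n dvd j - i" using \<open>x \<noteq> 0\<close> by (simp add: assms)
    then show ?thesis using that by (auto dest: dvd_imp_le)
  qed
  have inj: "inj_on (\<lambda>i. x ^ i) {..<p ^ n}"
    by (rule linorder_inj_onI') (use eq in \<open>force simp: eq_commute\<close>)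
  define P where "P = monom (1::'a) (p ^ n) - 1"
  have roots: "roots_pn p n = {w. poly P w = 0}"
    by (simp add: roots_pn_def P_def poly_monom)
  have "coeff P (p ^ n) = 1" by (simp add: P_def)
  then have "P \<noteq> 0" by auto
  have "degree P \<le> p ^ n" unfolding P_def by (intro degree_diff_le degree_monom_le) simp
  then have "card (roots_pn p n :: 'a set) \<le> p ^ n"
    using card_poly_roots_bound[OF \<open>P \<noteq> 0\<close>] unfolding roots by linarith
  moreover have "finite (roots_pn p n :: 'a set)" unfolding roots by (rule poly_roots_finite[OF \<open>P \<noteq> 0\<close>])
  moreover have "(\<lambda>i. x ^ i) ` {..<p ^ n} \<subseteq> roots_pn p n"
  proof
    fix w assume "w \<in> (\<lambda>i. x ^ i) ` {..<p ^ n}"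
    then obtain i where "w = x ^ i" by blast
    then have "w ^ (p ^ n) = x ^ (p ^ n * i)" by (simp add: mult.commute flip: power_mult)
    then show "w \<in> roots_pn p n" using assms by (simp add: roots_pn_def)
  qed
  ultimately have "(\<lambda>i. x ^ i) ` {..<p ^ n} = roots_pn p n"
    by (intro card_seteq) (simp_all add: card_image[OF inj])
  with inj show ?thesis by (simp add: bij_betw_def)
qed

lemma sum_roots_pn: "(\<Sum>w\<in>roots_pn p n. w ^ e) = (if p ^ n dvd e then of_nat p ^ n else (0::'a))"
proof -
  obtain x :: 'a where x: "\<And>m. x ^ m = 1 \<longleftrightarrow> p ^ n dvd m" using primitive_root by blast
  have "(\<Sum>w\<in>roots_pn p n. w ^ e) = (\<Sum>i<p ^ n. (x ^ e) ^ i)"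
    using sum.reindex_bij_betw[OF roots_pn_bij[OF x], of "\<lambda>w. w ^ e"]
    by (simp add: mult.commute flip: power_mult)
  moreover have "(\<Sum>i<p ^ n. (x ^ e) ^ i) = 0" if "\<not> p ^ n dvd e"
  proof -
    have "(x ^ e) ^ (p ^ n) = 1" using x by (simp flip: power_mult)
    then have "(x ^ e - 1) * (\<Sum>i<p ^ n. (x ^ e) ^ i) = 0"
      using power_diff_1_eq[of "x ^ e" "p ^ n"] by simp
    then show ?thesis using that x by simp
  qed
  moreover have "(\<Sum>i<p ^ n. (x ^ e) ^ i) = of_nat p ^ n" if "p ^ n dvd e"
  proof -
    have "x ^ e = 1" using that x by blast
    then show ?thesis by simp
  qed
  ultimately show ?thesis by simp
qed

lemma v_root_of_unity:
  assumes "w ^ (p ^ n) = 1"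
  shows "v w = 1"
proof -
  have "v w ^ (p ^ n) = 1" using assms by (simp flip: v_power)
  then show ?thesis using power_eq_imp_eq_base[of "v w" "p ^ n" 1] by simp
qed

subsection \<open>Powers with p-adic exponents\<close>

lemma v_powi_minus_1:
  assumes "v x = 1"
  shows "v (x powi t - 1) \<le> v (x - 1)"
proof -
  have nat: "v (x ^ k - 1) \<le> v (x - 1)" for k
  proof -
    have "v (\<Sum>i<k. x ^ i) \<le> 1" using assms by (intro v_sum_le) (simp_all add: v_power)
    then show ?thesis unfolding power_diff_1_eq v_mult by (simp add: mult_left_le)
  qed
  show ?thesis
  proof (cases t rule: int_cases2)
    case (nonneg k)
    then show ?thesis using nat by simp
  next
    case (nonpos k)
    have "x \<noteq> 0" using assms by auto
    then have "x powi t - 1 = - ((x ^ k - 1) / x ^ k)"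
      by (simp add: nonpos power_int_minus field_simps)
    then show ?thesis using nat[of k] assms by (simp add: v_divide v_power)
  qed
qed

text \<open>\<open>upow\<close> quantifies over all integer sequences tending to \<open>z\<close>.
  Eventually their members differ from \<open>trunc n z\<close> by multiples of
  \<open>p ^ n\<close>, and such a change of the exponent is harmless once
  \<open>\<alpha> ^ (p ^ n)\<close> is close to 1. It thus suffices to look at truncations, with one
  suitable \<open>n\<close> for each \<open>e\<close>.\<close>

lemma upow_eqI:
  assumes z: "z \<in> Zp v" and \<alpha>: "v \<alpha> = 1"
    and L: "\<And>e. e > 0 \<Longrightarrow> \<exists>n. v (\<alpha> ^ (p ^ n) - 1) \<le> e \<and> v (\<alpha> ^ trunc n z - L) \<le> e"
  shows "upow v \<alpha> z = L"
proof -
  have "\<alpha> \<noteq> 0" using \<alpha> by auto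
  have lim: "vtendsto v (\<lambda>k. \<alpha> powi s k) L" if s: "vtendsto v (\<lambda>k. of_int (s k)) z" for s
  proof (rule vtendstoI)
    fix e :: real assume "e > 0"
    from L[OF this] obtain n where n: "v (\<alpha> ^ (p ^ n) - 1) \<le> e" "v (\<alpha> ^ trunc n z - L) \<le> e" by blast
    obtain K where K: "\<And>k. k \<ge> K \<Longrightarrow> v (of_int (s k) - z) \<le> rad n"
      using vtendsto_eventually_le[OF s rad_pos] by blast
    have "v (\<alpha> powi s k - L) \<le> e" if k: "k \<ge> K" for k
    proof -
      have "v (of_int (s k - int (trunc n z))) \<le> rad n"
        using v_trans[OF K[OF k] trunc_close[OF z]] by simp
      then have "int p ^ n dvd s k - int (trunc n z)" by (simp only: v_int_le_rad)
      then obtain t where "s k - int (trunc n z) = int p ^ n * t" by blast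
      then have t: "s k = int (trunc n z) + int (p ^ n) * t" by simp
      have "\<alpha> powi s k = \<alpha> ^ trunc n z * (\<alpha> ^ (p ^ n)) powi t"
        unfolding t using \<open>\<alpha> \<noteq> 0\<close> by (simp add: power_int_add power_int_mult del: of_nat_power)
      then have "v (\<alpha> powi s k - \<alpha> ^ trunc n z) = v (\<alpha> ^ trunc n z * ((\<alpha> ^ (p ^ n)) powi t - 1))"
        by (simp add: right_diff_distrib)
      also have "\<dots> \<le> e"
        using order_trans[OF v_powi_minus_1[of "\<alpha> ^ (p ^ n)" t] n(1)] by (simp add: v_mult v_power \<alpha>)
      finally show ?thesis using n(2) by (rule v_trans)
    qed
    then show "\<exists>K. \<forall>k\<ge>K. v (\<alpha> powi s k - L) \<le> e" by blast
  qed
  obtain s where s: "vtendsto v (\<lambda>k. of_int (s k)) z" using z unfolding Zp_def by blast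
  show ?thesis unfolding upow_def
    by (rule the_equality) (use lim s vtendsto_unique in blast)+
qed

lemma upow_root_of_unity:
  assumes "w ^ (p ^ n) = 1" "z \<in> Zp v"
  shows "upow v w z = w ^ trunc n z"
  using assms v_root_of_unity[OF assms(1)] by (intro upow_eqI) (auto intro!: exI[of _ n])

lemma upow_of_nat:
  assumes w: "w ^ (p ^ n) = 1" and q: "v (q - 1) < er"
  shows "upow v (w / q) (of_nat m) = (w / q) ^ m"
proof (rule upow_eqI)
  have vq: "v q = 1" by (rule v_principal_unit[OF q])
  then show "v (w / q) = 1" by (simp add: v_divide v_root_of_unity[OF w])
  fix e :: real assume "e > 0"
  then obtain k where k: "rad k < e" using rad_less_ex by blast
  \<comment> \<open>\<open>i \<ge> n\<close> makes the power of \<open>w\<close> trivial,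
    \<open>i \<ge> k\<close> brings the power of \<open>q\<close> close to 1, and
    \<open>i \<ge> m\<close> makes the truncation of \<open>m\<close> equal to
    \<open>m\<close>.\<close>
  define i where "i = max (max k n) m"
  have "m < p ^ i"
  proof -
    have "m < p ^ m" using power_gt_expt[of p m] p_gt_1 by simp
    also have "\<dots> \<le> p ^ i" using p_gt_1 by (intro power_increasing) (auto simp: i_def)
    finally show ?thesis .
  qed
  moreover have "v ((w / q) ^ (p ^ i) - 1) \<le> e"
  proof -
    have "w ^ (p ^ i) = (w ^ (p ^ n)) ^ (p ^ (i - n))"
      by (simp add: i_def flip: power_mult power_add)
    then have "w ^ (p ^ i) = 1" using w by simp
    moreover have "q \<noteq> 0" using vq by auto
    ultimately have "(w / q) ^ (p ^ i) - 1 = - ((q ^ (p ^ i) - 1) / q ^ (p ^ i))"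
      by (simp add: power_divide field_simps)
    then have "v ((w / q) ^ (p ^ i) - 1) = rad i * v (q - 1)"
      using v_power_p_power_minus_1[OF q, of i] by (simp add: v_divide v_power vq)
    also have "\<dots> \<le> rad i * 1" using q er_less_1 by (intro mult_left_mono) auto
    also have "\<dots> \<le> e" using order_trans[OF rad_antimono less_imp_le[OF k], of i] by (simp add: i_def)
    finally show ?thesis .
  qed
  ultimately show "\<exists>n. v ((w / q) ^ (p ^ n) - 1) \<le> e \<and> v ((w / q) ^ trunc n (of_nat m) - (w / q) ^ m) \<le> e"
    using \<open>e > 0\<close> by (intro exI[of _ i]) simp
qed simp

subsection \<open>Reduction of the q-integral to the Volkenborn integral\<close>

lemma vtendsto_inverse:
  assumes X: "vtendsto v X L" and "L \<noteq> 0"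
  shows "vtendsto v (\<lambda>n. inverse (X n)) (inverse L)"
proof (rule vtendstoI)
  fix e :: real assume "e > 0"
  \<comment> \<open>The first bound forces \<open>v (X n) = v L\<close> by the ultrametric
    inequality; the second absorbs the denominator \<open>X n * L\<close>.\<close>
  define e' where "e' = min (v L / 2) (e * (v L * v L))"
  have e': "e' > 0" "e' < v L" "e' \<le> e * (v L * v L)"
    using \<open>e > 0\<close> \<open>L \<noteq> 0\<close> by (auto simp: e'_def min_less_iff_disj)
  obtain N where N: "\<And>n. n \<ge> N \<Longrightarrow> v (X n - L) \<le> e'"
    using vtendsto_eventually_le[OF X e'(1)] by blast
  have "v (inverse (X n) - inverse L) \<le> e" if n: "n \<ge> N" for n
  proof -
    have vX: "v (X n) = v L" using v_add_eq[of "X n - L" L] N[OF n] e'(2) by simp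
    then have "X n \<noteq> 0" using \<open>L \<noteq> 0\<close> by (metis v_eq_0_iff)
    then have "inverse (X n) - inverse L = - ((X n - L) / (X n * L))"
      using \<open>L \<noteq> 0\<close> by (simp add: field_simps)
    then have "v (inverse (X n) - inverse L) = v (X n - L) / (v L * v L)"
      by (simp add: v_divide v_mult vX)
    also have "\<dots> \<le> e" using N[OF n] e'(3) \<open>L \<noteq> 0\<close> by (simp add: pos_divide_le_eq)
    finally show ?thesis .
  qed
  then show "\<exists>N. \<forall>n\<ge>N. v (inverse (X n) - inverse L) \<le> e" by blast
qed

context
  fixes q :: 'a
  assumes q: "v (q - 1) < er" and q1: "q \<noteq> 1"
begin

lemma qpow_of_nat: "qpow v q (of_nat m) = q ^ m"
  unfolding qpow_def vexp_of_nat_mult[OF v_vlog[OF q]] vexp_vlog[OF q] ..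

lemma qpow_minus_of_nat: "qpow v q (- of_nat m) = inverse (q ^ m)"
proof -
  have "v (of_nat m * vlog v q) < er" using v_nat_mult_le[of m "vlog v q"] v_vlog[OF q] by linarith
  from vexp_minus[OF this] show ?thesis
    using qpow_of_nat[of m] by (simp add: qpow_def)
qed

lemma vlog_nonzero: "vlog v q \<noteq> 0"
  using vexp_vlog[OF q] vexp_0 q1 by auto

definition qfactor :: 'a where "qfactor = (q - 1) / vlog v q"

lemma Iq_eq:
  assumes "vtendsto v (mean (\<lambda>x. f (of_nat x) * q ^ x)) L"
  shows "Iq p v q f = qfactor * L"
  unfolding Iq_def
proof (rule vlim_eq)
  let ?D = "\<lambda>N. (q ^ (p ^ N) - 1) / of_nat p ^ N"
  have "vtendsto v (\<lambda>N. (q - 1) * inverse (?D N) * mean (\<lambda>x. f (of_nat x) * q ^ x) N)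
    ((q - 1) * inverse (vlog v q) * L)"
    by (intro vtendsto_mult vtendsto_cmult vtendsto_inverse vlog_limit[OF q] vlog_nonzero assms)
  moreover have "(q - 1) * inverse (?D N) * mean (\<lambda>x. f (of_nat x) * q ^ x) N
    = 1 / qnum v q (of_nat (p ^ N)) * (\<Sum>x<p ^ N. f (of_nat x) * qpow v q (of_nat x))" for N
  proof -
    have "1 / qnum v q (of_nat (p ^ N)) = (1 - q) / (1 - q ^ (p ^ N))"
      unfolding qnum_def qpow_of_nat by simp
    also have "\<dots> = (q - 1) / (q ^ (p ^ N) - 1)" by (metis minus_diff_eq minus_divide_divide)
    finally show ?thesis by (simp add: qpow_of_nat mean_def)
  qed
  ultimately show "vtendsto v (\<lambda>N. 1 / qnum v q (of_nat (p ^ N)) *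
    (\<Sum>x<p ^ N. f (of_nat x) * qpow v q (of_nat x))) (qfactor * L)"
    by (simp add: qfactor_def divide_inverse)
qed

text \<open>The weight \<open>q ^ x\<close> of the q-integral cancels the \<open>q\<close> in
  \<open>(w / q) ^ x\<close>. What remains is \<open>w ^ x * f x\<close>, and \<open>w ^ x\<close>
  depends only on \<open>x\<close> modulo \<open>p ^ n\<close>, so the mean splits into progressions
  of step \<open>p ^ n\<close>.\<close>

lemma fhat_eq:
  assumes f: "UDd f d" and w: "w ^ (p ^ n) = 1"
  shows "fhat p v q f (w / q) = qfactor * ((\<Sum>a<p ^ n. w ^ a * vol f n a) / of_nat p ^ n)"
  unfolding fhat_def
proof (rule Iq_eq)
  have "q \<noteq> 0" using v_principal_unit[OF q] by auto
  \<comment> \<open>The level is shifted by \<open>n\<close> so that each residue class modulo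
    \<open>p ^ n\<close> holds exactly \<open>p ^ K\<close> points.\<close>
  have mean: "mean (\<lambda>x. upow v (w / q) (of_nat x) * f (of_nat x) * q ^ x) (K + n)
    = (\<Sum>a<p ^ n. w ^ a * mean (\<lambda>y. f (of_nat (a + p ^ n * y))) K) / of_nat p ^ n" for K
  proof -
    have "(\<Sum>x<p ^ (K + n). upow v (w / q) (of_nat x) * f (of_nat x) * q ^ x)
      = (\<Sum>x<p ^ n * p ^ K. w ^ x * f (of_nat x))"
      using \<open>q \<noteq> 0\<close> by (simp add: upow_of_nat[OF w q] power_divide power_add mult.commute)
    also have "\<dots> = (\<Sum>a<p ^ n. w ^ a * (\<Sum>y<p ^ K. f (of_nat (a + p ^ n * y))))"
      unfolding sum_lessThan_mult by (simp add: power_add power_mult w sum_distrib_left del: of_nat_add of_nat_mult)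
    finally show ?thesis
      by (simp add: mean_def power_add del: of_nat_add of_nat_mult flip: sum_divide_distrib)
  qed
  have "vtendsto v (\<lambda>K. mean (\<lambda>x. upow v (w / q) (of_nat x) * f (of_nat x) * q ^ x) (K + n))
    ((\<Sum>a<p ^ n. w ^ a * vol f n a) / of_nat p ^ n)"
    unfolding mean by (intro vtendsto_cdivide vtendsto_sum vtendsto_cmult vol_tendsto[OF f])
  then show "vtendsto v (mean (\<lambda>x. upow v (w / q) (of_nat x) * f (of_nat x) * q ^ x))
    ((\<Sum>a<p ^ n. w ^ a * vol f n a) / of_nat p ^ n)"
    by (simp only: vtendsto_shift)
qed

lemma roots_sum_eq_dconv:
  assumes f: "UDd f d" and g: "UDd g d'" and z: "z \<in> Zp v"
  shows "(\<Sum>w\<in>roots_pn p n. fhat p v q f (w / q) * fhat p v q g (w / q) * upow v (inverse w) z)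
    = qfactor\<^sup>2 * dconv f g n (trunc n z)"
proof -
  define N where "N = p ^ n"
  define m where "m = trunc n z"
  have m: "m < N" unfolding N_def m_def by (rule trunc_less[OF z])
  let ?A = "\<lambda>a. vol f n a" and ?B = "\<lambda>b. vol g n b"
  have "(\<Sum>w\<in>roots_pn p n. fhat p v q f (w / q) * fhat p v q g (w / q) * upow v (inverse w) z)
    = (\<Sum>w\<in>roots_pn p n. qfactor\<^sup>2 / of_nat N ^ 2 * (\<Sum>a<N. \<Sum>b<N. ?A a * ?B b * w ^ (a + b + (N - m))))"
  proof (rule sum.cong[OF refl])
    fix w :: 'a assume "w \<in> roots_pn p n"
    then have w: "w ^ (p ^ n) = 1" by (simp add: roots_pn_def)
    then have "inverse w ^ (p ^ n) = 1" by (simp add: power_inverse)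
    then have "upow v (inverse w) z = inverse w ^ m"
      unfolding m_def using z by (rule upow_root_of_unity)
    \<comment> \<open>Replacing the exponent \<open>- m\<close> by \<open>N - m\<close> keeps the
      exponents natural, as \<open>sum_roots_pn\<close> requires.\<close>
    also have "\<dots> = w ^ (N - m)"
    proof -
      have "w ^ (N - m) * w ^ m = 1" using m w by (simp add: N_def flip: power_add)
      then show ?thesis by (metis inverse_unique mult.commute power_inverse)
    qed
    finally have up: "upow v (inverse w) z = w ^ (N - m)" .
    have "(\<Sum>a<N. w ^ a * ?A a) * (\<Sum>b<N. w ^ b * ?B b) * w ^ (N - m)
      = (\<Sum>a<N. \<Sum>b<N. ?A a * ?B b * w ^ (a + b + (N - m)))"
      unfolding sum_product unfolding sum_distrib_right by (intro sum.cong refl) (simp add: power_add mult_ac)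
    then show "fhat p v q f (w / q) * fhat p v q g (w / q) * upow v (inverse w) z
      = qfactor\<^sup>2 / of_nat N ^ 2 * (\<Sum>a<N. \<Sum>b<N. ?A a * ?B b * w ^ (a + b + (N - m)))"
      unfolding up fhat_eq[OF f w] fhat_eq[OF g w]
      by (simp add: N_def power2_eq_square flip: mult.assoc)
  qed
  also have "\<dots> = qfactor\<^sup>2 / of_nat N ^ 2 *
      (\<Sum>a<N. \<Sum>b<N. \<Sum>w\<in>roots_pn p n. ?A a * ?B b * w ^ (a + b + (N - m)))"
    by (simp only: sum_distrib_left[symmetric] sum.swap[of _ "{..<N}" "roots_pn p n"])
  also have "(\<Sum>a<N. \<Sum>b<N. \<Sum>w\<in>roots_pn p n. ?A a * ?B b * w ^ (a + b + (N - m)))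
    = (\<Sum>a<N. \<Sum>b<N. if b = cdiff N m a then ?A a * ?B b * of_nat N else 0)"
  proof (intro sum.cong refl)
    fix a b assume "a \<in> {..<N}" "b \<in> {..<N}"
    then have ab: "a < N" "b < N" by auto
    have "N dvd a + b + (N - m) \<longleftrightarrow> b = cdiff N m a"
    proof
      assume "N dvd a + b + (N - m)"
      then obtain k where k: "a + b + (N - m) = N * k" by blast
      \<comment> \<open>Only the multiples \<open>N\<close> and \<open>2 * N\<close> are possible;
        they correspond to \<open>a \<le> m\<close> and \<open>a > m\<close> in
        \<open>cdiff\<close>.\<close>
      have "0 < N * k" "N * k < N * 3" using k m ab by linarith+
      then have "k = 1 \<or> k = 2" by auto
      then show "b = cdiff N m a" using k m ab by (auto simp: cdiff_def)
    next
      assume "b = cdiff N m a"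
      then have "a + b + (N - m) = N \<or> a + b + (N - m) = N * 2" using m ab by (auto simp: cdiff_def)
      then show "N dvd a + b + (N - m)" by auto
    qed
    then show "(\<Sum>w\<in>roots_pn p n. ?A a * ?B b * w ^ (a + b + (N - m)))
      = (if b = cdiff N m a then ?A a * ?B b * of_nat N else 0)"
      unfolding sum_distrib_left[symmetric] sum_roots_pn by (simp add: N_def)
  qed
  also have "\<dots> = (\<Sum>a<N. ?A a * ?B (cdiff N m a)) * of_nat N"
    using m by (simp add: sum.delta cdiff_less sum_distrib_right)
  also have "qfactor\<^sup>2 / of_nat N ^ 2 * \<dots> = qfactor\<^sup>2 * dconv f g n m"
    by (simp add: dconv_def N_def power2_eq_square)
  finally show ?thesis unfolding m_def .
qed

lemma qconv_eq:
  assumes "UDd f d" "UDd g d'" "z \<in> Zp v" "vtendsto v (\<lambda>n. dconv f g n (trunc n z)) H"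
  shows "qconv p v q f g z = qfactor\<^sup>2 * H"
  unfolding qconv_def sum_w_def
  by (rule vlim_eq) (unfold roots_sum_eq_dconv[OF assms(1-3)], rule vtendsto_cmult[OF assms(4)])

lemma vderiv_qconv:
  assumes F: "UDd F f" and G: "UDd G g" and z: "z \<in> Zp v"
  shows "vderiv v (qconv p v q F G) z = - (qfactor\<^sup>2 * cconv f g z)"
proof -
  obtain H where H: "\<And>z. z \<in> Zp v \<Longrightarrow> vtendsto v (\<lambda>n. dconv F G n (trunc n z)) (H z)"
    "UDd H (\<lambda>z. - cconv f g z)" using dconv_UDd[OF F G] by blast
  have "UDd (qconv p v q F G) (\<lambda>z. qfactor\<^sup>2 * - cconv f g z)"
    by (rule UDd_cong[OF UDd_cmult[OF H(2), of "qfactor\<^sup>2"]]) (simp_all add: qconv_eq[OF F G _ H(1)])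
  from UDd_imp_vderiv[OF this z] show ?thesis by simp
qed

text \<open>The primitives picked by \<open>SOME\<close> are unknown, but
  \<open>vderiv_qconv\<close> sees only their derivatives. Suitable ones exist:
  \<open>antiderivative_ex\<close> for \<open>f\<close>, which is continuous because it is
  differentiable, and \<open>g\<close> itself for its own derivative.\<close>

lemma qotimes_eq:
  assumes f: "UD v f" and g: "UD v g" and z: "z \<in> Zp v"
  shows "qotimes p v q f (vderiv v g) z = qfactor\<^sup>2 * cconv f (vderiv v g) z"
proof -
  define F where "F = (SOME F. UD v F \<and> (\<forall>x\<in>Zp v. vderiv v F x = f x))"
  define G where "G = (SOME G. UD v G \<and> (\<forall>x\<in>Zp v. vderiv v G x = vderiv v g x))"
  obtain F0 where "UDd F0 f"
    using antiderivative_ex[OF UDd_imp_ucont[OF UDd_vderiv[OF f]]] by blast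
  then have "UD v F0 \<and> (\<forall>x\<in>Zp v. vderiv v F0 x = f x)"
    using UDd_imp_UD UDd_imp_vderiv by blast
  then have F: "UD v F \<and> (\<forall>x\<in>Zp v. vderiv v F x = f x)"
    unfolding F_def by (rule someI[of "\<lambda>F. UD v F \<and> (\<forall>x\<in>Zp v. vderiv v F x = f x)"])
  have G: "UD v G \<and> (\<forall>x\<in>Zp v. vderiv v G x = vderiv v g x)"
    unfolding G_def
    by (rule someI[of "\<lambda>G. UD v G \<and> (\<forall>x\<in>Zp v. vderiv v G x = vderiv v g x)" g]) (use g in simp)
  have "vderiv v (qconv p v q F G) z = - (qfactor\<^sup>2 * cconv (vderiv v F) (vderiv v G) z)"
    using F G by (intro vderiv_qconv UDd_vderiv z) auto
  also have "cconv (vderiv v F) (vderiv v G) z = cconv f (vderiv v g) z"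
    using F G by (intro cconv_cong) auto
  finally show ?thesis by (simp add: qotimes_def F_def G_def)
qed

text \<open>With \<open>c = qfactor\<close>, \<open>H\<close> the limit of \<open>dconv\<close> and
  \<open>X\<close> the value of \<open>cconv\<close>, the three terms are \<open>c ^ 2 * H\<close>,
  \<open>c * (c * (H + X))\<close> and \<open>c ^ 2 * X\<close>. One factor \<open>c\<close> on the
  right is explicit and the other comes from the q-integral, whose weight is cancelled by
  \<open>q ^ (- x)\<close>.\<close>

lemma qconv_formula:
  assumes f: "UD v f" and g: "UD v g" and z: "z \<in> Zp v"
  shows "qconv p v q f g z = (q - 1) / vlog v q * Iq p v q (\<lambda>x. f x * g (z - x) * qpow v q (- x))
    - qotimes p v q f (vderiv v g) z"
proof -
  note fd = UDd_vderiv[OF f] and gd = UDd_vderiv[OF g]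
  let ?X = "cconv f (vderiv v g) z"
  obtain H where H: "vtendsto v (\<lambda>n. dconv f g n (trunc n z)) H"
    using dconv_UDd[OF fd gd] z by blast
  \<comment> \<open>Adding the two known limits back to the null sequence shows that the mean itself
    converges, with limit \<open>H + X\<close>.\<close>
  have "vtendsto v (\<lambda>n. mean (\<lambda>a. f (of_nat a) * g (z - of_nat a)) n
    - dconv f g n (trunc n z) - csum f (vderiv v g) (trunc n z)
    + (dconv f g n (trunc n z) + csum f (vderiv v g) (trunc n z))) (0 + (H + ?X))"
    by (intro vtendsto_add dconv_vs_mean[OF fd gd z] H cconv_tendsto z
        UDd_imp_ucont[OF fd] UDd_imp_ucont_deriv[OF gd])
  then have "vtendsto v (mean (\<lambda>a. f (of_nat a) * g (z - of_nat a))) (H + ?X)" by simp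
  moreover have "q \<noteq> 0" using v_principal_unit[OF q] by auto
  ultimately have "vtendsto v (mean (\<lambda>x. f (of_nat x) * g (z - of_nat x) * qpow v q (- of_nat x) * q ^ x)) (H + ?X)"
    by (simp add: qpow_minus_of_nat mult.assoc)
  from Iq_eq[OF this] have "Iq p v q (\<lambda>x. f x * g (z - x) * qpow v q (- x)) = qfactor * (H + ?X)" .
  then show ?thesis
    unfolding qconv_eq[OF fd gd z H] qotimes_eq[OF assms] qfactor_def[symmetric]
    by (simp add: power2_eq_square algebra_simps)
qed

end

end

theorem theorem2:
  fixes p :: nat and v :: "'a::field_char_0 \<Rightarrow> real" and q z :: 'a and f g :: "'a \<Rightarrow> 'a"
  assumes "is_Cp p v"
    and "v (q - 1) < real p powr (- 1 / (real p - 1))"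
    and "q \<noteq> 1"
    and "UD v f" and "UD v g"
    and "z \<in> Zp v"
  shows "qconv p v q f g z =
           (q - 1) / vlog v q * Iq p v q (\<lambda>x. f x * g (z - x) * qpow v q (- x))
           - qotimes p v q f (vderiv v g) z"
proof -
  interpret Cp p v by standard (rule assms(1))
  show ?thesis
    using assms(2) by (intro qconv_formula assms(3-)) (simp add: er_def)
qed

end
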